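(* Let $n$ be a positive integer, let $A$ be a projective $C^*$-algebra and let $\alpha:A\to\mathbf{M}_n(\mathbb{C})$ be a representation (i.e. a $*$-homomorphism). Then the $C^*$-algebra $\mathbf{W}_\alpha(A)$ is projective.
   Context: $C^*$-algebras need not be unital. A $C^*$-algebra $P$ is projective if for every surjective $*$-homomorphism $\rho:B\to D$ of $C^*$-algebras and every $*$-homomorphism $\varphi:P\to D$ there is a $*$-homomorphism $\bar\varphi:P\to B$ with $\rho\circ\bar\varphi=\varphi$. For a $C^*$-algebra $B$, $\widetilde{B}$ denotes its unitization, in which a unit $\mathbb{1}$ is adjoined even when $B$ is already unital. Write $\overline{n}=\{1,\ldots,n\}$, and for $a\in A$ let $\alpha_{ij}(a)$ be the $(i,j)$ entry of $\alpha(a)$. $\mathbf{W}_\alpha(A)$ is the universal $C^*$-algebra $$C^*\left\langle A\times\overline{n}\times\overline{n}\ \middle|\ a\mapsto[\alpha_{ij}(a)\mathbb{1}+(a,i,j)]_{i,j}\text{ is a }*\text{-homomorphism}\right\rangle .$$ That is, $\mathbf{W}_\alpha(A)$ comes with a function $\iota:A\times\overline{n}\times\overline{n}\to\mathbf{W}_\alpha(A)$ such that, for every $C^*$-algebra $B$, $\varphi\mapsto\varphi\circ\iota$ is a bijection from the $*$-homomorphisms $\mathbf{W}_\alpha(A)\to B$ onto the set of functions $f:A\times\overline{n}\times\overline{n}\to B$ for which $a\mapsto[\alpha_{ij}(a)\mathbb{1}+f(a,i,j)]_{i,j}$ is a $*$-homomorphism $A\to\mathbf{M}_n(\widetilde{B})$.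 (Such a universal $C^*$-algebra exists.) *)

theory Defs
  imports Complex_Main "HOL-Library.FuncSet" "HOL-Algebra.FiniteProduct"
begin

section \<open>Complex *-algebras and C*-algebras\<close>

text \<open>
  Algebras are records with an explicit carrier, so that statements can quantify over all
  algebras living in a given type. No unit is required.
\<close>

record 'a star_algebra = "'a partial_object" +
  vadd :: "'a \<Rightarrow> 'a \<Rightarrow> 'a" (infixl "\<boxplus>\<index>" 65)
  vzero :: 'a
  amult :: "'a \<Rightarrow> 'a \<Rightarrow> 'a" (infixl "\<boxtimes>\<index>" 70)
  cscale :: "complex \<Rightarrow> 'a \<Rightarrow> 'a" (infixr "\<boxdot>\<index>" 75)
  adj :: "'a \<Rightarrow> 'a"

record 'a cstar_algebra = "'a star_algebra" +
  anorm :: "'a \<Rightarrow> real"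

definition add_group :: "('a, 'm) star_algebra_scheme \<Rightarrow> 'a monoid" where
  "add_group A = \<lparr>carrier = carrier A, mult = vadd A, one = vzero A\<rparr>"

locale star_algebra =
  fixes A :: "('a, 'm) star_algebra_scheme" (structure)
  assumes additive_group: "comm_group (add_group A)"
    and scale_closed: "x \<in> carrier A \<Longrightarrow> c \<boxdot> x \<in> carrier A"
    and scale_add_right: "\<lbrakk>x \<in> carrier A; y \<in> carrier A\<rbrakk> \<Longrightarrow> c \<boxdot> (x \<boxplus> y) = c \<boxdot> x \<boxplus> c \<boxdot> y"
    and scale_add_left: "x \<in> carrier A \<Longrightarrow> (c + d) \<boxdot> x = c \<boxdot> x \<boxplus> d \<boxdot> x"
    and scale_scale: "x \<in> carrier A \<Longrightarrow> c \<boxdot> d \<boxdot> x = (c * d) \<boxdot> x"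
    and scale_one: "x \<in> carrier A \<Longrightarrow> 1 \<boxdot> x = x"
    and mult_closed: "\<lbrakk>x \<in> carrier A; y \<in> carrier A\<rbrakk> \<Longrightarrow> x \<boxtimes> y \<in> carrier A"
    and mult_assoc: "\<lbrakk>x \<in> carrier A; y \<in> carrier A; z \<in> carrier A\<rbrakk>
      \<Longrightarrow> (x \<boxtimes> y) \<boxtimes> z = x \<boxtimes> (y \<boxtimes> z)"
    and distrib_right: "\<lbrakk>x \<in> carrier A; y \<in> carrier A; z \<in> carrier A\<rbrakk>
      \<Longrightarrow> (x \<boxplus> y) \<boxtimes> z = x \<boxtimes> z \<boxplus> y \<boxtimes> z"
    and distrib_left: "\<lbrakk>x \<in> carrier A; y \<in> carrier A; z \<in> carrier A\<rbrakk>
      \<Longrightarrow> x \<boxtimes> (y \<boxplus> z) = x \<boxtimes> y \<boxplus> x \<boxtimes> z"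
    and scale_mult_left: "\<lbrakk>x \<in> carrier A; y \<in> carrier A\<rbrakk> \<Longrightarrow> (c \<boxdot> x) \<boxtimes> y = c \<boxdot> (x \<boxtimes> y)"
    and scale_mult_right: "\<lbrakk>x \<in> carrier A; y \<in> carrier A\<rbrakk> \<Longrightarrow> x \<boxtimes> (c \<boxdot> y) = c \<boxdot> (x \<boxtimes> y)"
    and adj_closed: "x \<in> carrier A \<Longrightarrow> adj A x \<in> carrier A"
    and adj_adj: "x \<in> carrier A \<Longrightarrow> adj A (adj A x) = x"
    and adj_add: "\<lbrakk>x \<in> carrier A; y \<in> carrier A\<rbrakk> \<Longrightarrow> adj A (x \<boxplus> y) = adj A x \<boxplus> adj A y"
    and adj_scale: "x \<in> carrier A \<Longrightarrow> adj A (c \<boxdot> x) = cnj c \<boxdot> adj A x"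
    and adj_mult: "\<lbrakk>x \<in> carrier A; y \<in> carrier A\<rbrakk> \<Longrightarrow> adj A (x \<boxtimes> y) = adj A y \<boxtimes> adj A x"

definition adist :: "('a, 'm) cstar_algebra_scheme \<Rightarrow> 'a \<Rightarrow> 'a \<Rightarrow> real" where
  "adist A x y = anorm A (x \<boxplus>\<^bsub>A\<^esub> (-1) \<boxdot>\<^bsub>A\<^esub> y)"

locale cstar_algebra = star_algebra A
  for A :: "('a, 'm) cstar_algebra_scheme" (structure) +
  assumes norm_eq_zero: "x \<in> carrier A \<Longrightarrow> anorm A x = 0 \<longleftrightarrow> x = vzero A"
    and norm_triangle: "\<lbrakk>x \<in> carrier A; y \<in> carrier A\<rbrakk>
      \<Longrightarrow> anorm A (x \<boxplus> y) \<le> anorm A x + anorm A y"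
    and norm_scale: "x \<in> carrier A \<Longrightarrow> anorm A (c \<boxdot> x) = cmod c * anorm A x"
    and norm_mult: "\<lbrakk>x \<in> carrier A; y \<in> carrier A\<rbrakk>
      \<Longrightarrow> anorm A (x \<boxtimes> y) \<le> anorm A x * anorm A y"
    and norm_cstar: "x \<in> carrier A \<Longrightarrow> anorm A (adj A x \<boxtimes> x) = (anorm A x)\<^sup>2"
    and complete: "\<lbrakk>\<And>k. s k \<in> carrier A;
        \<And>e. e > 0 \<Longrightarrow> \<exists>N. \<forall>k\<ge>N. \<forall>l\<ge>N. adist A (s k) (s l) < e\<rbrakk>
      \<Longrightarrow> \<exists>x\<in>carrier A. (\<lambda>k. adist A (s k) x) \<longlonglongrightarrow> 0"

text \<open>
  Maps are extensional (\<open>undefined\<close> off the carrier), so that equality of homomorphisms is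
  equality of HOL functions. As usual, a *-homomorphism is a purely algebraic notion.
\<close>

definition star_homs ::
    "('a, 'm) star_algebra_scheme \<Rightarrow> ('b, 'k) star_algebra_scheme \<Rightarrow> ('a \<Rightarrow> 'b) set" where
  "star_homs A B = {\<phi> \<in> carrier A \<rightarrow>\<^sub>E carrier B.
     (\<forall>x\<in>carrier A. \<forall>y\<in>carrier A. \<phi> (x \<boxplus>\<^bsub>A\<^esub> y) = \<phi> x \<boxplus>\<^bsub>B\<^esub> \<phi> y) \<and>
     (\<forall>c. \<forall>x\<in>carrier A. \<phi> (c \<boxdot>\<^bsub>A\<^esub> x) = c \<boxdot>\<^bsub>B\<^esub> \<phi> x) \<and>
     (\<forall>x\<in>carrier A. \<forall>y\<in>carrier A. \<phi> (x \<boxtimes>\<^bsub>A\<^esub> y) = \<phi> x \<boxtimes>\<^bsub>B\<^esub> \<phi> y) \<and>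
     (\<forall>x\<in>carrier A. \<phi> (adj A x) = adj B (\<phi> x))}"

section \<open>Projectivity\<close>

text \<open>
  HOL cannot quantify over types inside a formula, so ``every C*-algebra'' is rendered as
  ``every C*-algebra with carrier in the type \<open>'u\<close>'', where \<open>'u\<close> is an arbitrary type passed
  as a parameter and plays the role of a universe. Projectivity in the usual sense is
  projectivity for every \<open>'u\<close>.
\<close>

definition projective :: "'u itself \<Rightarrow> 'p cstar_algebra \<Rightarrow> bool" where
  "projective U P \<longleftrightarrow> cstar_algebra P \<and>
     (\<forall>(B :: 'u cstar_algebra) (D :: 'u cstar_algebra).
        cstar_algebra B \<and> cstar_algebra D \<longrightarrow>
        (\<forall>\<rho>\<in>star_homs B D. \<rho> ` carrier B = carrier D \<longrightarrow>
          (\<forall>\<phi>\<in>star_homs P D. \<exists>\<psi>\<in>star_homs P B. compose (carrier P) \<rho> \<psi> = \<phi>)))"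

section \<open>Unitization and matrix algebras\<close>

text \<open>
  The algebras below are only given as *-algebras. The C*-norm on the unitization of a C*-algebra
  and on matrices over it exists and is unique, but *-homomorphisms do not refer to it.
\<close>

definition complex_alg :: "complex star_algebra" where
  "complex_alg = \<lparr>carrier = UNIV, vadd = (+), vzero = 0, amult = (*), cscale = (*), adj = cnj\<rparr>"

text \<open>The pair \<open>(b, c)\<close> stands for \<open>b + c 1\<close>, where \<open>1\<close> is the new unit.\<close>

definition unitization :: "('b, 'm) star_algebra_scheme \<Rightarrow> ('b \<times> complex) star_algebra" where
  "unitization B = \<lparr>carrier = carrier B \<times> UNIV,
     vadd = (\<lambda>(x, c) (y, d). (x \<boxplus>\<^bsub>B\<^esub> y, c + d)),
     vzero = (vzero B, 0),
     amult = (\<lambda>(x, c) (y, d). (x \<boxtimes>\<^bsub>B\<^esub> y \<boxplus>\<^bsub>B\<^esub> c \<boxdot>\<^bsub>B\<^esub> y \<boxplus>\<^bsub>B\<^esub> d \<boxdot>\<^bsub>B\<^esub> x, c * d)),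
     cscale = (\<lambda>a (x, c). (a \<boxdot>\<^bsub>B\<^esub> x, a * c)),
     adj = (\<lambda>(x, c). (adj B x, cnj c))\<rparr>"

definition new_unit :: "('b, 'm) star_algebra_scheme \<Rightarrow> 'b \<times> complex" where
  "new_unit B = (vzero B, 1)"

definition unit_embed :: "'b \<Rightarrow> 'b \<times> complex" where
  "unit_embed b = (b, 0)"

text \<open>
  An \<open>n\<close> by \<open>n\<close> matrix is an extensional function on pairs of indices in \<open>{1..n}\<close>. The
  \<open>finprod\<close> over the additive group is the sum over \<open>k\<close> of the products of entries.
\<close>

definition mat_alg :: "nat \<Rightarrow> ('b, 'm) star_algebra_scheme \<Rightarrow> (nat \<times> nat \<Rightarrow> 'b) star_algebra" where
  "mat_alg n B = \<lparr>carrier = {1..n} \<times> {1..n} \<rightarrow>\<^sub>E carrier B,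
     vadd = (\<lambda>M N. \<lambda>(i, j)\<in>{1..n} \<times> {1..n}. M (i, j) \<boxplus>\<^bsub>B\<^esub> N (i, j)),
     vzero = (\<lambda>(i, j)\<in>{1..n} \<times> {1..n}. vzero B),
     amult = (\<lambda>M N. \<lambda>(i, j)\<in>{1..n} \<times> {1..n}.
       finprod (add_group B) (\<lambda>k. M (i, k) \<boxtimes>\<^bsub>B\<^esub> N (k, j)) {1..n}),
     cscale = (\<lambda>c M. \<lambda>(i, j)\<in>{1..n} \<times> {1..n}. c \<boxdot>\<^bsub>B\<^esub> M (i, j)),
     adj = (\<lambda>M. \<lambda>(i, j)\<in>{1..n} \<times> {1..n}. adj B (M (j, i)))\<rparr>"

section \<open>The universal algebra\<close>

definition W_map ::
    "nat \<Rightarrow> 'a cstar_algebra \<Rightarrow> ('a \<Rightarrow> nat \<times> nat \<Rightarrow> complex) \<Rightarrow> 'b cstar_algebra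
      \<Rightarrow> ('a \<times> nat \<times> nat \<Rightarrow> 'b) \<Rightarrow> 'a \<Rightarrow> nat \<times> nat \<Rightarrow> 'b \<times> complex" where
  "W_map n A \<alpha> B f = (\<lambda>a\<in>carrier A. \<lambda>(i, j)\<in>{1..n} \<times> {1..n}.
     \<alpha> a (i, j) \<boxdot>\<^bsub>unitization B\<^esub> new_unit B \<boxplus>\<^bsub>unitization B\<^esub> unit_embed (f (a, i, j)))"

definition W_functions ::
    "nat \<Rightarrow> 'a cstar_algebra \<Rightarrow> ('a \<Rightarrow> nat \<times> nat \<Rightarrow> complex) \<Rightarrow> 'b cstar_algebra
      \<Rightarrow> ('a \<times> nat \<times> nat \<Rightarrow> 'b) set" where
  "W_functions n A \<alpha> B = {f \<in> carrier A \<times> {1..n} \<times> {1..n} \<rightarrow>\<^sub>E carrier B.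
     W_map n A \<alpha> B f \<in> star_homs A (mat_alg n (unitization B))}"

text \<open>
  \<open>W\<close> together with \<open>\<iota>\<close> is the universal C*-algebra attached to \<open>\<alpha>\<close>; the universal property
  is again tested on the C*-algebras with carrier in the type \<open>'u\<close>.
\<close>

definition is_W ::
    "'u itself \<Rightarrow> nat \<Rightarrow> 'a cstar_algebra \<Rightarrow> ('a \<Rightarrow> nat \<times> nat \<Rightarrow> complex)
      \<Rightarrow> 'w cstar_algebra \<Rightarrow> ('a \<times> nat \<times> nat \<Rightarrow> 'w) \<Rightarrow> bool" where
  "is_W U n A \<alpha> W \<iota> \<longleftrightarrow> cstar_algebra W \<and>
     \<iota> \<in> carrier A \<times> {1..n} \<times> {1..n} \<rightarrow> carrier W \<and>
     (\<forall>B :: 'u cstar_algebra. cstar_algebra B \<longrightarrow>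
       bij_betw (\<lambda>\<phi>. compose (carrier A \<times> {1..n} \<times> {1..n}) \<phi> \<iota>)
         (star_homs W B) (W_functions n A \<alpha> B))"

end

theory Submission
  imports Defs "HOL-Algebra.Ring"
begin

text \<open>
  Let \<open>\<rho> : B \<rightarrow> D\<close> be surjective and \<open>\<phi> : W \<rightarrow> D\<close> a *-homomorphism. By the universal property \<open>\<phi>\<close> is the
  same thing as a *-homomorphism \<open>A \<rightarrow> M\<^sub>n(D~)\<close> with scalar part \<open>\<alpha>\<close>, where \<open>D~\<close> is the unitization.
  The map \<open>M\<^sub>n(\<rho>~) : M\<^sub>n(B~) \<rightarrow> M\<^sub>n(D~)\<close> is again surjective, so projectivity of \<open>A\<close> gives a lift
  \<open>A \<rightarrow> M\<^sub>n(B~)\<close>. As \<open>\<rho>~\<close> does not change scalar parts, the lift has scalar part \<open>\<alpha>\<close> too; hence it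
  comes from a *-homomorphism \<open>\<psi> : W \<rightarrow> B\<close>, and \<open>\<rho> \<circ> \<psi> = \<phi>\<close> because both sides correspond to the same
  map into \<open>M\<^sub>n(D~)\<close>.

  Projectivity of \<open>A\<close> may be used only between C*-algebras with carrier in the universe \<open>'u\<close>, which
  leaves two things to prove.

  The *-algebra \<open>M\<^sub>n(B~)\<close> has a complete C*-norm (\<open>ex_norm_mat_unitization\<close>). Both steps use the same
  device (\<open>cstar_algebra_op_norm\<close>): if a *-algebra acts boundedly on a normed set in such a way that
  \<open>\<parallel>x v\<parallel>\<^sup>2 \<le> \<parallel>v\<parallel> \<parallel>x* x v\<parallel>\<close>, then the operator norm is a C*-seminorm. For \<open>B~\<close> the set is the disjoint
  union of \<open>B\<close> and the complex numbers. For \<open>M\<^sub>n(U)\<close> with \<open>U\<close> unital it is the Hilbert module \<open>U\<^sup>n\<close>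
  with inner product \<open>\<langle>v, w\<rangle> = \<Sum> v\<^sub>i* w\<^sub>i\<close>, and the required inequality is the Cauchy-Schwarz inequality
  (\<open>ip_Cauchy_Schwarz\<close>). This rests on positivity in \<open>U\<close>, namely that \<open>a* a\<close> is positive
  (\<open>pos_st_mult\<close>) and that the norm is monotone on positive elements (\<open>nm_mono\<close>). These facts are
  derived without spectra or functional calculus from a single square root, that of \<open>1 - x\<close> for
  self-adjoint \<open>x\<close> with \<open>\<parallel>x\<parallel> \<le> 1\<close> (\<open>sqrt_one_minus\<close>).

  The carrier of \<open>M\<^sub>n(B~)\<close> must be placed in \<open>'u\<close>. If \<open>B\<close> is nonzero, it contains a copy of the complex
  numbers, so it is infinite and \<open>M\<^sub>n(B~)\<close> and \<open>M\<^sub>n(D~)\<close> inject into \<open>B\<close>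
  (\<open>mat_unitization_embedding\<close>); the algebras are then transported along the injections
  (\<open>projective_lift\<close>). If \<open>B = 0\<close> then \<open>D = 0\<close> and there is nothing to lift.
\<close>

section \<open>Unital C*-algebras as rings, and a square root\<close>

text \<open>
  A unital C*-algebra presented as a ring: \<open>st\<close> is the involution, \<open>nm\<close> the norm, and \<open>sc c\<close> stands for
  the scalar multiple \<open>c 1\<close> of the unit, so that \<open>sc c \<otimes> x\<close> is the scalar multiple \<open>c x\<close>. Keeping
  scalars inside the ring makes the ring simplification procedures applicable. The unit may be zero.
\<close>

locale unital_cstar_ring = ring R for R (structure) +
  fixes st :: "'a \<Rightarrow> 'a" and nm :: "'a \<Rightarrow> real" and sc :: "complex \<Rightarrow> 'a"
  assumes sc_closed [simp]: "sc c \<in> carrier R"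
    and sc_add: "sc (c + d) = sc c \<oplus> sc d"
    and sc_mult: "sc (c * d) = sc c \<otimes> sc d"
    and sc_1 [simp]: "sc 1 = \<one>"
    and sc_central: "x \<in> carrier R \<Longrightarrow> x \<otimes> sc c = sc c \<otimes> x"
    and st_closed [simp]: "x \<in> carrier R \<Longrightarrow> st x \<in> carrier R"
    and st_st [simp]: "x \<in> carrier R \<Longrightarrow> st (st x) = x"
    and st_add: "\<lbrakk>x \<in> carrier R; y \<in> carrier R\<rbrakk> \<Longrightarrow> st (x \<oplus> y) = st x \<oplus> st y"
    and st_mult: "\<lbrakk>x \<in> carrier R; y \<in> carrier R\<rbrakk> \<Longrightarrow> st (x \<otimes> y) = st y \<otimes> st x"
    and st_sc: "st (sc c) = sc (cnj c)"
    and nm_eq_0: "x \<in> carrier R \<Longrightarrow> nm x = 0 \<longleftrightarrow> x = \<zero>"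
    and nm_triangle: "\<lbrakk>x \<in> carrier R; y \<in> carrier R\<rbrakk> \<Longrightarrow> nm (x \<oplus> y) \<le> nm x + nm y"
    and nm_sc: "x \<in> carrier R \<Longrightarrow> nm (sc c \<otimes> x) = cmod c * nm x"
    and nm_mult: "\<lbrakk>x \<in> carrier R; y \<in> carrier R\<rbrakk> \<Longrightarrow> nm (x \<otimes> y) \<le> nm x * nm y"
    and nm_cstar: "x \<in> carrier R \<Longrightarrow> nm (st x \<otimes> x) = (nm x)\<^sup>2"
    and nm_complete: "\<lbrakk>\<And>k. s k \<in> carrier R;
        \<And>e. e > 0 \<Longrightarrow> \<exists>N. \<forall>k\<ge>N. \<forall>l\<ge>N. nm (s k \<ominus> s l) < e\<rbrakk>
      \<Longrightarrow> \<exists>x\<in>carrier R. (\<lambda>k. nm (s k \<ominus> x)) \<longlonglongrightarrow> 0"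
begin

lemma sc_0 [simp]: "sc 0 = \<zero>"
proof -
  have "sc 0 \<oplus> sc 0 = sc 0"
    by (metis sc_add add_0)
  then show ?thesis
    by (metis sc_closed add.r_cancel_one)
qed

lemma sc_minus: "sc (- c) = \<ominus> sc c"
proof -
  have "sc (- c) \<oplus> sc c = \<zero>"
    by (metis sc_add sc_0 add.left_inverse)
  then show ?thesis
    by (simp add: minus_equality)
qed

lemma sc_minus_1 [simp]: "x \<in> carrier R \<Longrightarrow> sc (- 1) \<otimes> x = \<ominus> x"
  by (simp add: sc_minus l_minus)

lemma sc_sc: "x \<in> carrier R \<Longrightarrow> sc c \<otimes> (sc d \<otimes> x) = sc (c * d) \<otimes> x"
  by (simp add: sc_mult m_assoc)

lemma sc_mult_right: "\<lbrakk>x \<in> carrier R; y \<in> carrier R\<rbrakk> \<Longrightarrow> x \<otimes> (sc c \<otimes> y) = sc c \<otimes> (x \<otimes> y)"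
  by (metis m_assoc sc_central sc_closed)

lemma sc_mult_sc: "\<lbrakk>x \<in> carrier R; y \<in> carrier R\<rbrakk> \<Longrightarrow> (sc c \<otimes> x) \<otimes> (sc d \<otimes> y) = sc (c * d) \<otimes> (x \<otimes> y)"
  by (metis m_assoc sc_mult sc_closed m_closed sc_mult_right)

lemma sc_2: "x \<in> carrier R \<Longrightarrow> sc 2 \<otimes> x = x \<oplus> x"
  by (metis l_distr l_one one_add_one one_closed sc_1 sc_add)

lemma sc_half_double: "x \<in> carrier R \<Longrightarrow> sc (1/2) \<otimes> (x \<oplus> x) = x"
  by (metis sc_2 sc_sc sc_1 l_one nonzero_eq_divide_eq zero_neq_numeral)

lemma nm_0 [simp]: "nm \<zero> = 0"
  by (simp add: nm_eq_0)

lemma nm_minus [simp]: "x \<in> carrier R \<Longrightarrow> nm (\<ominus> x) = nm x"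
  using nm_sc[of x "-1"] by simp

lemma nm_nonneg [simp]: "x \<in> carrier R \<Longrightarrow> 0 \<le> nm x"
  using nm_triangle[of x "\<ominus> x"] by (simp add: r_neg)

lemma st_0 [simp]: "st \<zero> = \<zero>"
  by (metis complex_cnj_zero sc_0 st_sc)

lemma st_1 [simp]: "st \<one> = \<one>"
  by (metis complex_cnj_one sc_1 st_sc)

lemma st_minus: "x \<in> carrier R \<Longrightarrow> st (\<ominus> x) = \<ominus> st x"
  using st_mult[of "sc (-1)" x] by (simp add: st_sc sc_central)

lemma st_diff: "\<lbrakk>x \<in> carrier R; y \<in> carrier R\<rbrakk> \<Longrightarrow> st (x \<ominus> y) = st x \<ominus> st y"
  by (simp add: a_minus_def st_add st_minus)

lemma nm_le_nm_st: "x \<in> carrier R \<Longrightarrow> nm x \<le> nm (st x)"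
proof -
  assume x: "x \<in> carrier R"
  have "nm x * nm x \<le> nm (st x) * nm x"
    using nm_cstar[OF x] nm_mult[of "st x" x] x by (simp add: power2_eq_square)
  then show ?thesis
    using nm_nonneg[OF x] nm_nonneg[of "st x"] x by (metis mult_right_le_imp_le order.order_iff_strict st_closed)
qed

lemma nm_st [simp]: "x \<in> carrier R \<Longrightarrow> nm (st x) = nm x"
  using nm_le_nm_st[of x] nm_le_nm_st[of "st x"] by simp

lemma nm_one_le: "nm \<one> \<le> 1"
proof -
  have "nm \<one> = nm \<one> * nm \<one>"
    using nm_cstar[of \<one>] by (simp add: power2_eq_square)
  then show ?thesis
    by (metis linorder_not_le mult_cancel_right1 order_refl zero_le_one)
qed

lemma nm_sc_le: "nm (sc c) \<le> cmod c"
  using nm_sc[of \<one> c] nm_one_le by (simp add: mult_left_le)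

lemma nm_diff_commute: "\<lbrakk>x \<in> carrier R; y \<in> carrier R\<rbrakk> \<Longrightarrow> nm (x \<ominus> y) = nm (y \<ominus> x)"
proof -
  assume xy: "x \<in> carrier R" "y \<in> carrier R"
  then have "x \<ominus> y = \<ominus> (y \<ominus> x)" by algebra
  then show ?thesis using xy by simp
qed

lemma nm_diff_triangle:
  assumes "x \<in> carrier R" "y \<in> carrier R" "z \<in> carrier R"
  shows "nm (x \<ominus> z) \<le> nm (x \<ominus> y) + nm (y \<ominus> z)"
proof -
  have "x \<ominus> z = (x \<ominus> y) \<oplus> (y \<ominus> z)" using assms by algebra
  then show ?thesis using nm_triangle[of "x \<ominus> y" "y \<ominus> z"] assms by simp
qed

lemma eq_if_nm_diff: "\<lbrakk>x \<in> carrier R; y \<in> carrier R; nm (x \<ominus> y) = 0\<rbrakk> \<Longrightarrow> x = y"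
proof -
  assume xy: "x \<in> carrier R" "y \<in> carrier R" and "nm (x \<ominus> y) = 0"
  then have "x \<ominus> y = \<zero>" by (simp add: nm_eq_0)
  moreover have "x = (x \<ominus> y) \<oplus> y" using xy by algebra
  ultimately show "x = y" using xy by simp
qed

text \<open>Convergence in norm of a sequence, including the membership of all terms and of the limit.\<close>

definition tends :: "(nat \<Rightarrow> 'a) \<Rightarrow> 'a \<Rightarrow> bool" where
  "tends s x \<longleftrightarrow> (\<forall>k. s k \<in> carrier R) \<and> x \<in> carrier R \<and> (\<lambda>k. nm (s k \<ominus> x)) \<longlonglongrightarrow> 0"

lemma tendsI:
  assumes "\<And>k. s k \<in> carrier R" "x \<in> carrier R" "\<And>k. nm (s k \<ominus> x) \<le> f k" "f \<longlonglongrightarrow> 0"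
  shows "tends s x"
  unfolding tends_def
  using assms by (auto intro: tendsto_sandwich[OF _ _ tendsto_const assms(4)])

lemma tends_const: "x \<in> carrier R \<Longrightarrow> tends (\<lambda>k. x) x"
  by (rule tendsI[of _ _ "\<lambda>k. 0"]) (auto simp: a_minus_def r_neg)

lemma tends_unique:
  assumes "tends s x" "tends s y"
  shows "x = y"
proof -
  have c: "\<And>k. s k \<in> carrier R" "x \<in> carrier R" "y \<in> carrier R"
    using assms by (auto simp: tends_def)
  have "(\<lambda>k. nm (s k \<ominus> x) + nm (s k \<ominus> y)) \<longlonglongrightarrow> 0 + 0"
    using assms by (intro tendsto_add) (auto simp: tends_def)
  moreover have "nm (x \<ominus> y) \<le> nm (s k \<ominus> x) + nm (s k \<ominus> y)" for k
    using nm_diff_triangle[of x "s k" y] c nm_diff_commute[of x "s k"] by simp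
  ultimately have "nm (x \<ominus> y) \<le> 0"
    by (intro LIMSEQ_le_const) auto
  moreover have "0 \<le> nm (x \<ominus> y)" using c by simp
  ultimately show ?thesis using c by (intro eq_if_nm_diff) linarith+
qed

lemma tends_add:
  assumes "tends s x" "tends t y"
  shows "tends (\<lambda>k. s k \<oplus> t k) (x \<oplus> y)"
proof (rule tendsI)
  have c: "\<And>k. s k \<in> carrier R" "x \<in> carrier R" "\<And>k. t k \<in> carrier R" "y \<in> carrier R"
    using assms by (auto simp: tends_def)
  show "s k \<oplus> t k \<in> carrier R" "x \<oplus> y \<in> carrier R" for k using c by auto
  show "nm (s k \<oplus> t k \<ominus> (x \<oplus> y)) \<le> nm (s k \<ominus> x) + nm (t k \<ominus> y)" for k
  proof -
    have "s k \<oplus> t k \<ominus> (x \<oplus> y) = (s k \<ominus> x) \<oplus> (t k \<ominus> y)" using c(1)[of k] c(3)[of k] c(2,4) by algebra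
    then show ?thesis using c nm_triangle[of "s k \<ominus> x" "t k \<ominus> y"] by simp
  qed
  show "(\<lambda>k. nm (s k \<ominus> x) + nm (t k \<ominus> y)) \<longlonglongrightarrow> 0"
    using assms tendsto_add[of "\<lambda>k. nm (s k \<ominus> x)" 0 sequentially "\<lambda>k. nm (t k \<ominus> y)" 0]
    by (simp add: tends_def)
qed

lemma tends_mult:
  assumes "tends s x" "tends t y"
  shows "tends (\<lambda>k. s k \<otimes> t k) (x \<otimes> y)"
proof (rule tendsI)
  have c: "\<And>k. s k \<in> carrier R" "x \<in> carrier R" "\<And>k. t k \<in> carrier R" "y \<in> carrier R"
    using assms by (auto simp: tends_def)
  let ?f = "\<lambda>k. (nm (s k \<ominus> x) + nm x) * nm (t k \<ominus> y) + nm (s k \<ominus> x) * nm y"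
  show "s k \<otimes> t k \<in> carrier R" "x \<otimes> y \<in> carrier R" for k using c by auto
  show "nm (s k \<otimes> t k \<ominus> (x \<otimes> y)) \<le> ?f k" for k
  proof -
    have "s k \<otimes> t k \<ominus> (x \<otimes> y) = s k \<otimes> (t k \<ominus> y) \<oplus> (s k \<ominus> x) \<otimes> y"
      using c(1)[of k] c(3)[of k] c(2,4) by algebra
    then have 1: "nm (s k \<otimes> t k \<ominus> (x \<otimes> y)) \<le> nm (s k) * nm (t k \<ominus> y) + nm (s k \<ominus> x) * nm y"
      using c nm_triangle[of "s k \<otimes> (t k \<ominus> y)" "(s k \<ominus> x) \<otimes> y"]
        nm_mult[of "s k" "t k \<ominus> y"] nm_mult[of "s k \<ominus> x" y]
      by simp
    have "s k = (s k \<ominus> x) \<oplus> x" using c(1)[of k] c(2) by algebra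
    then have "nm (s k) \<le> nm (s k \<ominus> x) + nm x"
      using nm_triangle[of "s k \<ominus> x" x] c by simp
    then have "nm (s k) * nm (t k \<ominus> y) \<le> (nm (s k \<ominus> x) + nm x) * nm (t k \<ominus> y)"
      using c by (simp add: mult_right_mono)
    then show ?thesis using 1 by simp
  qed
  have "?f \<longlonglongrightarrow> (0 + nm x) * 0 + 0 * nm y"
    using assms by (intro tendsto_intros) (auto simp: tends_def)
  then show "?f \<longlonglongrightarrow> 0" by simp
qed

lemma tends_st:
  assumes "tends s x"
  shows "tends (\<lambda>k. st (s k)) (st x)"
proof (rule tendsI)
  have c: "\<And>k. s k \<in> carrier R" "x \<in> carrier R"
    using assms by (auto simp: tends_def)
  show "st (s k) \<in> carrier R" "st x \<in> carrier R" for k using c by auto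
  show "nm (st (s k) \<ominus> st x) \<le> nm (s k \<ominus> x)" for k
    using c nm_st[of "s k \<ominus> x"] by (simp add: st_diff)
  show "(\<lambda>k. nm (s k \<ominus> x)) \<longlonglongrightarrow> 0" using assms by (simp add: tends_def)
qed

lemma tends_nm_le:
  assumes "tends s x" "\<And>k. nm (s k) \<le> K"
  shows "nm x \<le> K"
proof -
  have c: "\<And>k. s k \<in> carrier R" "x \<in> carrier R"
    using assms by (auto simp: tends_def)
  have "(\<lambda>k. nm (s k \<ominus> x) + K) \<longlonglongrightarrow> 0 + K"
    using assms by (intro tendsto_intros) (auto simp: tends_def)
  moreover have "nm x \<le> nm (s k \<ominus> x) + K" for k
  proof -
    have "x = s k \<ominus> (s k \<ominus> x)" using c(1)[of k] c(2) by algebra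
    then have "nm x \<le> nm (s k) + nm (s k \<ominus> x)"
      using nm_triangle[of "s k" "\<ominus> (s k \<ominus> x)"] c by (simp add: a_minus_def)
    then show ?thesis using assms(2)[of k] by simp
  qed
  ultimately show ?thesis
    by (intro LIMSEQ_le_const) auto
qed

lemma tends_shift: "tends s x \<Longrightarrow> tends (\<lambda>k. s (Suc k)) x"
  unfolding tends_def by (auto intro: LIMSEQ_Suc)

text \<open>
  Self-adjoint elements of the carrier.
\<close>

definition sa :: "'a \<Rightarrow> bool" where
  "sa x \<longleftrightarrow> x \<in> carrier R \<and> st x = x"

lemma sa_closed [simp]: "sa x \<Longrightarrow> x \<in> carrier R"
  by (simp add: sa_def)

lemma sa_add: "\<lbrakk>sa x; sa y\<rbrakk> \<Longrightarrow> sa (x \<oplus> y)"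
  by (simp add: sa_def st_add)

lemma sa_diff: "\<lbrakk>sa x; sa y\<rbrakk> \<Longrightarrow> sa (x \<ominus> y)"
  by (simp add: sa_def st_diff)

lemma sa_one [simp]: "sa \<one>" and sa_zero [simp]: "sa \<zero>"
  by (simp_all add: sa_def)

lemma sa_sc: "sa x \<Longrightarrow> sa (sc (complex_of_real r) \<otimes> x)"
  by (simp add: sa_def st_mult st_sc sc_central)

lemma sa_of_real [simp]: "sa (sc (complex_of_real r))"
  by (simp add: sa_def st_sc)

lemma sa_mult: "\<lbrakk>sa x; sa y; x \<otimes> y = y \<otimes> x\<rbrakk> \<Longrightarrow> sa (x \<otimes> y)"
  by (simp add: sa_def st_mult)

lemma nm_sa_square: "sa x \<Longrightarrow> nm (x \<otimes> x) = (nm x)\<^sup>2"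
  using nm_cstar[of x] by (simp add: sa_def)

lemma sa_square_zero: "\<lbrakk>sa x; x \<otimes> x = \<zero>\<rbrakk> \<Longrightarrow> x = \<zero>"
  using nm_sa_square[of x] by (simp add: nm_eq_0)

text \<open>
  The iteration \<open>y \<mapsto> (x + y\<^sup>2) / 2\<close> started at \<open>0\<close>. A limit \<open>y\<close> satisfies \<open>2 y = x + y\<^sup>2\<close>, that is
  \<open>(1 - y)\<^sup>2 = 1 - x\<close>.
\<close>

primrec approx :: "'a \<Rightarrow> nat \<Rightarrow> 'a" where
  "approx x 0 = \<zero>"
| "approx x (Suc k) = sc (1/2) \<otimes> (x \<oplus> approx x k \<otimes> approx x k)"

end

text \<open>
  The same iteration for the real number \<open>x = 1\<close>. It increases and is bounded by \<open>1\<close>, and its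
  increments bound those of \<open>approx x\<close> for every \<open>x\<close> of norm at most \<open>1\<close>; this gives convergence
  even on the boundary of the unit ball.
\<close>

primrec approx_majorant :: "nat \<Rightarrow> real" where
  "approx_majorant 0 = 0"
| "approx_majorant (Suc k) = (1 + (approx_majorant k)\<^sup>2) / 2"

lemma approx_majorant_bounds: "0 \<le> approx_majorant k \<and> approx_majorant k \<le> 1"
proof (induction k)
  case (Suc k)
  have "(approx_majorant k)\<^sup>2 \<le> 1"
    using Suc by (simp add: power_le_one)
  then show ?case by simp
qed simp

lemma approx_majorant_incseq: "incseq approx_majorant"
proof (rule incseq_SucI)
  fix k
  have "0 \<le> (1 - approx_majorant k)\<^sup>2" by simp
  then show "approx_majorant k \<le> approx_majorant (Suc k)"
    by (simp add: power2_eq_square algebra_simps)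
qed

lemma approx_majorant_Cauchy: "Cauchy approx_majorant"
  by (rule convergent_Cauchy, rule Bseq_monoseq_convergent)
    (use approx_majorant_bounds in \<open>auto intro!: BseqI'[of _ 1] incseq_imp_monoseq approx_majorant_incseq\<close>)

context unital_cstar_ring
begin

lemma approx_closed [simp]: "x \<in> carrier R \<Longrightarrow> approx x k \<in> carrier R"
  by (induction k) auto

lemma approx_commute:
  assumes "x \<in> carrier R" "z \<in> carrier R" "z \<otimes> x = x \<otimes> z"
  shows "z \<otimes> approx x k = approx x k \<otimes> z"
proof (induction k)
  case (Suc k)
  let ?a = "approx x k"
  have a: "?a \<in> carrier R" using assms by simp
  have "z \<otimes> (?a \<otimes> ?a) = (?a \<otimes> ?a) \<otimes> z"
    using Suc a assms(2) by (metis m_assoc)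
  then have "z \<otimes> (x \<oplus> ?a \<otimes> ?a) = (x \<oplus> ?a \<otimes> ?a) \<otimes> z"
    using assms a by (simp add: r_distr l_distr)
  then show ?case
    using assms a by (simp add: sc_mult_right m_assoc)
qed (use assms in auto)

lemma approx_sa: "sa x \<Longrightarrow> sa (approx x k)"
  by (induction k) (auto intro!: sa_sc[of _ "1/2", simplified] sa_add sa_mult)

lemma approx_nm:
  assumes "x \<in> carrier R" "nm x \<le> 1"
  shows "nm (approx x k) \<le> approx_majorant k"
proof (induction k)
  case (Suc k)
  let ?a = "approx x k"
  have a: "?a \<in> carrier R" using assms by simp
  have "nm (?a \<otimes> ?a) \<le> (approx_majorant k)\<^sup>2"
    using nm_mult[OF a a] Suc nm_nonneg[OF a]
    by (smt (verit) mult_mono power2_eq_square)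
  then have "nm (x \<oplus> ?a \<otimes> ?a) \<le> 1 + (approx_majorant k)\<^sup>2"
    using nm_triangle[of x "?a \<otimes> ?a"] assms a by simp
  then show ?case using assms a by (simp add: nm_sc)
qed simp

lemma approx_step:
  assumes "x \<in> carrier R" "nm x \<le> 1"
  shows "nm (approx x (Suc k) \<ominus> approx x k) \<le> approx_majorant (Suc k) - approx_majorant k"
proof (induction k)
  case 0
  then show ?case using assms by (simp add: a_minus_def nm_sc)
next
  case (Suc k)
  let ?a = "approx x k" and ?b = "approx x (Suc k)"
  let ?r = "approx_majorant k" and ?s = "approx_majorant (Suc k)"
  have a: "?a \<in> carrier R" and b: "?b \<in> carrier R" using assms approx_closed by blast+
  have step: "approx x (Suc (Suc k)) = sc (1/2) \<otimes> (x \<oplus> ?b \<otimes> ?b)"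
    by (rule approx.simps)
  have stepk: "?b = sc (1/2) \<otimes> (x \<oplus> ?a \<otimes> ?a)"
    by (rule approx.simps)
  have "approx x (Suc (Suc k)) \<ominus> ?b = sc (1/2) \<otimes> ((x \<oplus> ?b \<otimes> ?b) \<ominus> (x \<oplus> ?a \<otimes> ?a))"
    unfolding step stepk[symmetric]
    using assms(1) a b stepk by (simp add: a_minus_def r_distr r_minus del: approx.simps)
  also have "(x \<oplus> ?b \<otimes> ?b) \<ominus> (x \<oplus> ?a \<otimes> ?a) = ?b \<otimes> (?b \<ominus> ?a) \<oplus> (?b \<ominus> ?a) \<otimes> ?a"
    using assms(1) a b by algebra
  finally have eq: "approx x (Suc (Suc k)) \<ominus> ?b
      = sc (1/2) \<otimes> (?b \<otimes> (?b \<ominus> ?a) \<oplus> (?b \<ominus> ?a) \<otimes> ?a)" .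
  have "nm (?b \<otimes> (?b \<ominus> ?a)) \<le> ?s * (?s - ?r)"
    using nm_mult[of ?b "?b \<ominus> ?a"] approx_nm[OF assms, of "Suc k"] Suc nm_nonneg[OF b] a b
    by (smt (verit) mult_mono minus_closed nm_nonneg)
  moreover have "nm ((?b \<ominus> ?a) \<otimes> ?a) \<le> (?s - ?r) * ?r"
    using nm_mult[of "?b \<ominus> ?a" ?a] approx_nm[OF assms, of k] Suc nm_nonneg[OF a] a b
    by (smt (verit) mult_mono minus_closed nm_nonneg)
  ultimately have "nm (?b \<otimes> (?b \<ominus> ?a) \<oplus> (?b \<ominus> ?a) \<otimes> ?a) \<le> ?s * (?s - ?r) + (?s - ?r) * ?r"
    using nm_triangle[of "?b \<otimes> (?b \<ominus> ?a)" "(?b \<ominus> ?a) \<otimes> ?a"] a b by (simp del: approx.simps)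
  also have "\<dots> = ?s\<^sup>2 - ?r\<^sup>2"
    by (simp add: power2_eq_square algebra_simps)
  finally have "nm (approx x (Suc (Suc k)) \<ominus> ?b) \<le> (?s\<^sup>2 - ?r\<^sup>2) / 2"
    unfolding eq using a b by (simp add: nm_sc del: approx.simps approx_majorant.simps)
  also have "\<dots> = approx_majorant (Suc (Suc k)) - ?s"
  proof -
    have "approx_majorant (Suc (Suc k)) = (1 + ?s\<^sup>2) / 2" "?s = (1 + ?r\<^sup>2) / 2"
      by (rule approx_majorant.simps)+
    then show ?thesis by (simp add: diff_divide_distrib add_divide_distrib)
  qed
  finally show ?case .
qed

lemma approx_diff:
  assumes "x \<in> carrier R" "nm x \<le> 1" "k \<le> l"
  shows "nm (approx x l \<ominus> approx x k) \<le> approx_majorant l - approx_majorant k"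
  using \<open>k \<le> l\<close>
proof (induction l rule: dec_induct)
  case base
  then show ?case using assms by (simp add: a_minus_def r_neg)
next
  case (step l)
  then show ?case
    using nm_diff_triangle[of "approx x (Suc l)" "approx x l" "approx x k"] approx_step[OF assms(1,2), of l]
      approx_closed[OF assms(1)]
    by (smt (verit))
qed

text \<open>
  The square root of \<open>1 - x\<close> commutes with everything that commutes with \<open>x\<close>. The bound on \<open>\<parallel>1 - s\<parallel>\<close>
  says that the root found is itself positive.
\<close>

lemma sqrt_one_minus:
  assumes x: "sa x" "nm x \<le> 1"
  obtains s where "sa s" "s \<otimes> s = \<one> \<ominus> x" "nm (\<one> \<ominus> s) \<le> 1"
    "\<And>z. \<lbrakk>z \<in> carrier R; z \<otimes> x = x \<otimes> z\<rbrakk> \<Longrightarrow> z \<otimes> s = s \<otimes> z"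
proof -
  have xc: "x \<in> carrier R" using x by simp
  have "\<exists>y\<in>carrier R. (\<lambda>k. nm (approx x k \<ominus> y)) \<longlonglongrightarrow> 0"
  proof (rule nm_complete)
    fix e :: real assume "e > 0"
    then obtain N where N: "\<forall>k\<ge>N. \<forall>l\<ge>N. dist (approx_majorant k) (approx_majorant l) < e"
      using approx_majorant_Cauchy by (auto simp: Cauchy_def)
    have "nm (approx x k \<ominus> approx x l) < e" if "k \<ge> N" "l \<ge> N" for k l
    proof (cases "k \<le> l")
      case True
      then show ?thesis
        using approx_diff[OF xc x(2) True] N that nm_diff_commute[of "approx x k" "approx x l"] xc
        by (fastforce simp: dist_real_def abs_if split: if_splits)
    next
      case False
      then have "l \<le> k" by simp
      then show ?thesis
        using approx_diff[OF xc x(2), of l k] N that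
        by (fastforce simp: dist_real_def abs_if split: if_splits)
    qed
    then show "\<exists>N. \<forall>k\<ge>N. \<forall>l\<ge>N. nm (approx x k \<ominus> approx x l) < e" by blast
  qed (use xc in auto)
  then obtain y where yc: "y \<in> carrier R" and "(\<lambda>k. nm (approx x k \<ominus> y)) \<longlonglongrightarrow> 0" by blast
  then have y: "tends (approx x) y" using xc by (simp add: tends_def)
  have "tends (\<lambda>k. approx x (Suc k)) (sc (1/2) \<otimes> (x \<oplus> y \<otimes> y))"
    unfolding approx.simps using y xc by (intro tends_mult tends_add tends_const) auto
  then have fix_eq: "y = sc (1/2) \<otimes> (x \<oplus> y \<otimes> y)"
    using tends_unique[OF tends_shift[OF y]] by blast
  have "y \<oplus> y = sc 2 \<otimes> y" using yc by (simp add: sc_2)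
  also have "\<dots> = x \<oplus> y \<otimes> y" using xc yc by (subst fix_eq) (simp add: sc_sc)
  finally have dbl: "y \<oplus> y = x \<oplus> y \<otimes> y" .
  have "tends (approx x) (st y)"
    using tends_st[OF y] approx_sa[OF x(1)] by (simp add: sa_def)
  then have "y = st y" by (rule tends_unique[OF y])
  then have "sa y" using yc by (simp add: sa_def)
  then have 1: "sa (\<one> \<ominus> y)" by (simp add: sa_diff)
  have "(\<one> \<ominus> y) \<otimes> (\<one> \<ominus> y) = \<one> \<ominus> (y \<oplus> y) \<oplus> y \<otimes> y"
    using yc by (simp add: a_minus_def r_distr l_distr l_minus r_minus minus_add a_ac)
  also have "\<dots> = \<one> \<ominus> x" unfolding dbl using xc yc by algebra
  finally have 2: "(\<one> \<ominus> y) \<otimes> (\<one> \<ominus> y) = \<one> \<ominus> x" .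
  have "nm y \<le> 1"
    using approx_nm[OF xc x(2)] approx_majorant_bounds by (intro tends_nm_le[OF y]) (meson order_trans)
  moreover have "\<one> \<ominus> (\<one> \<ominus> y) = y" using yc by algebra
  ultimately have 3: "nm (\<one> \<ominus> (\<one> \<ominus> y)) \<le> 1" by simp
  have 4: "z \<otimes> (\<one> \<ominus> y) = (\<one> \<ominus> y) \<otimes> z" if z: "z \<in> carrier R" "z \<otimes> x = x \<otimes> z" for z
  proof -
    have "tends (\<lambda>k. z \<otimes> approx x k) (z \<otimes> y)" "tends (\<lambda>k. approx x k \<otimes> z) (y \<otimes> z)"
      using y z by (auto intro: tends_mult tends_const)
    then have "z \<otimes> y = y \<otimes> z"
      using approx_commute[OF xc z] tends_unique by simp
    then show ?thesis using yc z(1) by (simp add: a_minus_def r_distr l_distr l_minus r_minus)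
  qed
  show ?thesis using that 1 2 3 4 by blast
qed

end

section \<open>Positive elements\<close>

context unital_cstar_ring
begin

abbreviation scr :: "real \<Rightarrow> 'a" where "scr r \<equiv> sc (complex_of_real r)"

text \<open>
  If \<open>a\<^sup>2 + b\<^sup>2 = t\<close> for commuting self-adjoint \<open>a\<close> and \<open>b\<close>, then \<open>u = a + \<i> b\<close> satisfies \<open>u* u = t\<close>,
  and \<open>a\<close> is its real part.
\<close>

lemma commuting_sum_of_squares_bound:
  assumes a: "sa a" and b: "sa b" and ab: "a \<otimes> b = b \<otimes> a"
    and sum: "a \<otimes> a \<oplus> b \<otimes> b = scr t" and t: "0 \<le> t"
  shows "(nm a)\<^sup>2 \<le> t"
proof -
  have ac: "a \<in> carrier R" and bc: "b \<in> carrier R" using a b by auto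
  define c where "c = sc \<i> \<otimes> b"
  have cc: "c \<in> carrier R" using bc by (simp add: c_def)
  have stc: "st c = \<ominus> c"
    using b bc by (simp add: c_def st_mult st_sc sa_def sc_central sc_minus l_minus r_minus)
  have csq: "c \<otimes> c = \<ominus> (b \<otimes> b)"
    using bc by (simp add: c_def sc_mult_sc)
  have ac': "a \<otimes> c = c \<otimes> a"
    using ac bc ab by (simp add: c_def m_assoc sc_mult_right)
  have st_u: "st (a \<oplus> c) = a \<ominus> c"
    using a ac cc by (simp add: st_add stc sa_def a_minus_def)
  have "(a \<ominus> c) \<otimes> (a \<oplus> c) = a \<otimes> a \<ominus> c \<otimes> c \<oplus> (a \<otimes> c \<ominus> c \<otimes> a)"
    using ac cc by algebra
  also have "\<dots> = a \<otimes> a \<oplus> b \<otimes> b"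
    unfolding csq ac' using ac bc cc by algebra
  finally have "(nm (a \<oplus> c))\<^sup>2 = nm (scr t)"
    using nm_cstar[of "a \<oplus> c"] ac cc st_u sum by simp
  then have u: "(nm (a \<oplus> c))\<^sup>2 \<le> t"
    using nm_sc_le[of "complex_of_real t"] t by simp
  have "sc 2 \<otimes> a = (a \<oplus> c) \<oplus> (a \<ominus> c)"
    using ac cc by (simp add: sc_2) algebra
  moreover have "nm (a \<ominus> c) = nm (a \<oplus> c)"
    using st_u nm_st[of "a \<oplus> c"] ac cc by simp
  ultimately have "2 * nm a \<le> 2 * nm (a \<oplus> c)"
    using nm_triangle[of "a \<oplus> c" "a \<ominus> c"] nm_sc[of a 2] ac cc by simp
  then have "(nm a)\<^sup>2 \<le> (nm (a \<oplus> c))\<^sup>2"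
    using ac by (intro power_mono) auto
  then show ?thesis using u by simp
qed

text \<open>
  Squares are positive, in the normalised form: \<open>s = \<surd>(1 - h\<^sup>2)\<close> and \<open>h\<close> commute and
  \<open>s\<^sup>2 + h\<^sup>2 = 1\<close>, so \<open>\<parallel>s\<parallel> \<le> 1\<close>.
\<close>

lemma nm_one_minus_square:
  assumes h: "sa h" "nm h \<le> 1"
  shows "nm (\<one> \<ominus> h \<otimes> h) \<le> 1"
proof -
  have hc: "h \<in> carrier R" using h by simp
  have "nm (h \<otimes> h) \<le> 1"
    using h by (simp add: nm_sa_square power_le_one)
  moreover have "sa (h \<otimes> h)" using h by (simp add: sa_mult)
  ultimately obtain s where s: "sa s" "s \<otimes> s = \<one> \<ominus> h \<otimes> h"
    and comm: "\<And>z. \<lbrakk>z \<in> carrier R; z \<otimes> (h \<otimes> h) = (h \<otimes> h) \<otimes> z\<rbrakk> \<Longrightarrow> z \<otimes> s = s \<otimes> z"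
    using sqrt_one_minus by metis
  have "s \<otimes> s \<oplus> h \<otimes> h = scr 1"
    unfolding s using hc by simp algebra
  moreover have "h \<otimes> s = s \<otimes> h"
    using comm[of h] hc by (simp add: m_assoc)
  ultimately have "(nm s)\<^sup>2 \<le> 1"
    using commuting_sum_of_squares_bound[of s h 1] s h by simp
  then show ?thesis using nm_sa_square[OF s(1)] s(2) by simp
qed

text \<open>
  Positivity in terms of the norm: \<open>h\<close> is self-adjoint and lies in the ball of radius \<open>t\<close> around
  \<open>t 1\<close>, for some \<open>t\<close>. In this form positive elements are visibly closed under sums. By
  \<open>pos_square\<close> and \<open>pos_sqrt\<close> they are the squares of self-adjoint elements.
\<close>

definition pos :: "'a \<Rightarrow> bool" where
  "pos h \<longleftrightarrow> sa h \<and> (\<exists>t\<ge>0. nm (scr t \<ominus> h) \<le> t)"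

lemma pos_sa: "pos h \<Longrightarrow> sa h" and pos_closed [simp]: "pos h \<Longrightarrow> h \<in> carrier R"
  by (simp_all add: pos_def)

lemma pos_zero [simp]: "pos \<zero>"
  unfolding pos_def by (auto intro!: exI[of _ 0] simp: a_minus_def)

lemma sc_distrib: "\<lbrakk>x \<in> carrier R; y \<in> carrier R\<rbrakk> \<Longrightarrow> sc c \<otimes> (x \<ominus> y) = sc c \<otimes> x \<ominus> sc c \<otimes> y"
  by (simp add: a_minus_def r_distr r_minus)

lemma pos_scale:
  assumes "pos h" "0 \<le> r"
  shows "pos (scr r \<otimes> h)"
proof -
  obtain t where t: "t \<ge> 0" "nm (scr t \<ominus> h) \<le> t" using assms by (auto simp: pos_def)
  have "scr (r * t) \<ominus> scr r \<otimes> h = scr r \<otimes> (scr t \<ominus> h)"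
    using assms by (simp add: sc_distrib sc_mult)
  then have "nm (scr (r * t) \<ominus> scr r \<otimes> h) = r * nm (scr t \<ominus> h)"
    using assms nm_sc[of "scr t \<ominus> h" "complex_of_real r"] by simp
  also have "\<dots> \<le> r * t" using t assms by (simp add: mult_left_mono)
  finally have "nm (scr (r * t) \<ominus> scr r \<otimes> h) \<le> r * t" .
  moreover have "0 \<le> r * t" using t assms by simp
  ultimately show ?thesis using assms unfolding pos_def by (blast intro: sa_sc)
qed

lemma pos_add:
  assumes "pos h" "pos k"
  shows "pos (h \<oplus> k)"
proof -
  obtain t where t: "t \<ge> 0" "nm (scr t \<ominus> h) \<le> t" using assms by (auto simp: pos_def)
  obtain u where u: "u \<ge> 0" "nm (scr u \<ominus> k) \<le> u" using assms by (auto simp: pos_def)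
  have c: "h \<in> carrier R" "k \<in> carrier R" "scr t \<in> carrier R" "scr u \<in> carrier R" using assms by auto
  have "scr (t + u) = scr t \<oplus> scr u" by (simp add: sc_add)
  then have "scr (t + u) \<ominus> (h \<oplus> k) = (scr t \<ominus> h) \<oplus> (scr u \<ominus> k)"
    using c by (simp only:) algebra
  then have "nm (scr (t + u) \<ominus> (h \<oplus> k)) \<le> t + u"
    using nm_triangle[of "scr t \<ominus> h" "scr u \<ominus> k"] t u c by simp
  then show ?thesis unfolding pos_def
    using t u assms by (intro conjI exI[of _ "t + u"] sa_add) (auto dest: pos_sa)
qed

lemma pos_square:
  assumes k: "sa k"
  shows "pos (k \<otimes> k)"
proof -
  have kc: "k \<in> carrier R" using k by simp
  (* rescale into the unit ball; the summand 1 covers k = 0 *)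
  define r where "r = nm k + 1"
  have r: "r > 0" "nm k \<le> r" using kc nm_nonneg[of k] unfolding r_def by linarith+
  define h where "h = scr (1 / r) \<otimes> k"
  have h: "sa h" using k unfolding h_def by (rule sa_sc)
  have "nm h \<le> 1"
    unfolding h_def using r nm_sc[OF kc, of "complex_of_real (1/r)"] by (simp add: norm_divide)
  then have "nm (\<one> \<ominus> h \<otimes> h) \<le> 1" using nm_one_minus_square h by blast
  then have "pos (h \<otimes> h)" unfolding pos_def using h by (intro conjI exI[of _ 1] sa_mult) auto
  then have "pos (scr (r * r) \<otimes> (h \<otimes> h))" using r by (intro pos_scale) auto
  moreover have "scr (r * r) \<otimes> (h \<otimes> h) = k \<otimes> k"
    using kc r by (simp add: h_def sc_mult_sc sc_sc)
  ultimately show ?thesis by simp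
qed

lemma pos_sqrt:
  assumes h: "pos h"
  obtains k where "pos k" "k \<otimes> k = h"
    "\<And>z. \<lbrakk>z \<in> carrier R; z \<otimes> h = h \<otimes> z\<rbrakk> \<Longrightarrow> z \<otimes> k = k \<otimes> z"
proof -
  have hc: "h \<in> carrier R" using h by simp
  obtain t0 where t0: "t0 \<ge> 0" "nm (scr t0 \<ominus> h) \<le> t0" using h by (auto simp: pos_def)
  (* enlarging the radius makes it nonzero, so that it can be divided by *)
  define t where "t = t0 + 1"
  have t: "t > 0" using t0 by (simp add: t_def)
  have "scr t \<ominus> h = (scr t0 \<ominus> h) \<oplus> \<one>"
    unfolding t_def using hc by (simp add: sc_add a_minus_def a_ac)
  then have nt: "nm (scr t \<ominus> h) \<le> t"
    using nm_triangle[of "scr t0 \<ominus> h" \<one>] nm_one_le t0 hc by (simp add: t_def)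
  define x where "x = scr (1/t) \<otimes> (scr t \<ominus> h)"
  have xs: "sa x" unfolding x_def using h by (intro sa_sc sa_diff) (auto dest: pos_sa)
  have xc: "x \<in> carrier R" using xs by simp
  have xn: "nm x \<le> 1"
    unfolding x_def using t nt nm_sc[of "scr t \<ominus> h" "complex_of_real (1/t)"] hc by (simp add: norm_divide)
  have "scr (1/t) \<otimes> scr t = \<one>" using t by (simp flip: sc_mult)
  then have x_eq: "x = \<one> \<ominus> scr (1/t) \<otimes> h"
    unfolding x_def using hc by (simp add: sc_distrib)
  then have x1: "\<one> \<ominus> x = scr (1/t) \<otimes> h"
    using hc minus_equality by (simp add: a_minus_def minus_add flip: a_assoc) (simp add: r_neg)
  obtain s where s: "sa s" "s \<otimes> s = \<one> \<ominus> x" "nm (\<one> \<ominus> s) \<le> 1"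
    and comm: "\<And>z. \<lbrakk>z \<in> carrier R; z \<otimes> x = x \<otimes> z\<rbrakk> \<Longrightarrow> z \<otimes> s = s \<otimes> z"
    using sqrt_one_minus[OF xs xn] by metis
  have sc: "s \<in> carrier R" using s by simp
  define k where "k = scr (sqrt t) \<otimes> s"
  have "pos s" unfolding pos_def using s by (intro conjI exI[of _ 1]) auto
  then have 1: "pos k" unfolding k_def using t by (intro pos_scale) auto
  have "complex_of_real (sqrt t) * complex_of_real (sqrt t) = complex_of_real t"
    using t by (simp flip: of_real_mult)
  then have "k \<otimes> k = scr t \<otimes> (s \<otimes> s)"
    unfolding k_def using sc by (simp add: sc_mult_sc)
  then have 2: "k \<otimes> k = h"
    unfolding s(2) x1 using hc t by (simp add: sc_sc)
  have 3: "z \<otimes> k = k \<otimes> z" if z: "z \<in> carrier R" "z \<otimes> h = h \<otimes> z" for z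
  proof -
    have "z \<otimes> (scr (1/t) \<otimes> h) = (scr (1/t) \<otimes> h) \<otimes> z"
      using z hc by (simp add: sc_mult_right m_assoc)
    then have "z \<otimes> x = x \<otimes> z"
      unfolding x_eq using z(1) hc by (simp add: a_minus_def r_distr l_distr l_minus r_minus)
    then show ?thesis
      unfolding k_def using comm[OF z(1)] z(1) sc by (simp add: sc_mult_right m_assoc)
  qed
  show ?thesis using that 1 2 3 by blast
qed

lemma pos_nm_minus:
  assumes "sa h"
  shows "pos (scr (nm h) \<ominus> h)"
proof -
  have c: "h \<in> carrier R" using assms by simp
  have "scr (nm h) \<ominus> (scr (nm h) \<ominus> h) = h"
    using c sc_closed[of "complex_of_real (nm h)"] by algebra
  then show ?thesis unfolding pos_def
    using assms c by (intro conjI exI[of _ "nm h"] sa_diff) auto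
qed

text \<open>
  If \<open>0 \<le> h \<le> t\<close>, the square roots of \<open>h\<close> and \<open>t - h\<close> commute and their squares sum to \<open>t\<close>.
\<close>

lemma pos_bounded_nm:
  assumes h: "pos h" and k: "pos (scr t \<ominus> h)" and t: "0 \<le> t"
  shows "nm h \<le> t"
proof -
  have hc: "h \<in> carrier R" using h by simp
  obtain a where a: "pos a" "a \<otimes> a = h"
    and acomm: "\<And>z. \<lbrakk>z \<in> carrier R; z \<otimes> h = h \<otimes> z\<rbrakk> \<Longrightarrow> z \<otimes> a = a \<otimes> z"
    using pos_sqrt[OF h] by metis
  obtain b where b: "pos b" "b \<otimes> b = scr t \<ominus> h"
    and bcomm: "\<And>z. \<lbrakk>z \<in> carrier R; z \<otimes> (scr t \<ominus> h) = (scr t \<ominus> h) \<otimes> z\<rbrakk> \<Longrightarrow> z \<otimes> b = b \<otimes> z"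
    using pos_sqrt[OF k] by metis
  have ac: "a \<in> carrier R" using a by simp
  have "a \<otimes> h = h \<otimes> a" unfolding a(2)[symmetric] using ac by (simp add: m_assoc)
  then have "a \<otimes> (scr t \<ominus> h) = (scr t \<ominus> h) \<otimes> a"
    using hc ac by (simp add: a_minus_def r_distr l_distr l_minus r_minus sc_central)
  then have "a \<otimes> b = b \<otimes> a" using bcomm ac by blast
  moreover have "a \<otimes> a \<oplus> b \<otimes> b = scr t"
    unfolding a b using hc sc_closed[of "complex_of_real t"] by algebra
  ultimately have "(nm a)\<^sup>2 \<le> t"
    using commuting_sum_of_squares_bound a b t pos_sa by blast
  then show ?thesis using nm_sa_square[of a] a pos_sa by metis
qed

text \<open>
  Monotonicity of the norm: \<open>0 \<le> h \<le> k\<close> implies \<open>\<parallel>h\<parallel> \<le> \<parallel>k\<parallel>\<close>, because \<open>h \<le> k \<le> \<parallel>k\<parallel> 1\<close>.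
\<close>

lemma nm_mono:
  assumes h: "pos h" and k: "pos (k \<ominus> h)" "k \<in> carrier R"
  shows "nm h \<le> nm k"
proof -
  have hc: "h \<in> carrier R" using h by simp
  have keq: "k = h \<oplus> (k \<ominus> h)" using hc k(2) by algebra
  have "sa (h \<oplus> (k \<ominus> h))"
    using h k by (intro sa_add pos_sa)
  then have "sa k" by (simp flip: keq)
  then have "pos ((scr (nm k) \<ominus> k) \<oplus> (k \<ominus> h))"
    using k by (intro pos_add pos_nm_minus)
  moreover have "(scr (nm k) \<ominus> k) \<oplus> (k \<ominus> h) = scr (nm k) \<ominus> h"
    using hc k(2) sc_closed[of "complex_of_real (nm k)"] by algebra
  ultimately show ?thesis using pos_bounded_nm[OF h] k(2) by simp
qed

lemma pos_antisym:
  assumes "pos h" "pos (\<ominus> h)"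
  shows "h = \<zero>"
proof -
  have hc: "h \<in> carrier R" using assms(1) by simp
  have "pos (\<zero> \<ominus> h)" using assms(2) hc by (simp add: a_minus_def)
  then have "nm h \<le> nm \<zero>" by (rule nm_mono[OF assms(1)]) simp
  then have "nm h = 0" using nm_nonneg[OF hc] by simp
  then show ?thesis using nm_eq_0[OF hc] by simp
qed

text \<open>
  \<open>2 (x* x + x x*)\<close> is the sum of the squares of the self-adjoint elements \<open>x + x*\<close> and \<open>\<i> (x - x*)\<close>.
\<close>

lemma pos_st_mult_sum:
  assumes x: "x \<in> carrier R"
  shows "pos (st x \<otimes> x \<oplus> x \<otimes> st x)"
proof -
  define w where "w = st x"
  have w: "w \<in> carrier R" "st w = x" using x by (auto simp: w_def)
  define z where "z = sc \<i> \<otimes> (x \<ominus> w)"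
  have "st z = \<ominus> (sc \<i> \<otimes> (w \<ominus> x))"
    unfolding z_def using x w
    by (simp add: st_mult st_sc st_diff sc_central sc_minus l_minus r_minus w_def[symmetric])
  also have "\<dots> = z" unfolding z_def using x w sc_closed[of \<i>] by algebra
  finally have z: "sa z" using x w by (simp add: sa_def z_def)
  have y: "sa (x \<oplus> w)" using x w by (simp add: sa_def st_add w_def[symmetric] a_comm)
  have zz: "z \<otimes> z = \<ominus> ((x \<ominus> w) \<otimes> (x \<ominus> w))"
    unfolding z_def using x w by (simp add: sc_mult_sc)
  have "(x \<oplus> w) \<otimes> (x \<oplus> w) \<oplus> z \<otimes> z = (w \<otimes> x \<oplus> x \<otimes> w) \<oplus> (w \<otimes> x \<oplus> x \<otimes> w)"
    unfolding zz using x w by algebra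
  then have "w \<otimes> x \<oplus> x \<otimes> w = scr (1/2) \<otimes> ((x \<oplus> w) \<otimes> (x \<oplus> w) \<oplus> z \<otimes> z)"
    using x w sc_half_double[of "w \<otimes> x \<oplus> x \<otimes> w"] by simp
  moreover have "pos (scr (1/2) \<otimes> ((x \<oplus> w) \<otimes> (x \<oplus> w) \<oplus> z \<otimes> z))"
    using y z by (intro pos_scale pos_add pos_square) auto
  ultimately show ?thesis by (simp add: w_def)
qed

text \<open>
  If \<open>- x* x = c\<^sup>2\<close> then \<open>y = x c\<close> has \<open>y* y = - c\<^sup>4\<close> and \<open>y y* = - (x x*)\<^sup>2\<close>. So \<open>y* y + y y*\<close> is both
  positive and negative, hence zero, and then \<open>c = 0\<close>. This replaces the usual comparison of the
  spectra of \<open>x* x\<close> and \<open>x x*\<close>.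
\<close>

lemma eq_zero_if_pos_minus_st_mult:
  assumes x: "x \<in> carrier R" and neg: "pos (\<ominus> (st x \<otimes> x))"
  shows "x = \<zero>"
proof -
  obtain c where c: "pos c" "c \<otimes> c = \<ominus> (st x \<otimes> x)"
    using pos_sqrt[OF neg] by metis
  have cc: "c \<in> carrier R" and stc: "st c = c" using c pos_sa[of c] by (auto simp: sa_def)
  define w where "w = st x"
  have w: "w \<in> carrier R" using x by (simp add: w_def)
  have cw: "c \<otimes> c = \<ominus> (w \<otimes> x)" using c by (simp add: w_def)
  define p where "p = (c \<otimes> c) \<otimes> (c \<otimes> c)"
  define q where "q = (x \<otimes> w) \<otimes> (x \<otimes> w)"
  define y where "y = x \<otimes> c"
  have yc: "y \<in> carrier R" using x cc by (simp add: y_def)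
  have sty: "st y = c \<otimes> w" using x cc stc by (simp add: y_def w_def st_mult)
  have p: "pos p" unfolding p_def using c pos_sa by (intro pos_square sa_mult) auto
  have "sa (x \<otimes> w)" using x by (simp add: sa_def st_mult w_def)
  then have q: "pos q" unfolding q_def by (rule pos_square)
  have "st y \<otimes> y = c \<otimes> (w \<otimes> x) \<otimes> c"
    unfolding sty unfolding y_def using x w cc by (simp add: m_assoc)
  also have "w \<otimes> x = \<ominus> (c \<otimes> c)" unfolding cw using x w by simp
  finally have 1: "st y \<otimes> y = \<ominus> p" unfolding p_def using cc by (simp add: m_assoc l_minus r_minus)
  have "y \<otimes> st y = x \<otimes> (c \<otimes> c) \<otimes> w"
    unfolding sty unfolding y_def using x w cc by (simp add: m_assoc)
  then have 2: "y \<otimes> st y = \<ominus> q" unfolding cw q_def using x w by (simp add: m_assoc l_minus r_minus)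
  have pc: "p \<in> carrier R" "q \<in> carrier R" using p q by auto
  have "pos (\<ominus> p \<oplus> \<ominus> q)" using pos_st_mult_sum[OF yc] unfolding 1 2 .
  moreover have "\<ominus> p \<oplus> \<ominus> q = \<ominus> (p \<oplus> q)" using pc by algebra
  ultimately have "p \<oplus> q = \<zero>" using pos_antisym[of "p \<oplus> q"] pos_add[OF p q] by simp
  then have "q = \<ominus> p" using pc by (metis a_comm minus_equality)
  then have "p = \<zero>" using pos_antisym[of p] p q by simp
  then have "c \<otimes> c = \<zero>" unfolding p_def using c pos_sa by (metis sa_mult sa_square_zero)
  then have "st x \<otimes> x = \<zero>" using cw x w by (metis w_def m_closed minus_minus minus_zero)
  then show ?thesis using nm_cstar[OF x] x by (simp add: nm_eq_0)
qed

text \<open>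
  Let \<open>h = a* a\<close>, let \<open>k = \<surd>(h\<^sup>2)\<close> be its absolute value, and put \<open>q = k - h\<close>, twice the negative part.
  Then \<open>h q = - k q\<close>, so \<open>(a q)* (a q) = - q k q\<close> is minus the square of \<open>\<surd>k q\<close>. Therefore \<open>a q = 0\<close>,
  which forces \<open>q = 0\<close> and \<open>h = k\<close>.
\<close>

theorem pos_st_mult:
  assumes a: "a \<in> carrier R"
  shows "pos (st a \<otimes> a)"
proof -
  define h where "h = st a \<otimes> a"
  have h: "sa h" using a by (simp add: h_def sa_def st_mult)
  have hc: "h \<in> carrier R" using h by simp
  obtain k where k: "pos k" "k \<otimes> k = h \<otimes> h"
    and kcomm: "\<And>z. \<lbrakk>z \<in> carrier R; z \<otimes> (h \<otimes> h) = (h \<otimes> h) \<otimes> z\<rbrakk> \<Longrightarrow> z \<otimes> k = k \<otimes> z"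
    using pos_sqrt[OF pos_square[OF h]] by metis
  have kc: "k \<in> carrier R" using k by simp
  have hk: "h \<otimes> k = k \<otimes> h" using kcomm[of h] hc by (simp add: m_assoc)
  obtain m where m: "pos m" "m \<otimes> m = k"
    and mcomm: "\<And>z. \<lbrakk>z \<in> carrier R; z \<otimes> k = k \<otimes> z\<rbrakk> \<Longrightarrow> z \<otimes> m = m \<otimes> z"
    using pos_sqrt[OF k(1)] by metis
  have mc: "m \<in> carrier R" using m by simp
  define q where "q = k \<ominus> h"
  have q: "sa q" using k h pos_sa by (simp add: q_def sa_diff)
  have qc: "q \<in> carrier R" using q by simp
  have qk: "q \<otimes> k = k \<otimes> q"
    unfolding q_def using hc kc hk by (simp add: a_minus_def r_distr l_distr l_minus r_minus)
  have qm: "q \<otimes> m = m \<otimes> q" using mcomm qc qk by blast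
  have "h \<otimes> q = h \<otimes> k \<ominus> h \<otimes> h" unfolding q_def using hc kc by algebra
  also have "\<dots> = k \<otimes> h \<ominus> k \<otimes> k" using hk k by simp
  also have "\<dots> = \<ominus> (k \<otimes> q)" unfolding q_def using hc kc by algebra
  finally have hq: "h \<otimes> q = \<ominus> (k \<otimes> q)" .
  have mq: "(m \<otimes> q) \<otimes> (m \<otimes> q) = q \<otimes> (k \<otimes> q)"
  proof -
    have "(m \<otimes> q) \<otimes> (m \<otimes> q) = (q \<otimes> m) \<otimes> (m \<otimes> q)" using qm by simp
    also have "\<dots> = q \<otimes> ((m \<otimes> m) \<otimes> q)" using qc mc by (simp add: m_assoc)
    finally show ?thesis using m by simp
  qed
  have "sa (m \<otimes> q)" using m q qm pos_sa by (simp add: sa_mult)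
  then have sq: "pos (q \<otimes> (k \<otimes> q))" using pos_square mq by metis
  have "st (a \<otimes> q) \<otimes> (a \<otimes> q) = q \<otimes> (h \<otimes> q)"
    using a q qc by (simp add: h_def st_mult sa_def m_assoc)
  also have "\<dots> = \<ominus> (q \<otimes> (k \<otimes> q))" unfolding hq using qc kc by (simp add: r_minus)
  finally have x: "st (a \<otimes> q) \<otimes> (a \<otimes> q) = \<ominus> (q \<otimes> (k \<otimes> q))" .
  then have "a \<otimes> q = \<zero>"
    using sq a qc kc by (intro eq_zero_if_pos_minus_st_mult) auto
  then have "\<ominus> (q \<otimes> (k \<otimes> q)) = \<zero>" using x by simp
  then have z: "q \<otimes> (k \<otimes> q) = \<zero>" using qc kc by (metis m_closed minus_minus minus_zero)
  have "q \<otimes> q = k \<otimes> q \<ominus> h \<otimes> q" by (subst (1) q_def) (use qc kc hc in algebra)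
  also have "\<dots> = k \<otimes> q \<oplus> k \<otimes> q" unfolding hq using qc kc by (simp add: a_minus_def)
  finally have qq: "q \<otimes> q = k \<otimes> q \<oplus> k \<otimes> q" .
  have "(q \<otimes> q) \<otimes> (q \<otimes> q) = q \<otimes> (q \<otimes> (q \<otimes> q))" using qc by (simp add: m_assoc)
  also have "q \<otimes> (q \<otimes> q) = \<zero>" unfolding qq using qc kc z by (simp add: r_distr)
  finally have "(q \<otimes> q) \<otimes> (q \<otimes> q) = \<zero>" using qc by simp
  then have "q \<otimes> q = \<zero>" using q by (intro sa_square_zero[of "q \<otimes> q"] sa_mult) auto
  then have "q = \<zero>" using q by (rule sa_square_zero[rotated])
  then have "k = h" using hc kc eq_if_nm_diff[of k h] by (simp add: q_def)
  then show ?thesis using k by (simp add: h_def)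
qed

lemma pos_conj:
  assumes "pos h" "a \<in> carrier R"
  shows "pos (st a \<otimes> (h \<otimes> a))"
proof -
  obtain k where k: "pos k" "k \<otimes> k = h" using pos_sqrt[OF assms(1)] by metis
  have kc: "k \<in> carrier R" "st k = k" using k pos_sa[of k] by (auto simp: sa_def)
  have "st (k \<otimes> a) \<otimes> (k \<otimes> a) = st a \<otimes> (h \<otimes> a)"
    using kc assms(2) unfolding k(2)[symmetric] by (simp add: st_mult m_assoc)
  then show ?thesis using pos_st_mult[of "k \<otimes> a"] kc assms(2) by simp
qed

end

section \<open>The Hilbert module of column vectors\<close>

lemma (in abelian_monoid) finsum_swap:
  assumes "finite A" "finite B" "\<And>i j. \<lbrakk>i \<in> A; j \<in> B\<rbrakk> \<Longrightarrow> f i j \<in> carrier G"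
  shows "(\<Oplus>i\<in>A. \<Oplus>j\<in>B. f i j) = (\<Oplus>j\<in>B. \<Oplus>i\<in>A. f i j)"
  using assms(1,3)
proof (induction A rule: finite_induct)
  case empty
  then show ?case by simp
next
  case (insert a A)
  have "(\<Oplus>i\<in>insert a A. \<Oplus>j\<in>B. f i j) = (\<Oplus>j\<in>B. f a j) \<oplus> (\<Oplus>j\<in>B. \<Oplus>i\<in>A. f i j)"
    using insert by (subst finsum_insert) (auto intro!: finsum_closed)
  also have "\<dots> = (\<Oplus>j\<in>B. f a j \<oplus> (\<Oplus>i\<in>A. f i j))"
    using insert by (intro finsum_addf[symmetric]) (auto intro!: finsum_closed)
  also have "\<dots> = (\<Oplus>j\<in>B. \<Oplus>i\<in>insert a A. f i j)"
    using insert by (intro finsum_cong') (auto intro!: finsum_closed)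
  finally show ?case .
qed

context unital_cstar_ring
begin

lemma st_finsum:
  assumes "finite A" "\<And>i. i \<in> A \<Longrightarrow> f i \<in> carrier R"
  shows "st (\<Oplus>i\<in>A. f i) = (\<Oplus>i\<in>A. st (f i))"
  using assms
proof (induction A rule: finite_induct)
  case (insert a A)
  then show ?case by (simp add: Pi_def st_add finsum_closed)
qed simp

lemma nm_finsum_le:
  assumes "finite A" "\<And>i. i \<in> A \<Longrightarrow> f i \<in> carrier R"
  shows "nm (\<Oplus>i\<in>A. f i) \<le> (\<Sum>i\<in>A. nm (f i))"
  using assms
proof (induction A rule: finite_induct)
  case (insert a A)
  then show ?case using nm_triangle[of "f a" "\<Oplus>i\<in>A. f i"] by (simp add: Pi_def finsum_closed)
qed simp

lemma pos_finsum:
  assumes "finite A" "\<And>i. i \<in> A \<Longrightarrow> pos (f i)"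
  shows "pos (\<Oplus>i\<in>A. f i)"
  using assms
proof (induction A rule: finite_induct)
  case (insert a A)
  then show ?case by (simp add: Pi_def pos_add)
qed simp

lemma add_minus_cancel_left: "\<lbrakk>x \<in> carrier R; y \<in> carrier R\<rbrakk> \<Longrightarrow> (x \<oplus> y) \<ominus> x = y"
  by algebra

text \<open>
  The inner product \<open>\<Sum> v\<^sub>i* w\<^sub>i\<close> of column vectors indexed by \<open>I\<close>, the resulting norm, and the product
  of a matrix with a vector. Vectors and matrices are plain functions; values outside \<open>I\<close> are ignored.
\<close>

definition ip :: "'i set \<Rightarrow> ('i \<Rightarrow> 'a) \<Rightarrow> ('i \<Rightarrow> 'a) \<Rightarrow> 'a" where
  "ip I v w = (\<Oplus>i\<in>I. st (v i) \<otimes> w i)"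

definition vnm :: "'i set \<Rightarrow> ('i \<Rightarrow> 'a) \<Rightarrow> real" where
  "vnm I v = sqrt (nm (ip I v v))"

definition mv :: "'i set \<Rightarrow> ('i \<times> 'i \<Rightarrow> 'a) \<Rightarrow> ('i \<Rightarrow> 'a) \<Rightarrow> 'i \<Rightarrow> 'a" where
  "mv I M v i = (\<Oplus>k\<in>I. M (i, k) \<otimes> v k)"

context
  fixes I :: "'i set"
  assumes fin: "finite I"
begin

lemma ip_closed [simp]:
  "\<lbrakk>\<And>i. i \<in> I \<Longrightarrow> v i \<in> carrier R; \<And>i. i \<in> I \<Longrightarrow> w i \<in> carrier R\<rbrakk> \<Longrightarrow> ip I v w \<in> carrier R"
  unfolding ip_def by (auto intro!: finsum_closed)

lemma ip_cong:
  "\<lbrakk>\<And>i. i \<in> I \<Longrightarrow> v i = v' i; \<And>i. i \<in> I \<Longrightarrow> w i = w' i; \<And>i. i \<in> I \<Longrightarrow> v' i \<in> carrier R;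
    \<And>i. i \<in> I \<Longrightarrow> w' i \<in> carrier R\<rbrakk> \<Longrightarrow> ip I v w = ip I v' w'"
  unfolding ip_def by (intro finsum_cong') auto

lemma st_ip:
  assumes "\<And>i. i \<in> I \<Longrightarrow> v i \<in> carrier R" "\<And>i. i \<in> I \<Longrightarrow> w i \<in> carrier R"
  shows "st (ip I v w) = ip I w v"
proof -
  have "st (ip I v w) = (\<Oplus>i\<in>I. st (st (v i) \<otimes> w i))"
    unfolding ip_def using assms fin by (intro st_finsum) auto
  also have "\<dots> = ip I w v"
    unfolding ip_def using assms by (intro finsum_cong') (auto simp: st_mult)
  finally show ?thesis .
qed

lemma ip_add_right:
  assumes "\<And>i. i \<in> I \<Longrightarrow> v i \<in> carrier R" "\<And>i. i \<in> I \<Longrightarrow> w i \<in> carrier R" "\<And>i. i \<in> I \<Longrightarrow> w' i \<in> carrier R"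
  shows "ip I v (\<lambda>i. w i \<oplus> w' i) = ip I v w \<oplus> ip I v w'"
proof -
  have "ip I v (\<lambda>i. w i \<oplus> w' i) = (\<Oplus>i\<in>I. st (v i) \<otimes> w i \<oplus> st (v i) \<otimes> w' i)"
    unfolding ip_def using assms by (intro finsum_cong') (auto simp: r_distr)
  also have "\<dots> = ip I v w \<oplus> ip I v w'"
    unfolding ip_def using assms by (intro finsum_addf) auto
  finally show ?thesis .
qed

lemma ip_mult_right:
  assumes "\<And>i. i \<in> I \<Longrightarrow> v i \<in> carrier R" "\<And>i. i \<in> I \<Longrightarrow> w i \<in> carrier R" "g \<in> carrier R"
  shows "ip I v (\<lambda>i. w i \<otimes> g) = ip I v w \<otimes> g"
proof -
  have "ip I v w \<otimes> g = (\<Oplus>i\<in>I. (st (v i) \<otimes> w i) \<otimes> g)"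
    unfolding ip_def using assms fin by (intro finsum_ldistr) auto
  also have "\<dots> = ip I v (\<lambda>i. w i \<otimes> g)"
    unfolding ip_def using assms by (intro finsum_cong') (auto simp: m_assoc)
  finally show ?thesis by simp
qed

lemma ip_add_left:
  assumes "\<And>i. i \<in> I \<Longrightarrow> v i \<in> carrier R" "\<And>i. i \<in> I \<Longrightarrow> v' i \<in> carrier R" "\<And>i. i \<in> I \<Longrightarrow> w i \<in> carrier R"
  shows "ip I (\<lambda>i. v i \<oplus> v' i) w = ip I v w \<oplus> ip I v' w"
proof -
  have "ip I (\<lambda>i. v i \<oplus> v' i) w = st (ip I w (\<lambda>i. v i \<oplus> v' i))"
    using assms by (simp add: st_ip)
  also have "ip I w (\<lambda>i. v i \<oplus> v' i) = ip I w v \<oplus> ip I w v'"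
    using assms by (intro ip_add_right) auto
  also have "st \<dots> = ip I v w \<oplus> ip I v' w"
    using assms by (simp add: st_add st_ip)
  finally show ?thesis .
qed

lemma ip_mult_left:
  assumes "\<And>i. i \<in> I \<Longrightarrow> v i \<in> carrier R" "\<And>i. i \<in> I \<Longrightarrow> w i \<in> carrier R" "g \<in> carrier R"
  shows "ip I (\<lambda>i. v i \<otimes> g) w = st g \<otimes> ip I v w"
proof -
  have "ip I (\<lambda>i. v i \<otimes> g) w = st (ip I w (\<lambda>i. v i \<otimes> g))"
    using assms by (simp add: st_ip)
  also have "ip I w (\<lambda>i. v i \<otimes> g) = ip I w v \<otimes> g"
    using assms by (intro ip_mult_right) auto
  also have "st \<dots> = st g \<otimes> ip I v w"
    using assms by (simp add: st_mult st_ip)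
  finally show ?thesis .
qed

lemma pos_ip: "(\<And>i. i \<in> I \<Longrightarrow> v i \<in> carrier R) \<Longrightarrow> pos (ip I v v)"
  unfolding ip_def using fin by (intro pos_finsum pos_st_mult) auto

lemma nm_entry_le:
  assumes v: "\<And>i. i \<in> I \<Longrightarrow> v i \<in> carrier R" and i: "i \<in> I"
  shows "(nm (v i))\<^sup>2 \<le> nm (ip I v v)"
proof -
  let ?r = "\<Oplus>k\<in>I - {i}. st (v k) \<otimes> v k"
  have "ip I v v = (\<Oplus>k\<in>insert i (I - {i}). st (v k) \<otimes> v k)"
    unfolding ip_def using i by (simp add: insert_absorb)
  also have "\<dots> = st (v i) \<otimes> v i \<oplus> ?r"
    using v i fin by (intro finsum_insert) auto
  finally have eq: "ip I v v = st (v i) \<otimes> v i \<oplus> ?r" .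
  have c: "st (v i) \<otimes> v i \<in> carrier R" using v i by simp
  have r: "pos ?r" using v fin by (intro pos_finsum pos_st_mult) auto
  have "ip I v v \<ominus> st (v i) \<otimes> v i = ?r"
    unfolding eq using c pos_closed[OF r] by (rule add_minus_cancel_left)
  then have "nm (st (v i) \<otimes> v i) \<le> nm (ip I v v)"
    using v i r by (intro nm_mono pos_st_mult) auto
  then show ?thesis using nm_cstar v i by simp
qed

lemma nm_ip_bound:
  assumes v: "\<And>i. i \<in> I \<Longrightarrow> v i \<in> carrier R"
  shows "nm (ip I v v) \<le> (\<Sum>i\<in>I. nm (v i))\<^sup>2"
proof -
  have "nm (ip I v v) \<le> (\<Sum>i\<in>I. nm (st (v i) \<otimes> v i))"
    unfolding ip_def using fin v by (intro nm_finsum_le) auto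
  also have "\<dots> = (\<Sum>i\<in>I. nm (v i) * nm (v i))"
    using v by (intro sum.cong) (auto simp: nm_cstar power2_eq_square)
  also have "\<dots> \<le> (\<Sum>i\<in>I. nm (v i) * (\<Sum>k\<in>I. nm (v k)))"
    using v fin by (intro sum_mono mult_left_mono member_le_sum) auto
  finally show ?thesis by (simp add: power2_eq_square sum_distrib_right)
qed

text \<open>
  With \<open>h = \<langle>v, v\<rangle>\<close>, \<open>g = \<langle>v, w\<rangle>\<close> and \<open>r = \<parallel>h\<parallel>\<close>, positivity of \<open>\<langle>v g - r w, v g - r w\<rangle>\<close> and of
  \<open>g* (r - h) g\<close> add up to \<open>r g* g \<le> r\<^sup>2 \<langle>w, w\<rangle>\<close>.
\<close>

lemma ip_Cauchy_Schwarz: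
  assumes v: "\<And>i. i \<in> I \<Longrightarrow> v i \<in> carrier R" and w: "\<And>i. i \<in> I \<Longrightarrow> w i \<in> carrier R"
  shows "(nm (ip I v w))\<^sup>2 \<le> nm (ip I v v) * nm (ip I w w)"
proof (cases "nm (ip I v v) = 0")
  case True
  have "nm (v i) = 0" if "i \<in> I" for i
    using nm_entry_le[of v i] v that True by simp
  then have "ip I v w = ip I (\<lambda>i. \<zero>) w"
    using v w by (intro ip_cong) (auto simp: nm_eq_0)
  also have "\<dots> = \<zero>"
    unfolding ip_def using w by (simp add: finsum_cong'[of I _ "\<lambda>i. \<zero>"])
  finally show ?thesis using True by simp
next
  case False
  define h where "h = ip I v v"
  define g where "g = ip I v w"
  define r where "r = nm h"
  have hc: "h \<in> carrier R" and gc: "g \<in> carrier R" using v w by (auto simp: h_def g_def)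
  have r: "r > 0" using False nm_nonneg[OF hc] by (simp add: r_def h_def)
  have stg: "ip I w v = st g" using st_ip[of v w] v w by (simp add: g_def)
  define s where "s = scr (- r)"
  have sc: "s \<in> carrier R" and sts: "st s = s" by (auto simp: s_def st_sc)
  have sx: "x \<otimes> s = s \<otimes> x" if "x \<in> carrier R" for x using that by (simp add: s_def sc_central)
  define W where "W = ip I w w"
  have Wc: "W \<in> carrier R" using w by (simp add: W_def)
  define G where "G = st g \<otimes> g"
  have Gc: "G \<in> carrier R" using gc by (simp add: G_def)
  (* s = - r, so z = v g - r w *)
  define z where "z = (\<lambda>i. v i \<otimes> g \<oplus> w i \<otimes> s)"
  have vg: "\<And>i. i \<in> I \<Longrightarrow> v i \<otimes> g \<in> carrier R" and ws: "\<And>i. i \<in> I \<Longrightarrow> w i \<otimes> s \<in> carrier R"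
    using v w gc sc by auto
  have zc: "\<And>i. i \<in> I \<Longrightarrow> z i \<in> carrier R" using vg ws by (simp add: z_def)
  have "ip I z z = ip I z (\<lambda>i. v i \<otimes> g) \<oplus> ip I z (\<lambda>i. w i \<otimes> s)"
    by (subst (2) z_def) (rule ip_add_right[OF zc vg ws])
  also have "ip I z (\<lambda>i. v i \<otimes> g) = ip I z v \<otimes> g" by (rule ip_mult_right[OF zc v gc])
  also have "ip I z (\<lambda>i. w i \<otimes> s) = ip I z w \<otimes> s" by (rule ip_mult_right[OF zc w sc])
  also have "ip I z v = ip I (\<lambda>i. v i \<otimes> g) v \<oplus> ip I (\<lambda>i. w i \<otimes> s) v"
    unfolding z_def by (rule ip_add_left[OF vg ws v])
  also have "ip I z w = ip I (\<lambda>i. v i \<otimes> g) w \<oplus> ip I (\<lambda>i. w i \<otimes> s) w"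
    unfolding z_def by (rule ip_add_left[OF vg ws w])
  also have "ip I (\<lambda>i. v i \<otimes> g) v = st g \<otimes> h" unfolding h_def by (rule ip_mult_left[OF v v gc])
  also have "ip I (\<lambda>i. w i \<otimes> s) v = s \<otimes> st g" using ip_mult_left[OF w v sc] by (simp add: sts stg)
  also have "ip I (\<lambda>i. v i \<otimes> g) w = G" using ip_mult_left[OF v w gc] by (simp add: G_def g_def)
  also have "ip I (\<lambda>i. w i \<otimes> s) w = s \<otimes> W" using ip_mult_left[OF w w sc] by (simp add: sts W_def)
  finally have "ip I z z = (st g \<otimes> h \<oplus> s \<otimes> st g) \<otimes> g \<oplus> (G \<oplus> s \<otimes> W) \<otimes> s" .
  then have zz: "ip I z z = st g \<otimes> (h \<otimes> g) \<oplus> s \<otimes> G \<oplus> (s \<otimes> G \<oplus> s \<otimes> (s \<otimes> W))"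
    using hc gc sc Wc Gc by (simp add: l_distr m_assoc sx) (simp add: G_def m_assoc r_distr)
  have p: "pos (st g \<otimes> ((scr r \<ominus> h) \<otimes> g))"
    unfolding r_def using v gc pos_ip[of v] pos_sa by (intro pos_conj pos_nm_minus) (auto simp: h_def)
  have "st g \<otimes> ((scr r \<ominus> h) \<otimes> g) = scr r \<otimes> G \<ominus> st g \<otimes> (h \<otimes> g)"
    using hc gc by (simp add: G_def a_minus_def l_distr r_distr l_minus r_minus sc_mult_right)
  then have "pos (scr r \<otimes> G \<ominus> st g \<otimes> (h \<otimes> g))" using p by simp
  moreover have "scr r = \<ominus> s" by (simp add: s_def sc_minus)
  ultimately have p': "pos (\<ominus> s \<otimes> G \<ominus> st g \<otimes> (h \<otimes> g))" by simp
  have A: "st g \<otimes> (h \<otimes> g) \<in> carrier R" using hc gc by simp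
  have B: "s \<otimes> G \<in> carrier R" "s \<otimes> (s \<otimes> W) \<in> carrier R" using sc Gc Wc by auto
  have "ip I z z \<oplus> (\<ominus> s \<otimes> G \<ominus> st g \<otimes> (h \<otimes> g)) = s \<otimes> (s \<otimes> W) \<oplus> s \<otimes> G"
  proof -
    have "\<ominus> s \<otimes> G = \<ominus> (s \<otimes> G)" using sc Gc by (simp add: l_minus)
    then show ?thesis unfolding zz using A B by (simp only:) algebra
  qed
  moreover have "pos (ip I z z \<oplus> (\<ominus> s \<otimes> G \<ominus> st g \<otimes> (h \<otimes> g)))"
    using pos_ip[OF zc] p' by (rule pos_add)
  ultimately have "pos (s \<otimes> (s \<otimes> W) \<oplus> s \<otimes> G)" by simp
  moreover have "s \<otimes> (s \<otimes> W) \<oplus> s \<otimes> G = scr (r * r) \<otimes> W \<ominus> scr r \<otimes> G"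
    using Wc Gc by (simp add: s_def sc_sc sc_minus a_minus_def l_minus r_minus)
  ultimately have "nm (scr r \<otimes> G) \<le> nm (scr (r * r) \<otimes> W)"
    using Wc Gc gc r pos_st_mult[OF gc] by (intro nm_mono pos_scale) (auto simp: G_def)
  then have "r * nm G \<le> r * (r * nm W)"
    using r nm_sc[OF Gc, of "complex_of_real r"] nm_sc[OF Wc, of "complex_of_real (r * r)"] by (simp add: norm_mult)
  then have "nm G \<le> r * nm W" using r by simp
  then show ?thesis using nm_cstar[OF gc] by (simp add: G_def g_def r_def h_def W_def)
qed

lemma vnm_nonneg [simp]: "(\<And>i. i \<in> I \<Longrightarrow> v i \<in> carrier R) \<Longrightarrow> 0 \<le> vnm I v"
  by (simp add: vnm_def)

lemma vnm_square: "(\<And>i. i \<in> I \<Longrightarrow> v i \<in> carrier R) \<Longrightarrow> (vnm I v)\<^sup>2 = nm (ip I v v)"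
  by (simp add: vnm_def)

lemma nm_ip_le:
  assumes "\<And>i. i \<in> I \<Longrightarrow> v i \<in> carrier R" "\<And>i. i \<in> I \<Longrightarrow> w i \<in> carrier R"
  shows "nm (ip I v w) \<le> vnm I v * vnm I w"
proof -
  have "nm (ip I v w) \<le> sqrt (nm (ip I v v) * nm (ip I w w))"
    using ip_Cauchy_Schwarz assms by (intro real_le_rsqrt) auto
  then show ?thesis by (simp add: vnm_def real_sqrt_mult)
qed

lemma vnm_cong:
  "\<lbrakk>\<And>i. i \<in> I \<Longrightarrow> v i = v' i; \<And>i. i \<in> I \<Longrightarrow> v' i \<in> carrier R\<rbrakk> \<Longrightarrow> vnm I v = vnm I v'"
  unfolding vnm_def using ip_cong[of v v' v v'] by simp

lemma vnm_triangle:
  assumes v: "\<And>i. i \<in> I \<Longrightarrow> v i \<in> carrier R" and w: "\<And>i. i \<in> I \<Longrightarrow> w i \<in> carrier R"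
  shows "vnm I (\<lambda>i. v i \<oplus> w i) \<le> vnm I v + vnm I w"
proof -
  let ?u = "\<lambda>i. v i \<oplus> w i"
  have u: "\<And>i. i \<in> I \<Longrightarrow> ?u i \<in> carrier R" using v w by simp
  have "(vnm I ?u)\<^sup>2 = nm (ip I ?u v \<oplus> ip I ?u w)"
    using vnm_square[OF u] ip_add_right[OF u v w] by simp
  also have "\<dots> \<le> nm (ip I ?u v) + nm (ip I ?u w)"
    using u v w by (intro nm_triangle) auto
  also have "\<dots> \<le> vnm I ?u * vnm I v + vnm I ?u * vnm I w"
    by (intro add_mono nm_ip_le u v w)
  finally have "vnm I ?u * vnm I ?u \<le> vnm I ?u * (vnm I v + vnm I w)"
    by (simp add: power2_eq_square distrib_left)
  moreover have "0 \<le> vnm I ?u" "0 \<le> vnm I v" "0 \<le> vnm I w"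
    using u v w by (auto intro: vnm_nonneg)
  ultimately show ?thesis
    by (cases "vnm I ?u = 0") (auto simp: mult_le_cancel_left)
qed

lemma vnm_scale:
  assumes v: "\<And>i. i \<in> I \<Longrightarrow> v i \<in> carrier R"
  shows "vnm I (\<lambda>i. sc c \<otimes> v i) = cmod c * vnm I v"
proof -
  have "ip I (\<lambda>i. sc c \<otimes> v i) (\<lambda>i. sc c \<otimes> v i) = ip I (\<lambda>i. v i \<otimes> sc c) (\<lambda>i. v i \<otimes> sc c)"
    using v by (intro ip_cong) (auto simp: sc_central)
  also have "\<dots> = sc (cnj c) \<otimes> (sc c \<otimes> ip I v v)"
    using v by (simp add: ip_mult_left ip_mult_right st_sc sc_central)
  also have "\<dots> = sc (cnj c * c) \<otimes> ip I v v" using v by (simp add: sc_sc)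
  finally have "nm (ip I (\<lambda>i. sc c \<otimes> v i) (\<lambda>i. sc c \<otimes> v i)) = (cmod c)\<^sup>2 * nm (ip I v v)"
    using v by (simp add: nm_sc norm_mult power2_eq_square)
  then show ?thesis by (simp add: vnm_def real_sqrt_mult)
qed

lemma nm_entry_le_vnm: "\<lbrakk>\<And>i. i \<in> I \<Longrightarrow> v i \<in> carrier R; i \<in> I\<rbrakk> \<Longrightarrow> nm (v i) \<le> vnm I v"
  unfolding vnm_def using nm_entry_le by (intro real_le_rsqrt) auto

lemma vnm_le_sum: "(\<And>i. i \<in> I \<Longrightarrow> v i \<in> carrier R) \<Longrightarrow> vnm I v \<le> (\<Sum>i\<in>I. nm (v i))"
  unfolding vnm_def using nm_ip_bound by (intro real_le_lsqrt) (auto intro!: sum_nonneg)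

lemma mv_closed [simp]:
  assumes "\<And>i j. \<lbrakk>i \<in> I; j \<in> I\<rbrakk> \<Longrightarrow> M (i, j) \<in> carrier R" "\<And>i. i \<in> I \<Longrightarrow> v i \<in> carrier R" "i \<in> I"
  shows "mv I M v i \<in> carrier R"
  unfolding mv_def using assms by (auto intro!: finsum_closed)

lemma mv_bound:
  assumes M: "\<And>i j. \<lbrakk>i \<in> I; j \<in> I\<rbrakk> \<Longrightarrow> M (i, j) \<in> carrier R" and v: "\<And>i. i \<in> I \<Longrightarrow> v i \<in> carrier R"
  shows "vnm I (mv I M v) \<le> (\<Sum>i\<in>I. \<Sum>j\<in>I. nm (M (i, j))) * vnm I v"
proof -
  have "vnm I (mv I M v) \<le> (\<Sum>i\<in>I. nm (mv I M v i))"
    using M v by (intro vnm_le_sum) auto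
  also have "\<dots> \<le> (\<Sum>i\<in>I. \<Sum>j\<in>I. nm (M (i, j)) * vnm I v)"
  proof (intro sum_mono)
    fix i assume i: "i \<in> I"
    have "nm (mv I M v i) \<le> (\<Sum>j\<in>I. nm (M (i, j) \<otimes> v j))"
      unfolding mv_def using fin M v i by (intro nm_finsum_le) auto
    also have "\<dots> \<le> (\<Sum>j\<in>I. nm (M (i, j)) * vnm I v)"
    proof (intro sum_mono)
      fix j assume j: "j \<in> I"
      have "nm (M (i, j) \<otimes> v j) \<le> nm (M (i, j)) * nm (v j)"
        using M v i j by (intro nm_mult) auto
      also have "\<dots> \<le> nm (M (i, j)) * vnm I v"
        using M v i j nm_entry_le_vnm[OF v j] by (intro mult_left_mono) auto
      finally show "nm (M (i, j) \<otimes> v j) \<le> nm (M (i, j)) * vnm I v" .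
    qed
    finally show "nm (mv I M v i) \<le> (\<Sum>j\<in>I. nm (M (i, j)) * vnm I v)" .
  qed
  finally show ?thesis by (simp add: sum_distrib_right)
qed

lemma mv_mult:
  assumes M: "\<And>i j. \<lbrakk>i \<in> I; j \<in> I\<rbrakk> \<Longrightarrow> M (i, j) \<in> carrier R"
    and N: "\<And>i j. \<lbrakk>i \<in> I; j \<in> I\<rbrakk> \<Longrightarrow> N (i, j) \<in> carrier R"
    and P: "\<And>i j. \<lbrakk>i \<in> I; j \<in> I\<rbrakk> \<Longrightarrow> P (i, j) = (\<Oplus>k\<in>I. M (i, k) \<otimes> N (k, j))"
    and v: "\<And>i. i \<in> I \<Longrightarrow> v i \<in> carrier R" and i: "i \<in> I"
  shows "mv I P v i = mv I M (mv I N v) i"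
proof -
  have "mv I P v i = (\<Oplus>j\<in>I. \<Oplus>k\<in>I. M (i, k) \<otimes> (N (k, j) \<otimes> v j))"
    unfolding mv_def
  proof (rule finsum_cong')
    fix j assume j: "j \<in> I"
    have "P (i, j) \<otimes> v j = (\<Oplus>k\<in>I. M (i, k) \<otimes> N (k, j) \<otimes> v j)"
      unfolding P[OF i j] using fin M N v i j by (intro finsum_ldistr) auto
    also have "\<dots> = (\<Oplus>k\<in>I. M (i, k) \<otimes> (N (k, j) \<otimes> v j))"
      using M N v i j by (intro finsum_cong') (auto simp: m_assoc)
    finally show "P (i, j) \<otimes> v j = (\<Oplus>k\<in>I. M (i, k) \<otimes> (N (k, j) \<otimes> v j))" .
  qed (use M N v i in \<open>auto intro!: finsum_closed\<close>)
  also have "\<dots> = (\<Oplus>k\<in>I. \<Oplus>j\<in>I. M (i, k) \<otimes> (N (k, j) \<otimes> v j))"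
    using fin M N v i by (intro finsum_swap) auto
  also have "\<dots> = mv I M (mv I N v) i"
    unfolding mv_def using fin M N v i
    by (intro finsum_cong' refl finsum_rdistr[symmetric]) (auto intro!: finsum_closed)
  finally show ?thesis .
qed

lemma ip_mv_adjoint:
  assumes M: "\<And>i j. \<lbrakk>i \<in> I; j \<in> I\<rbrakk> \<Longrightarrow> M (i, j) \<in> carrier R"
    and N: "\<And>i j. \<lbrakk>i \<in> I; j \<in> I\<rbrakk> \<Longrightarrow> N (i, j) = st (M (j, i))"
    and v: "\<And>i. i \<in> I \<Longrightarrow> v i \<in> carrier R" and w: "\<And>i. i \<in> I \<Longrightarrow> w i \<in> carrier R"
  shows "ip I (mv I M v) w = ip I v (mv I N w)"
proof -
  have "ip I (mv I M v) w = (\<Oplus>i\<in>I. \<Oplus>k\<in>I. st (v k) \<otimes> (st (M (i, k)) \<otimes> w i))"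
    unfolding ip_def
  proof (rule finsum_cong')
    fix i assume i: "i \<in> I"
    have "st (mv I M v i) = (\<Oplus>k\<in>I. st (M (i, k) \<otimes> v k))"
      unfolding mv_def using fin M v i by (intro st_finsum) auto
    then have "st (mv I M v i) \<otimes> w i = (\<Oplus>k\<in>I. st (M (i, k) \<otimes> v k) \<otimes> w i)"
      using fin M v w i by (simp add: finsum_ldistr Pi_def)
    also have "\<dots> = (\<Oplus>k\<in>I. st (v k) \<otimes> (st (M (i, k)) \<otimes> w i))"
      using M v w i by (intro finsum_cong') (auto simp: st_mult m_assoc)
    finally show "st (mv I M v i) \<otimes> w i = (\<Oplus>k\<in>I. st (v k) \<otimes> (st (M (i, k)) \<otimes> w i))" .
  qed (use M v w in \<open>auto intro!: finsum_closed\<close>)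
  also have "\<dots> = (\<Oplus>k\<in>I. \<Oplus>i\<in>I. st (v k) \<otimes> (st (M (i, k)) \<otimes> w i))"
    using fin M v w by (intro finsum_swap) auto
  also have "\<dots> = (\<Oplus>k\<in>I. st (v k) \<otimes> (\<Oplus>i\<in>I. st (M (i, k)) \<otimes> w i))"
    using fin M v w
    by (intro finsum_cong' refl finsum_rdistr[symmetric]) (auto intro!: finsum_closed)
  also have "\<dots> = ip I v (mv I N w)"
    unfolding ip_def mv_def using M v w by (intro finsum_cong' arg_cong2[of _ _ _ _ "(\<otimes>)"]) (auto simp: N intro!: finsum_closed)
  finally show ?thesis .
qed

text \<open>
  For \<open>N = M*\<close> and \<open>P = M* M\<close>: the inequality that makes the operator norm on matrices a C*-norm,
  from \<open>\<langle>M v, M v\<rangle> = \<langle>v, M* M v\<rangle>\<close> and Cauchy-Schwarz.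
\<close>

lemma vnm_mv_cstar:
  assumes M: "\<And>i j. \<lbrakk>i \<in> I; j \<in> I\<rbrakk> \<Longrightarrow> M (i, j) \<in> carrier R"
    and N: "\<And>i j. \<lbrakk>i \<in> I; j \<in> I\<rbrakk> \<Longrightarrow> N (i, j) = st (M (j, i))"
    and P: "\<And>i j. \<lbrakk>i \<in> I; j \<in> I\<rbrakk> \<Longrightarrow> P (i, j) = (\<Oplus>k\<in>I. N (i, k) \<otimes> M (k, j))"
    and v: "\<And>i. i \<in> I \<Longrightarrow> v i \<in> carrier R"
  shows "(vnm I (mv I M v))\<^sup>2 \<le> vnm I v * vnm I (mv I P v)"
proof -
  have Nc: "N (i, j) \<in> carrier R" if "i \<in> I" "j \<in> I" for i j
    unfolding N[OF that] by (rule st_closed[OF M[OF that(2,1)]])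
  have Pc: "P (i, j) \<in> carrier R" if "i \<in> I" "j \<in> I" for i j
    unfolding P[OF that] by (rule finsum_closed) (use M Nc that in auto)
  have Mv: "mv I M v i \<in> carrier R" if "i \<in> I" for i by (rule mv_closed) (use M v that in auto)
  have Pv: "mv I P v i \<in> carrier R" if "i \<in> I" for i by (rule mv_closed) (use Pc v that in auto)
  have "(vnm I (mv I M v))\<^sup>2 = nm (ip I (mv I M v) (mv I M v))"
    by (rule vnm_square[OF Mv])
  also have "ip I (mv I M v) (mv I M v) = ip I v (mv I N (mv I M v))"
    by (rule ip_mv_adjoint) (fact M N v Mv)+
  also have "\<dots> = ip I v (mv I P v)"
  proof (rule ip_cong)
    show "mv I N (mv I M v) i = mv I P v i" if "i \<in> I" for i
      by (rule mv_mult[symmetric]) (fact Nc M P v that)+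
  qed (auto intro: v Pv)
  also have "nm \<dots> \<le> vnm I v * vnm I (mv I P v)"
    by (rule nm_ip_le[OF v Pv])
  finally show ?thesis .
qed

lemma mv_unit_vector:
  assumes M: "\<And>i j. \<lbrakk>i \<in> I; j \<in> I\<rbrakk> \<Longrightarrow> M (i, j) \<in> carrier R" and ij: "i \<in> I" "j \<in> I"
  shows "mv I M (\<lambda>k. if k = j then \<one> else \<zero>) i = M (i, j)"
proof -
  have "mv I M (\<lambda>k. if k = j then \<one> else \<zero>) i = (\<Oplus>k\<in>I. if j = k then M (i, k) else \<zero>)"
    unfolding mv_def
  proof (rule finsum_cong')
    show "(\<lambda>k. if j = k then M (i, k) else \<zero>) \<in> I \<rightarrow> carrier R" using M ij by auto
    show "M (i, k) \<otimes> (if k = j then \<one> else \<zero>) = (if j = k then M (i, k) else \<zero>)" if "k \<in> I" for k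
      using M[OF ij(1) that] by simp
  qed simp
  also have "\<dots> = M (i, j)" 
    by (rule finsum_singleton[of j I "\<lambda>k. M (i, k)"]) (use fin M ij in auto)
  finally show ?thesis .
qed

lemma vnm_unit_vector_le:
  assumes j: "j \<in> I"
  shows "vnm I (\<lambda>k. if k = j then \<one> else \<zero>) \<le> 1"
proof -
  let ?e = "\<lambda>k. if k = j then \<one> else \<zero>"
  have "vnm I ?e \<le> (\<Sum>k\<in>I. nm (?e k))"
    by (rule vnm_le_sum) simp
  also have "\<dots> = (\<Sum>k\<in>I. if k = j then nm \<one> else 0)"
    by (rule sum.cong[OF refl]) simp
  also have "\<dots> = nm \<one>" by (simp only: sum.delta[OF fin] j if_True)
  finally show ?thesis using nm_one_le by linarith
qed

end

end

section \<open>From *-algebras to rings, and operator norms\<close>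

context star_algebra
begin

sublocale add: comm_group "add_group A"
  rewrites "carrier (add_group A) = carrier A" and "mult (add_group A) = vadd A"
    and "one (add_group A) = vzero A"
  using additive_group by (simp_all add: add_group_def)

lemma zero_scale [simp]: "x \<in> carrier A \<Longrightarrow> 0 \<boxdot> x = vzero A"
proof -
  assume x: "x \<in> carrier A"
  have "0 \<boxdot> x \<boxplus> 0 \<boxdot> x = 0 \<boxdot> x" using scale_add_left[OF x, of 0 0] by simp
  then show ?thesis using scale_closed[OF x, of 0] by (metis add.r_cancel_one)
qed

lemma scale_zero [simp]: "c \<boxdot> vzero A = vzero A"
  using scale_scale[of "vzero A" c 0] by simp

lemma add_neg [simp]: "x \<in> carrier A \<Longrightarrow> x \<boxplus> (-1) \<boxdot> x = vzero A"
  using scale_add_left[of x 1 "-1"] by (simp add: scale_one)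

lemma neg_add [simp]: "x \<in> carrier A \<Longrightarrow> (-1) \<boxdot> x \<boxplus> x = vzero A"
  using add_neg by (simp add: scale_closed add.m_comm)

lemma mult_zero_right [simp]: "x \<in> carrier A \<Longrightarrow> x \<boxtimes> vzero A = vzero A"
  using scale_mult_right[of x "vzero A" 0] by (simp add: mult_closed)

lemma mult_zero_left [simp]: "x \<in> carrier A \<Longrightarrow> vzero A \<boxtimes> x = vzero A"
  using scale_mult_left[of "vzero A" x 0] by (simp add: mult_closed)

lemma adj_zero [simp]: "adj A (vzero A) = vzero A"
  using adj_scale[of "vzero A" 0] by (simp add: adj_closed)

end

text \<open>
  The ring underlying a *-algebra with unit \<open>e\<close>.
\<close>

definition ring_of :: "('a, 'm) star_algebra_scheme \<Rightarrow> 'a \<Rightarrow> 'a ring" where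
  "ring_of A e = \<lparr>carrier = carrier A, mult = amult A, one = e, zero = vzero A, add = vadd A\<rparr>"

lemma ring_of_simps [simp]:
  "carrier (ring_of A e) = carrier A" "mult (ring_of A e) = amult A" "one (ring_of A e) = e"
  "zero (ring_of A e) = vzero A" "add (ring_of A e) = vadd A"
  by (simp_all add: ring_of_def)

lemma finsum_ring_of: "finsum (ring_of A e) = finprod (add_group A)"
  by (simp add: finsum_def ring_of_def add_group_def)

text \<open>
  A *-algebra together with a two-sided unit \<open>e\<close>.
\<close>

locale unital_star_algebra = star_algebra A for A :: "('a, 'm) star_algebra_scheme" (structure) +
  fixes e :: 'a
  assumes unit_closed [simp]: "e \<in> carrier A"
    and unit_left [simp]: "x \<in> carrier A \<Longrightarrow> e \<boxtimes> x = x"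
    and unit_right [simp]: "x \<in> carrier A \<Longrightarrow> x \<boxtimes> e = x"
begin

sublocale R: ring "ring_of A e"
  rewrites "carrier (ring_of A e) = carrier A" and "mult (ring_of A e) = amult A"
    and "one (ring_of A e) = e" and "zero (ring_of A e) = vzero A" and "add (ring_of A e) = vadd A"
proof -
  show "ring (ring_of A e)"
  proof (rule ringI)
    show "abelian_group (ring_of A e)"
      by (rule abelian_groupI)
        (auto intro: add.m_assoc add.m_comm bexI[of _ "(-1) \<boxdot> x" for x] scale_closed)
    show "Group.monoid (ring_of A e)"
      by (rule monoidI) (auto simp: mult_closed mult_assoc)
  qed (auto simp: distrib_left distrib_right)
qed simp_all

lemma a_inv_eq: "x \<in> carrier A \<Longrightarrow> a_inv (ring_of A e) x = (-1) \<boxdot> x"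
  by (rule R.minus_equality) (auto simp: scale_closed)

lemma adj_unit [simp]: "adj A e = e"
  by (metis adj_adj adj_closed adj_mult unit_closed unit_left unit_right)

end

locale unital_cstar_algebra = cstar_algebra A + unital_star_algebra A e
  for A :: "('a, 'm) cstar_algebra_scheme" (structure) and e
begin

sublocale R: unital_cstar_ring "ring_of A e" "adj A" "anorm A" "\<lambda>c. c \<boxdot> e"
  rewrites "carrier (ring_of A e) = carrier A" and "mult (ring_of A e) = amult A"
    and "one (ring_of A e) = e" and "zero (ring_of A e) = vzero A" and "add (ring_of A e) = vadd A"
proof -
  have dist: "a_minus (ring_of A e) x y = x \<boxplus> (-1) \<boxdot> y" if "y \<in> carrier A" for x y
    using that by (simp add: a_minus_def a_inv_eq)
  show "unital_cstar_ring (ring_of A e) (adj A) (anorm A) (\<lambda>c. c \<boxdot> e)"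
  proof (intro unital_cstar_ring.intro R.ring_axioms unital_cstar_ring_axioms.intro, unfold ring_of_simps)
    fix s assume s: "\<And>k::nat. s k \<in> carrier A"
      and "\<And>d::real. d > 0 \<Longrightarrow> \<exists>N. \<forall>k\<ge>N. \<forall>l\<ge>N. anorm A (a_minus (ring_of A e) (s k) (s l)) < d"
    then have "\<exists>x\<in>carrier A. (\<lambda>k. adist A (s k) x) \<longlonglongrightarrow> 0"
      by (intro complete) (auto simp: adist_def dist)
    then show "\<exists>x\<in>carrier A. (\<lambda>k. anorm A (a_minus (ring_of A e) (s k) x)) \<longlonglongrightarrow> 0"
      by (auto simp: adist_def dist)
  qed (auto simp: scale_closed scale_add_left scale_scale scale_one scale_mult_left scale_mult_right
      adj_closed adj_adj adj_add adj_scale adj_mult norm_eq_zero norm_triangle norm_scale norm_mult norm_cstar mult.commute)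
qed simp_all

end

text \<open>
  The *-algebra \<open>A\<close> equipped with the norm \<open>N\<close> (replacing any norm that \<open>A\<close> may have).
\<close>

definition with_norm :: "('a, 'm) star_algebra_scheme \<Rightarrow> ('a \<Rightarrow> real) \<Rightarrow> 'a cstar_algebra" where
  "with_norm A N = \<lparr>carrier = carrier A, vadd = vadd A, vzero = vzero A, amult = amult A,
     cscale = cscale A, adj = adj A, anorm = N\<rparr>"

lemma with_norm_simps [simp]:
  "carrier (with_norm A N) = carrier A" "vadd (with_norm A N) = vadd A"
  "vzero (with_norm A N) = vzero A" "amult (with_norm A N) = amult A"
  "cscale (with_norm A N) = cscale A" "adj (with_norm A N) = adj A" "anorm (with_norm A N) = N"
  "add_group (with_norm A N) = add_group A"
  by (simp_all add: with_norm_def add_group_def)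

lemma star_algebra_with_norm [simp]: "star_algebra (with_norm A N) \<longleftrightarrow> star_algebra A"
  by (simp add: star_algebra_def)

text \<open>
  The operator norm of \<open>act x\<close>, as the least bound \<open>K\<close> with \<open>\<parallel>x v\<parallel> \<le> K \<parallel>v\<parallel>\<close> on \<open>H\<close>. Written in this way
  it makes sense for a set \<open>H\<close> with a nonnegative function \<open>hn\<close>, without any linear structure.
\<close>

definition op_norm :: "'h set \<Rightarrow> ('h \<Rightarrow> real) \<Rightarrow> ('a \<Rightarrow> 'h \<Rightarrow> 'h) \<Rightarrow> 'a \<Rightarrow> real" where
  "op_norm H hn act x = Inf {K. 0 \<le> K \<and> (\<forall>v\<in>H. hn (act x v) \<le> K * hn v)}"

text \<open>
  An action of a *-algebra by bounded maps of \<open>(H, hn)\<close> for which the operator norm is a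
  C*-seminorm. No linear structure on \<open>H\<close> is needed, so direct sums of representations may be replaced
  by disjoint unions, and only norms of vectors are compared.
\<close>

locale cstar_action = star_algebra A for A :: "('a, 'm) star_algebra_scheme" (structure) +
  fixes H :: "'h set" and hn :: "'h \<Rightarrow> real" and act :: "'a \<Rightarrow> 'h \<Rightarrow> 'h"
  assumes hn_nonneg: "v \<in> H \<Longrightarrow> 0 \<le> hn v"
    and act_closed: "\<lbrakk>x \<in> carrier A; v \<in> H\<rbrakk> \<Longrightarrow> act x v \<in> H"
    and act_add: "\<lbrakk>x \<in> carrier A; y \<in> carrier A; v \<in> H\<rbrakk>
      \<Longrightarrow> hn (act (x \<boxplus> y) v) \<le> hn (act x v) + hn (act y v)"
    and act_scale: "\<lbrakk>x \<in> carrier A; v \<in> H\<rbrakk> \<Longrightarrow> hn (act (c \<boxdot> x) v) \<le> cmod c * hn (act x v)"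
    and act_mult: "\<lbrakk>x \<in> carrier A; y \<in> carrier A; v \<in> H\<rbrakk>
      \<Longrightarrow> hn (act (x \<boxtimes> y) v) \<le> hn (act x (act y v))"
    and act_bounded: "x \<in> carrier A \<Longrightarrow> \<exists>K\<ge>0. \<forall>v\<in>H. hn (act x v) \<le> K * hn v"
    and act_cstar: "\<lbrakk>x \<in> carrier A; v \<in> H\<rbrakk>
      \<Longrightarrow> (hn (act x v))\<^sup>2 \<le> hn v * hn (act (adj A x \<boxtimes> x) v)"
begin

abbreviation opn :: "'a \<Rightarrow> real" where "opn \<equiv> op_norm H hn act"

lemma opn_le: "\<lbrakk>0 \<le> K; \<And>v. v \<in> H \<Longrightarrow> hn (act x v) \<le> K * hn v\<rbrakk> \<Longrightarrow> opn x \<le> K"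
  unfolding op_norm_def by (rule cInf_lower) (auto intro!: bdd_belowI[of _ 0])

lemma opn_nonneg: "x \<in> carrier A \<Longrightarrow> 0 \<le> opn x"
  unfolding op_norm_def using act_bounded[of x] by (intro cInf_greatest) auto

lemma act_le_opn:
  assumes x: "x \<in> carrier A" and v: "v \<in> H"
  shows "hn (act x v) \<le> opn x * hn v"
proof (cases "hn v = 0")
  case True
  then show ?thesis using act_bounded[OF x] v by auto
next
  case False
  then have pos: "hn v > 0" using hn_nonneg[OF v] by simp
  have "hn (act x v) / hn v \<le> opn x"
    unfolding op_norm_def
    using act_bounded[OF x] v pos by (intro cInf_greatest) (auto simp: divide_le_eq)
  then show ?thesis using pos by (simp add: divide_le_eq)
qed

lemma opn_add:
  assumes "x \<in> carrier A" "y \<in> carrier A"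
  shows "opn (x \<boxplus> y) \<le> opn x + opn y"
proof (rule opn_le)
  show "hn (act (x \<boxplus> y) v) \<le> (opn x + opn y) * hn v" if v: "v \<in> H" for v
    using act_add[OF assms v] act_le_opn[OF assms(1) v] act_le_opn[OF assms(2) v]
    by (simp add: ring_distribs)
qed (use assms opn_nonneg in auto)

lemma opn_mult:
  assumes "x \<in> carrier A" "y \<in> carrier A"
  shows "opn (x \<boxtimes> y) \<le> opn x * opn y"
proof (rule opn_le)
  fix v assume v: "v \<in> H"
  have "hn (act (x \<boxtimes> y) v) \<le> opn x * hn (act y v)"
    using act_mult[OF assms v] act_le_opn[OF assms(1) act_closed[OF assms(2) v]] by simp
  also have "\<dots> \<le> opn x * (opn y * hn v)"
    using act_le_opn[OF assms(2) v] opn_nonneg[OF assms(1)] by (rule mult_left_mono)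
  finally show "hn (act (x \<boxtimes> y) v) \<le> opn x * opn y * hn v" by simp
qed (use assms opn_nonneg in auto)

lemma opn_scale_le:
  assumes "x \<in> carrier A"
  shows "opn (c \<boxdot> x) \<le> cmod c * opn x"
proof (rule opn_le)
  fix v assume v: "v \<in> H"
  have "hn (act (c \<boxdot> x) v) \<le> cmod c * hn (act x v)" using act_scale[OF assms v] .
  also have "\<dots> \<le> cmod c * (opn x * hn v)"
    using act_le_opn[OF assms v] by (rule mult_left_mono) simp
  finally show "hn (act (c \<boxdot> x) v) \<le> cmod c * opn x * hn v" by simp
qed (use assms opn_nonneg in auto)

lemma opn_scale:
  assumes x: "x \<in> carrier A"
  shows "opn (c \<boxdot> x) = cmod c * opn x"
proof (rule antisym[OF opn_scale_le[OF x]])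
  show "cmod c * opn x \<le> opn (c \<boxdot> x)"
  proof (cases "c = 0")
    case True
    then show ?thesis using opn_nonneg x scale_closed by simp
  next
    case False
    then have "inverse c \<boxdot> c \<boxdot> x = x" using x by (simp add: scale_scale scale_one)
    then have "opn x \<le> cmod (inverse c) * opn (c \<boxdot> x)"
      using opn_scale_le[of "c \<boxdot> x" "inverse c"] x by (simp add: scale_closed)
    then show ?thesis using False by (simp add: norm_inverse norm_divide field_simps)
  qed
qed

lemma opn_cstar_le:
  assumes x: "x \<in> carrier A"
  shows "(opn x)\<^sup>2 \<le> opn (adj A x \<boxtimes> x)"
proof -
  let ?z = "adj A x \<boxtimes> x"
  have z: "?z \<in> carrier A" using x by (simp add: adj_closed mult_closed)
  have "opn x \<le> sqrt (opn ?z)"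
  proof (rule opn_le)
    fix v assume v: "v \<in> H"
    have "(hn (act x v))\<^sup>2 \<le> hn v * hn (act ?z v)" by (rule act_cstar[OF x v])
    also have "\<dots> \<le> hn v * (opn ?z * hn v)"
      using act_le_opn[OF z v] hn_nonneg[OF v] by (rule mult_left_mono)
    also have "\<dots> = (sqrt (opn ?z) * hn v)\<^sup>2"
      using opn_nonneg[OF z] by (simp add: power_mult_distrib) (simp add: power2_eq_square)
    finally show "hn (act x v) \<le> sqrt (opn ?z) * hn v"
      using opn_nonneg[OF z] hn_nonneg[OF v] by (auto intro: power2_le_imp_le)
  qed (use opn_nonneg[OF z] in auto)
  then have "(opn x)\<^sup>2 \<le> (sqrt (opn ?z))\<^sup>2" using opn_nonneg[OF x] by (rule power_mono)
  then show ?thesis using opn_nonneg[OF z] by simp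
qed

lemma opn_le_opn_adj:
  assumes x: "x \<in> carrier A"
  shows "opn x \<le> opn (adj A x)"
proof -
  have "opn x * opn x \<le> opn (adj A x) * opn x"
    using opn_cstar_le[OF x] opn_mult[of "adj A x" x] x by (simp add: adj_closed power2_eq_square)
  then show ?thesis
    using opn_nonneg[OF x] opn_nonneg[of "adj A x"] x
    by (cases "opn x = 0") (auto simp: adj_closed mult_le_cancel_right)
qed

lemma opn_cstar:
  assumes x: "x \<in> carrier A"
  shows "opn (adj A x \<boxtimes> x) = (opn x)\<^sup>2"
proof (rule antisym[OF _ opn_cstar_le[OF x]])
  have "opn (adj A x) \<le> opn x" using opn_le_opn_adj[of "adj A x"] x by (simp add: adj_closed adj_adj)
  then have "opn (adj A x) * opn x \<le> opn x * opn x"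
    using opn_nonneg[OF x] by (rule mult_right_mono)
  then show "opn (adj A x \<boxtimes> x) \<le> (opn x)\<^sup>2"
    using opn_mult[of "adj A x" x] x by (simp add: adj_closed power2_eq_square)
qed

theorem cstar_algebra_op_norm:
  assumes faithful: "\<And>x. \<lbrakk>x \<in> carrier A; opn x = 0\<rbrakk> \<Longrightarrow> x = vzero A"
    and compl: "\<And>s. \<lbrakk>\<And>k::nat. s k \<in> carrier A;
        \<And>d. d > 0 \<Longrightarrow> \<exists>N. \<forall>k\<ge>N. \<forall>l\<ge>N. opn (s k \<boxplus> (-1) \<boxdot> s l) < d\<rbrakk>
      \<Longrightarrow> \<exists>x\<in>carrier A. (\<lambda>k. opn (s k \<boxplus> (-1) \<boxdot> x)) \<longlonglongrightarrow> 0"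
  shows "cstar_algebra (with_norm A opn)"
proof -
  have z: "opn (vzero A) = 0" using opn_scale[of "vzero A" 0] by simp
  show ?thesis
    by (intro cstar_algebra.intro cstar_algebra_axioms.intro)
      (use faithful z compl in \<open>auto simp: star_algebra_axioms opn_add opn_scale opn_mult opn_cstar adist_def\<close>)
qed

end

section \<open>The C*-norm on the unitization\<close>

lemma unitization_simps [simp]:
  "carrier (unitization B) = carrier B \<times> UNIV"
  "vadd (unitization B) (x, c) (y, d) = (vadd B x y, c + d)"
  "vzero (unitization B) = (vzero B, 0)"
  "amult (unitization B) (x, c) (y, d) =
    (vadd B (vadd B (amult B x y) (cscale B c y)) (cscale B d x), c * d)"
  "cscale (unitization B) a (x, c) = (cscale B a x, a * c)"
  "adj (unitization B) (x, c) = (adj B x, cnj c)"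
  by (simp_all add: unitization_def)

context star_algebra
begin

lemma unital_star_algebra_unitization: "unital_star_algebra (unitization A) (new_unit A)"
proof -
  have grp: "comm_group (add_group (unitization A))"
  proof (rule comm_groupI)
    fix x assume "x \<in> carrier (add_group (unitization A))"
    then show "\<exists>y\<in>carrier (add_group (unitization A)).
        y \<otimes>\<^bsub>add_group (unitization A)\<^esub> x = \<one>\<^bsub>add_group (unitization A)\<^esub>"
      by (intro bexI[of _ "cscale (unitization A) (-1) x"]) (auto simp: add_group_def scale_closed)
  qed (auto simp: add_group_def add.m_assoc intro: add.m_comm)
  have "star_algebra (unitization A)"
    by (intro star_algebra.intro grp)
      (auto simp: scale_closed scale_add_right scale_add_left scale_scale scale_one mult_closed
        mult_assoc distrib_right distrib_left scale_mult_left scale_mult_right adj_closed adj_adj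
        adj_add adj_scale adj_mult ring_distribs mult_ac add.m_ac)
  then show ?thesis
    by (intro unital_star_algebra.intro unital_star_algebra_axioms.intro)
      (auto simp: new_unit_def scale_closed scale_one)
qed

end

text \<open>
  The unitization of \<open>A\<close> acts on the disjoint union of \<open>A\<close>, by left multiplication, and of the complex
  numbers, through the scalar part. The first action alone is not faithful when \<open>A\<close> is unital; the
  operator norm on the disjoint union is the maximum of the two operator norms.
\<close>

definition unitization_space :: "('a, 'm) star_algebra_scheme \<Rightarrow> ('a + complex) set" where
  "unitization_space A = carrier A <+> UNIV"

primrec unitization_act ::
    "('a, 'm) star_algebra_scheme \<Rightarrow> 'a \<times> complex \<Rightarrow> 'a + complex \<Rightarrow> 'a + complex" where
  "unitization_act A p (Inl y) = Inl (fst p \<boxtimes>\<^bsub>A\<^esub> y \<boxplus>\<^bsub>A\<^esub> snd p \<boxdot>\<^bsub>A\<^esub> y)"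
| "unitization_act A p (Inr z) = Inr (snd p * z)"

definition unitization_norm :: "('a, 'm) cstar_algebra_scheme \<Rightarrow> 'a \<times> complex \<Rightarrow> real" where
  "unitization_norm A = op_norm (unitization_space A) (case_sum (anorm A) cmod) (unitization_act A)"

context cstar_algebra
begin

lemma norm_zero [simp]: "anorm A (vzero A) = 0"
  by (simp add: norm_eq_zero)

lemma norm_nonneg [simp]: "x \<in> carrier A \<Longrightarrow> 0 \<le> anorm A x"
  using norm_triangle[of x "(-1) \<boxdot> x"] norm_scale[of x "-1"] by (simp add: scale_closed)

lemma norm_le_norm_adj: "x \<in> carrier A \<Longrightarrow> anorm A x \<le> anorm A (adj A x)"
proof -
  assume x: "x \<in> carrier A"
  have "anorm A x * anorm A x \<le> anorm A (adj A x) * anorm A x"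
    using norm_cstar[OF x] norm_mult[of "adj A x" x] x by (simp add: power2_eq_square adj_closed)
  then show ?thesis
    using norm_nonneg[OF x] norm_nonneg[of "adj A x"] x
    by (cases "anorm A x = 0") (auto simp: adj_closed mult_le_cancel_right)
qed

lemma norm_adj [simp]: "x \<in> carrier A \<Longrightarrow> anorm A (adj A x) = anorm A x"
  using norm_le_norm_adj[of x] norm_le_norm_adj[of "adj A x"] by (simp add: adj_closed adj_adj)

lemma norm_mult_adj: "x \<in> carrier A \<Longrightarrow> anorm A (x \<boxtimes> adj A x) = (anorm A x)\<^sup>2"
  using norm_cstar[of "adj A x"] by (simp add: adj_closed adj_adj)

lemma unitization_act_bound:
  assumes x: "x \<in> carrier A" and v: "v \<in> unitization_space A"
  shows "case_sum (anorm A) cmod (unitization_act A (x, c) v)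
    \<le> (anorm A x + cmod c) * case_sum (anorm A) cmod v"
proof (cases v)
  case (Inl u)
  then have u: "u \<in> carrier A" using v by (auto simp: unitization_space_def)
  then show ?thesis
    using Inl x u norm_triangle[of "x \<boxtimes> u" "c \<boxdot> u"] norm_mult[OF x u]
    by (simp add: mult_closed scale_closed norm_scale ring_distribs)
next
  case (Inr z)
  then show ?thesis using x by (simp add: Real_Vector_Spaces.norm_mult ring_distribs)
qed

interpretation unitization: cstar_action "unitization A" "unitization_space A"
  "case_sum (anorm A) cmod" "unitization_act A"
proof -
  interpret U: unital_star_algebra "unitization A" "new_unit A"
    by (rule unital_star_algebra_unitization)
  show "cstar_action (unitization A) (unitization_space A) (case_sum (anorm A) cmod) (unitization_act A)"
  proof (intro cstar_action.intro cstar_action_axioms.intro U.star_algebra_axioms)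
    fix v assume v: "v \<in> unitization_space A"
    show "0 \<le> case_sum (anorm A) cmod v"
      using v by (auto simp: unitization_space_def)
    fix p assume p: "p \<in> carrier (unitization A)"
    obtain x c where [simp]: "p = (x, c)" and x: "x \<in> carrier A" using p by auto
    show "unitization_act A p v \<in> unitization_space A"
      using v x by (auto simp: unitization_space_def scale_closed mult_closed)
    show "case_sum (anorm A) cmod (unitization_act A (a \<boxdot>\<^bsub>unitization A\<^esub> p) v)
        \<le> cmod a * case_sum (anorm A) cmod (unitization_act A p v)" for a
    proof (cases v)
      case (Inl y)
      then have y: "y \<in> carrier A" using v by (auto simp: unitization_space_def)
      have "(a \<boxdot> x) \<boxtimes> y \<boxplus> (a * c) \<boxdot> y = a \<boxdot> (x \<boxtimes> y \<boxplus> c \<boxdot> y)"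
        using x y by (simp add: scale_mult_left scale_add_right scale_scale mult_closed scale_closed)
      then show ?thesis using Inl x y by (simp add: norm_scale mult_closed scale_closed)
    qed (simp add: Real_Vector_Spaces.norm_mult)
    show "(case_sum (anorm A) cmod (unitization_act A p v))\<^sup>2 \<le> case_sum (anorm A) cmod v *
        case_sum (anorm A) cmod (unitization_act A (adj (unitization A) p \<boxtimes>\<^bsub>unitization A\<^esub> p) v)"
    proof (cases v)
      case (Inl y)
      then have y: "y \<in> carrier A" using v by (auto simp: unitization_space_def)
      define w where "w = x \<boxtimes> y \<boxplus> c \<boxdot> y"
      have w: "w \<in> carrier A" using x y by (simp add: w_def mult_closed scale_closed)
      have "adj A w \<boxtimes> w = adj A y \<boxtimes> (adj A x \<boxtimes> w \<boxplus> cnj c \<boxdot> w)"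
        using x y w by (subst (1) w_def)
          (simp add: adj_add adj_mult adj_scale distrib_right distrib_left mult_assoc scale_mult_left
            scale_mult_right mult_closed scale_closed adj_closed)
      also have "adj A x \<boxtimes> w \<boxplus> cnj c \<boxdot> w
          = (adj A x \<boxtimes> x \<boxplus> cnj c \<boxdot> x \<boxplus> c \<boxdot> adj A x) \<boxtimes> y \<boxplus> (cnj c * c) \<boxdot> y"
        using x y by (simp add: w_def distrib_right distrib_left mult_assoc scale_mult_left
            scale_mult_right mult_closed scale_closed adj_closed scale_add_right scale_scale add.m_ac)
      finally have "(anorm A w)\<^sup>2 = anorm A (adj A y \<boxtimes>
          ((adj A x \<boxtimes> x \<boxplus> cnj c \<boxdot> x \<boxplus> c \<boxdot> adj A x) \<boxtimes> y \<boxplus> (cnj c * c) \<boxdot> y))"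
        using norm_cstar[OF w] by simp
      also have "\<dots> \<le> anorm A (adj A y) *
          anorm A ((adj A x \<boxtimes> x \<boxplus> cnj c \<boxdot> x \<boxplus> c \<boxdot> adj A x) \<boxtimes> y \<boxplus> (cnj c * c) \<boxdot> y)"
        using x y by (intro norm_mult) (auto simp: mult_closed scale_closed adj_closed)
      finally show ?thesis using Inl y by (simp add: w_def)
    qed (simp add: Real_Vector_Spaces.norm_mult power2_eq_square)
    fix q assume q: "q \<in> carrier (unitization A)"
    obtain y d where [simp]: "q = (y, d)" and y: "y \<in> carrier A" using q by auto
    show "case_sum (anorm A) cmod (unitization_act A (p \<boxplus>\<^bsub>unitization A\<^esub> q) v)
        \<le> case_sum (anorm A) cmod (unitization_act A p v) + case_sum (anorm A) cmod (unitization_act A q v)"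
    proof (cases v)
      case (Inl u)
      then have u: "u \<in> carrier A" using v by (auto simp: unitization_space_def)
      have "(x \<boxplus> y) \<boxtimes> u \<boxplus> (c + d) \<boxdot> u = (x \<boxtimes> u \<boxplus> c \<boxdot> u) \<boxplus> (y \<boxtimes> u \<boxplus> d \<boxdot> u)"
        using x y u by (simp add: distrib_right scale_add_left mult_closed scale_closed add.m_ac)
      then show ?thesis
        using Inl x y u norm_triangle[of "x \<boxtimes> u \<boxplus> c \<boxdot> u" "y \<boxtimes> u \<boxplus> d \<boxdot> u"]
        by (simp add: mult_closed scale_closed)
    qed (simp add: Rings.distrib_right norm_triangle_ineq)
    show "case_sum (anorm A) cmod (unitization_act A (p \<boxtimes>\<^bsub>unitization A\<^esub> q) v)
        \<le> case_sum (anorm A) cmod (unitization_act A p (unitization_act A q v))"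
    proof (cases v)
      case (Inl u)
      then have u: "u \<in> carrier A" using v by (auto simp: unitization_space_def)
      have "(x \<boxtimes> y \<boxplus> c \<boxdot> y \<boxplus> d \<boxdot> x) \<boxtimes> u \<boxplus> (c * d) \<boxdot> u
          = x \<boxtimes> (y \<boxtimes> u \<boxplus> d \<boxdot> u) \<boxplus> c \<boxdot> (y \<boxtimes> u \<boxplus> d \<boxdot> u)"
        using x y u by (simp add: distrib_right distrib_left mult_assoc scale_mult_left
            scale_mult_right mult_closed scale_closed scale_add_right scale_scale add.m_ac)
      then show ?thesis using Inl by simp
    qed (simp add: mult.assoc)
  next
    fix p assume p: "p \<in> carrier (unitization A)"
    obtain x c where [simp]: "p = (x, c)" and x: "x \<in> carrier A" using p by auto
    show "\<exists>K\<ge>0. \<forall>v\<in>unitization_space A. case_sum (anorm A) cmod (unitization_act A p v)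
        \<le> K * case_sum (anorm A) cmod v"
      using x unitization_act_bound[OF x] by (intro exI[of _ "anorm A x + cmod c"]) simp
  qed
qed

lemma unitization_norm_le: "x \<in> carrier A \<Longrightarrow> unitization_norm A (x, c) \<le> anorm A x + cmod c"
  unfolding unitization_norm_def by (rule unitization.opn_le) (auto intro: unitization_act_bound)

lemma scalar_le_unitization_norm: "x \<in> carrier A \<Longrightarrow> cmod c \<le> unitization_norm A (x, c)"
  using unitization.act_le_opn[of "(x, c)" "Inr 1"]
  by (auto simp: unitization_norm_def unitization_space_def)

text \<open>
  Applying \<open>x + c\<close> to the vector \<open>x*\<close> recovers \<open>\<parallel>x x*\<parallel> = \<parallel>x\<parallel>\<^sup>2\<close> up to \<open>\<bar>c\<bar> \<parallel>x\<parallel>\<close>. Together with the two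
  neighbouring bounds this shows that the norm is equivalent to \<open>\<parallel>x\<parallel> + \<bar>c\<bar>\<close>, whence completeness.
\<close>

lemma norm_le_unitization_norm:
  assumes x: "x \<in> carrier A"
  shows "anorm A x \<le> 2 * unitization_norm A (x, c)"
proof -
  let ?w = "x \<boxtimes> adj A x" and ?N = "unitization_norm A (x, c)"
  have "anorm A (?w \<boxplus> c \<boxdot> adj A x) \<le> ?N * anorm A x"
    using unitization.act_le_opn[of "(x, c)" "Inl (adj A x)"] x
    by (simp add: unitization_norm_def unitization_space_def adj_closed InlI)
  moreover have "?w = (?w \<boxplus> c \<boxdot> adj A x) \<boxplus> (-1) \<boxdot> (c \<boxdot> adj A x)"
    using x by (simp add: mult_closed adj_closed scale_closed add.m_assoc del: scale_scale)
  then have "anorm A ?w \<le> anorm A (?w \<boxplus> c \<boxdot> adj A x) + cmod c * anorm A x"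
    using norm_triangle[of "?w \<boxplus> c \<boxdot> adj A x" "(-1) \<boxdot> (c \<boxdot> adj A x)"] x
    by (simp add: mult_closed adj_closed scale_closed norm_scale)
  moreover have "cmod c * anorm A x \<le> ?N * anorm A x"
    using scalar_le_unitization_norm[OF x] x by (intro mult_right_mono) auto
  ultimately have "anorm A x * anorm A x \<le> (2 * ?N) * anorm A x"
    using norm_mult_adj[OF x] by (simp add: power2_eq_square)
  moreover have "0 \<le> ?N" using scalar_le_unitization_norm[OF x, of c] norm_ge_zero[of c] by linarith
  ultimately show ?thesis
    using norm_nonneg[OF x] by (cases "anorm A x = 0") (auto simp: mult_le_cancel_right)
qed

theorem unital_cstar_algebra_unitization:
  "unital_cstar_algebra (with_norm (unitization A) (unitization_norm A)) (new_unit A)"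
proof -
  interpret U: unital_star_algebra "unitization A" "new_unit A"
    by (rule unital_star_algebra_unitization)
  have "cstar_algebra (with_norm (unitization A) (unitization_norm A))"
    unfolding unitization_norm_def
  proof (rule unitization.cstar_algebra_op_norm; fold unitization_norm_def)
    fix p assume "p \<in> carrier (unitization A)" and 0: "unitization_norm A p = 0"
    then obtain x c where p: "p = (x, c)" and x: "x \<in> carrier A" by auto
    have "c = 0" "anorm A x = 0"
      using 0 scalar_le_unitization_norm[OF x, of c] norm_le_unitization_norm[OF x, of c] norm_nonneg[OF x]
      unfolding p by (auto intro: antisym)
    then show "p = vzero (unitization A)" using x by (simp add: p norm_eq_zero)
  next
    fix s assume s: "\<And>k::nat. s k \<in> carrier (unitization A)"
      and Cauchy: "\<And>d::real. d > 0 \<Longrightarrow> \<exists>N. \<forall>k\<ge>N. \<forall>l\<ge>N.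
        unitization_norm A (s k \<boxplus>\<^bsub>unitization A\<^esub> (-1) \<boxdot>\<^bsub>unitization A\<^esub> s l) < d"
    define x where "x = (\<lambda>k. fst (s k))"
    define c where "c = (\<lambda>k. snd (s k))"
    have s_eq: "s k = (x k, c k)" for k by (simp add: x_def c_def)
    have xc: "x k \<in> carrier A" for k using s[of k] by (simp add: s_eq)
    have diff: "s k \<boxplus>\<^bsub>unitization A\<^esub> (-1) \<boxdot>\<^bsub>unitization A\<^esub> (y, d)
        = (x k \<boxplus> (-1) \<boxdot> y, c k - d)" for k y d by (simp add: s_eq)
    have dc: "x k \<boxplus> (-1) \<boxdot> y \<in> carrier A" if "y \<in> carrier A" for k y
      using xc that by (simp add: scale_closed)
    have "\<exists>N. \<forall>k\<ge>N. \<forall>l\<ge>N. adist A (x k) (x l) < d" if d: "d > 0" for d :: real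
    proof -
      obtain N where N: "\<forall>k\<ge>N. \<forall>l\<ge>N. unitization_norm A (x k \<boxplus> (-1) \<boxdot> x l, c k - c l) < d / 2"
        using Cauchy[of "d / 2"] half_gt_zero[OF d] by (auto simp: s_eq simp del: less_divide_eq_numeral1)
      have "adist A (x k) (x l) < d" if "k \<ge> N" "l \<ge> N" for k l
        using norm_le_unitization_norm[OF dc[OF xc], of k l "c k - c l"] N that by (force simp: adist_def)
      then show ?thesis by blast
    qed
    then obtain y where y: "y \<in> carrier A" "(\<lambda>k. adist A (x k) y) \<longlonglongrightarrow> 0"
      using complete[of x] xc by blast
    have "Cauchy c"
      unfolding Cauchy_def dist_norm
    proof (intro allI impI)
      fix d :: real assume "d > 0"
      then obtain N where N: "\<forall>k\<ge>N. \<forall>l\<ge>N. unitization_norm A (x k \<boxplus> (-1) \<boxdot> x l, c k - c l) < d"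
        using Cauchy[of d] by (auto simp: s_eq)
      have "cmod (c k - c l) < d" if "k \<ge> N" "l \<ge> N" for k l
        using scalar_le_unitization_norm[OF dc[OF xc], of "c k - c l" k l] N that by force
      then show "\<exists>N. \<forall>k\<ge>N. \<forall>l\<ge>N. cmod (c k - c l) < d" by blast
    qed
    then obtain d where d: "c \<longlonglongrightarrow> d" using Cauchy_convergent convergent_def by blast
    have "(\<lambda>k. adist A (x k) y + cmod (c k - d)) \<longlonglongrightarrow> 0 + 0"
      using d by (intro tendsto_add y) (simp add: LIM_zero tendsto_norm_zero)
    then have lim: "(\<lambda>k. adist A (x k) y + cmod (c k - d)) \<longlonglongrightarrow> 0" by simp
    have "(\<lambda>k. unitization_norm A (s k \<boxplus>\<^bsub>unitization A\<^esub> (-1) \<boxdot>\<^bsub>unitization A\<^esub> (y, d))) \<longlonglongrightarrow> 0"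
    proof (rule tendsto_sandwich[OF _ _ tendsto_const lim]; intro always_eventually allI)
      fix k
      show "0 \<le> unitization_norm A (s k \<boxplus>\<^bsub>unitization A\<^esub> (-1) \<boxdot>\<^bsub>unitization A\<^esub> (y, d))"
        unfolding diff using scalar_le_unitization_norm[OF dc[OF y(1)], of "c k - d" k] norm_ge_zero[of "c k - d"]
        by linarith
      show "unitization_norm A (s k \<boxplus>\<^bsub>unitization A\<^esub> (-1) \<boxdot>\<^bsub>unitization A\<^esub> (y, d))
          \<le> adist A (x k) y + cmod (c k - d)"
        unfolding diff adist_def by (rule unitization_norm_le[OF dc[OF y(1)]])
    qed
    then show "\<exists>x\<in>carrier (unitization A).
        (\<lambda>k. unitization_norm A (s k \<boxplus>\<^bsub>unitization A\<^esub> (-1) \<boxdot>\<^bsub>unitization A\<^esub> x)) \<longlonglongrightarrow> 0"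
      using y by (intro bexI[of _ "(y, d)"]) auto
  qed
  then show ?thesis
    by (intro unital_cstar_algebra.intro unital_star_algebra.intro unital_star_algebra_axioms.intro)
      (auto simp: unitization.star_algebra_axioms simp del: unitization_simps)
qed

end

section \<open>The C*-norm on matrices\<close>

lemma mat_alg_entries [simp]:
  assumes "i \<in> {1..n}" "j \<in> {1..n}"
  shows "vadd (mat_alg n B) M N (i, j) = vadd B (M (i, j)) (N (i, j))"
    and "vzero (mat_alg n B) (i, j) = vzero B"
    and "amult (mat_alg n B) M N (i, j)
      = finprod (add_group B) (\<lambda>k. amult B (M (i, k)) (N (k, j))) {1..n}"
    and "cscale (mat_alg n B) c M (i, j) = cscale B c (M (i, j))"
    and "adj (mat_alg n B) M (i, j) = adj B (M (j, i))"
  using assms by (simp_all add: mat_alg_def)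

lemma mat_alg_entry_closed:
  "\<lbrakk>M \<in> carrier (mat_alg n B); i \<in> {1..n}; j \<in> {1..n}\<rbrakk> \<Longrightarrow> M (i, j) \<in> carrier B"
  by (auto simp: mat_alg_def)

lemma mat_alg_eqI:
  assumes "M \<in> carrier (mat_alg n B)" "N \<in> carrier (mat_alg n B)"
    and "\<And>i j. \<lbrakk>i \<in> {1..n}; j \<in> {1..n}\<rbrakk> \<Longrightarrow> M (i, j) = N (i, j)"
  shows "M = N"
proof (rule PiE_ext)
  show "M \<in> {1..n} \<times> {1..n} \<rightarrow>\<^sub>E carrier B" "N \<in> {1..n} \<times> {1..n} \<rightarrow>\<^sub>E carrier B"
    using assms(1,2) by (simp_all add: mat_alg_def)
qed (use assms(3) in auto)

context unital_cstar_algebra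
begin

lemma mat_mult_entry:
  "\<lbrakk>i \<in> {1..n}; j \<in> {1..n}\<rbrakk> \<Longrightarrow>
    amult (mat_alg n A) M N (i, j) = finsum (ring_of A e) (\<lambda>k. M (i, k) \<boxtimes> N (k, j)) {1..n}"
  by (simp add: finsum_ring_of[of A e])

lemma mat_mult_entry_mv:
  "\<lbrakk>i \<in> {1..n}; j \<in> {1..n}\<rbrakk> \<Longrightarrow>
    amult (mat_alg n A) M N (i, j) = R.mv {1..n} M (\<lambda>k. N (k, j)) i"
  by (simp add: mat_mult_entry R.mv_def del: mat_alg_entries)

lemma mat_closed:
  assumes M: "M \<in> carrier (mat_alg n A)"
  shows mat_add_closed: "N \<in> carrier (mat_alg n A) \<Longrightarrow> vadd (mat_alg n A) M N \<in> carrier (mat_alg n A)"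
    and mat_scale_closed: "cscale (mat_alg n A) c M \<in> carrier (mat_alg n A)"
    and mat_mult_closed: "N \<in> carrier (mat_alg n A) \<Longrightarrow> amult (mat_alg n A) M N \<in> carrier (mat_alg n A)"
    and mat_adj_closed: "adj (mat_alg n A) M \<in> carrier (mat_alg n A)"
  using M by (auto simp: mat_alg_def adj_closed scale_closed mult_closed
      finsum_ring_of[of A e, symmetric] intro!: R.finsum_closed dest: PiE_mem)

lemma mat_zero_closed: "vzero (mat_alg n A) \<in> carrier (mat_alg n A)"
  by (auto simp: mat_alg_def)

lemma finsum_scale:
  assumes "finite I" "\<And>k. k \<in> I \<Longrightarrow> f k \<in> carrier A"
  shows "finsum (ring_of A e) (\<lambda>k. c \<boxdot> f k) I = c \<boxdot> finsum (ring_of A e) f I"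
  using assms
  by (induction I rule: finite_induct)
    (auto simp: scale_add_right scale_closed Pi_def R.finsum_closed)

lemma star_algebra_mat_alg: "star_algebra (mat_alg n A)"
proof -
  let ?E = "mat_alg n A"
  note ec = mat_alg_entry_closed[where B = A and n = n]
  note cl = mat_add_closed mat_scale_closed mat_mult_closed mat_adj_closed mat_zero_closed
  have grp: "comm_group (add_group ?E)"
  proof (rule comm_groupI)
    fix x assume "x \<in> carrier (add_group ?E)"
    then have x: "x \<in> carrier ?E" by (simp add: add_group_def)
    have "vadd ?E (cscale ?E (-1) x) x = vzero ?E"
      using x ec[OF x] by (intro mat_alg_eqI[where n = n and B = A] cl) auto
    then show "\<exists>y\<in>carrier (add_group ?E). y \<otimes>\<^bsub>add_group ?E\<^esub> x = \<one>\<^bsub>add_group ?E\<^esub>"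
      using x by (intro bexI[of _ "cscale ?E (-1) x"]) (auto simp: add_group_def cl)
  qed (auto simp: add_group_def cl ec add.m_assoc intro!: mat_alg_eqI[where n = n and B = A] add.m_comm)
  show ?thesis
  proof (intro star_algebra.intro grp)
    fix x y z assume x: "x \<in> carrier ?E" and y: "y \<in> carrier ?E" and z: "z \<in> carrier ?E"
    show "amult ?E (amult ?E x y) z = amult ?E x (amult ?E y z)"
    proof (rule mat_alg_eqI[where n = n and B = A])
      fix i j assume i: "i \<in> {1..n}" and j: "j \<in> {1..n}"
      have "amult ?E (amult ?E x y) z (i, j) = R.mv {1..n} (amult ?E x y) (\<lambda>k. z (k, j)) i"
        by (rule mat_mult_entry_mv[OF i j])
      also have "\<dots> = R.mv {1..n} x (R.mv {1..n} y (\<lambda>k. z (k, j))) i"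
        by (rule R.mv_mult) (use x y z i j in \<open>auto simp: ec mat_mult_entry simp del: mat_alg_entries\<close>)
      also have "\<dots> = R.mv {1..n} x (\<lambda>k. amult ?E y z (k, j)) i"
        unfolding R.mv_def[of "{1..n}" x]
        by (rule R.finsum_cong')
          (use x y z i j in \<open>auto simp: ec mat_mult_entry_mv mult_closed intro!: mult_closed R.mv_closed
            simp del: mat_alg_entries\<close>)
      also have "\<dots> = amult ?E x (amult ?E y z) (i, j)"
        by (rule mat_mult_entry_mv[OF i j, symmetric])
      finally show "amult ?E (amult ?E x y) z (i, j) = amult ?E x (amult ?E y z) (i, j)" .
    qed (use x y z in \<open>auto simp: cl\<close>)
    show "amult ?E (vadd ?E x y) z = vadd ?E (amult ?E x z) (amult ?E y z)"
    proof (rule mat_alg_eqI[where n = n and B = A])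
      fix i j assume i: "i \<in> {1..n}" and j: "j \<in> {1..n}"
      have "amult ?E (vadd ?E x y) z (i, j)
          = finsum (ring_of A e) (\<lambda>k. x (i, k) \<boxtimes> z (k, j) \<boxplus> y (i, k) \<boxtimes> z (k, j)) {1..n}"
        unfolding mat_mult_entry[OF i j]
        by (rule R.finsum_cong') (use x y z i j in \<open>auto simp: ec mult_closed distrib_right\<close>)
      also have "\<dots> = vadd ?E (amult ?E x z) (amult ?E y z) (i, j)"
        unfolding mat_alg_entries(1)[OF i j] mat_mult_entry[OF i j]
        by (rule R.finsum_addf) (use x y z i j in \<open>auto simp: ec mult_closed\<close>)
      finally show "amult ?E (vadd ?E x y) z (i, j) = vadd ?E (amult ?E x z) (amult ?E y z) (i, j)" .
    qed (use x y z in \<open>auto simp: cl\<close>)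
    show "amult ?E x (vadd ?E y z) = vadd ?E (amult ?E x y) (amult ?E x z)"
    proof (rule mat_alg_eqI[where n = n and B = A])
      fix i j assume i: "i \<in> {1..n}" and j: "j \<in> {1..n}"
      have "amult ?E x (vadd ?E y z) (i, j)
          = finsum (ring_of A e) (\<lambda>k. x (i, k) \<boxtimes> y (k, j) \<boxplus> x (i, k) \<boxtimes> z (k, j)) {1..n}"
        unfolding mat_mult_entry[OF i j]
        by (rule R.finsum_cong') (use x y z i j in \<open>auto simp: ec mult_closed distrib_left\<close>)
      also have "\<dots> = vadd ?E (amult ?E x y) (amult ?E x z) (i, j)"
        unfolding mat_alg_entries(1)[OF i j] mat_mult_entry[OF i j]
        by (rule R.finsum_addf) (use x y z i j in \<open>auto simp: ec mult_closed\<close>)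
      finally show "amult ?E x (vadd ?E y z) (i, j) = vadd ?E (amult ?E x y) (amult ?E x z) (i, j)" .
    qed (use x y z in \<open>auto simp: cl\<close>)
  next
    fix x y assume x: "x \<in> carrier ?E" and y: "y \<in> carrier ?E"
    show "amult ?E (cscale ?E c x) y = cscale ?E c (amult ?E x y)" for c
    proof (rule mat_alg_eqI[where n = n and B = A])
      fix i j assume i: "i \<in> {1..n}" and j: "j \<in> {1..n}"
      have "amult ?E (cscale ?E c x) y (i, j)
          = finsum (ring_of A e) (\<lambda>k. c \<boxdot> (x (i, k) \<boxtimes> y (k, j))) {1..n}"
        unfolding mat_mult_entry[OF i j]
        by (rule R.finsum_cong') (use x y i j in \<open>auto simp: ec mult_closed scale_closed scale_mult_left\<close>)
      also have "\<dots> = cscale ?E c (amult ?E x y) (i, j)"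
        unfolding mat_alg_entries(4)[OF i j] mat_mult_entry[OF i j]
        by (rule finsum_scale) (use x y i j in \<open>auto simp: ec mult_closed\<close>)
      finally show "amult ?E (cscale ?E c x) y (i, j) = cscale ?E c (amult ?E x y) (i, j)" .
    qed (use x y in \<open>auto simp: cl\<close>)
    show "amult ?E x (cscale ?E c y) = cscale ?E c (amult ?E x y)" for c
    proof (rule mat_alg_eqI[where n = n and B = A])
      fix i j assume i: "i \<in> {1..n}" and j: "j \<in> {1..n}"
      have "amult ?E x (cscale ?E c y) (i, j)
          = finsum (ring_of A e) (\<lambda>k. c \<boxdot> (x (i, k) \<boxtimes> y (k, j))) {1..n}"
        unfolding mat_mult_entry[OF i j]
        by (rule R.finsum_cong') (use x y i j in \<open>auto simp: ec mult_closed scale_closed scale_mult_right\<close>)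
      also have "\<dots> = cscale ?E c (amult ?E x y) (i, j)"
        unfolding mat_alg_entries(4)[OF i j] mat_mult_entry[OF i j]
        by (rule finsum_scale) (use x y i j in \<open>auto simp: ec mult_closed\<close>)
      finally show "amult ?E x (cscale ?E c y) (i, j) = cscale ?E c (amult ?E x y) (i, j)" .
    qed (use x y in \<open>auto simp: cl\<close>)
    show "adj ?E (amult ?E x y) = amult ?E (adj ?E y) (adj ?E x)"
    proof (rule mat_alg_eqI[where n = n and B = A])
      fix i j assume i: "i \<in> {1..n}" and j: "j \<in> {1..n}"
      have "adj ?E (amult ?E x y) (i, j)
          = finsum (ring_of A e) (\<lambda>k. adj A (x (j, k) \<boxtimes> y (k, i))) {1..n}"
        unfolding mat_alg_entries(5)[OF i j] mat_mult_entry[OF j i]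
        by (rule R.st_finsum) (use x y i j in \<open>auto simp: ec mult_closed\<close>)
      also have "\<dots> = amult ?E (adj ?E y) (adj ?E x) (i, j)"
        unfolding mat_mult_entry[OF i j]
        by (rule R.finsum_cong') (use x y i j in \<open>auto simp: ec mult_closed adj_closed adj_mult\<close>)
      finally show "adj ?E (amult ?E x y) (i, j) = amult ?E (adj ?E y) (adj ?E x) (i, j)" .
    qed (use x y in \<open>auto simp: cl\<close>)
  qed (auto simp: cl ec scale_add_right scale_add_left scale_scale scale_one adj_adj adj_add adj_scale
      intro!: mat_alg_eqI[where n = n and B = A])
qed

text \<open>
  The norm of a matrix as an operator on the Hilbert module of column vectors.
\<close>

definition mat_norm :: "nat \<Rightarrow> (nat \<times> nat \<Rightarrow> 'a) \<Rightarrow> real" where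
  "mat_norm n = op_norm ({1..n} \<rightarrow> carrier A) (R.vnm {1..n}) (R.mv {1..n})"

lemma cstar_action_mat: "cstar_action (mat_alg n A) ({1..n} \<rightarrow> carrier A) (R.vnm {1..n}) (R.mv {1..n})"
proof -
  let ?E = "mat_alg n A"
  note ec = mat_alg_entry_closed[where B = A and n = n]
  note cl = mat_add_closed mat_scale_closed mat_mult_closed mat_adj_closed mat_zero_closed
  show ?thesis
  proof (intro cstar_action.intro cstar_action_axioms.intro star_algebra_mat_alg)
    fix v assume "v \<in> {1..n} \<rightarrow> carrier A"
    then have v: "\<And>i. i \<in> {1..n} \<Longrightarrow> v i \<in> carrier A" by auto
    show "0 \<le> R.vnm {1..n} v" using v by (intro R.vnm_nonneg) auto
    fix x assume x: "x \<in> carrier ?E"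
    have xv: "R.mv {1..n} x v i \<in> carrier A" if "i \<in> {1..n}" for i
      by (rule R.mv_closed) (use ec[OF x] v that in auto)
    show "R.mv {1..n} x v \<in> {1..n} \<rightarrow> carrier A" using xv by auto
    show "R.vnm {1..n} (R.mv {1..n} (cscale ?E c x) v) \<le> cmod c * R.vnm {1..n} (R.mv {1..n} x v)" for c
    proof -
      have "R.mv {1..n} (cscale ?E c x) v i = c \<boxdot> e \<boxtimes> R.mv {1..n} x v i" if i: "i \<in> {1..n}" for i
      proof -
        have "R.mv {1..n} (cscale ?E c x) v i = finsum (ring_of A e) (\<lambda>k. c \<boxdot> (x (i, k) \<boxtimes> v k)) {1..n}"
          unfolding R.mv_def
          by (rule R.finsum_cong') (use x v i in \<open>auto simp: ec mult_closed scale_closed scale_mult_left\<close>)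
        also have "\<dots> = c \<boxdot> R.mv {1..n} x v i"
          unfolding R.mv_def by (rule finsum_scale) (use x v i in \<open>auto simp: ec mult_closed\<close>)
        finally show ?thesis using xv[OF i] by (simp add: scale_mult_left)
      qed
      then have "R.vnm {1..n} (R.mv {1..n} (cscale ?E c x) v)
          = R.vnm {1..n} (\<lambda>i. c \<boxdot> e \<boxtimes> R.mv {1..n} x v i)"
        using xv by (intro R.vnm_cong) (auto simp: mult_closed scale_closed)
      also have "\<dots> = cmod c * R.vnm {1..n} (R.mv {1..n} x v)"
        using xv by (intro R.vnm_scale) auto
      finally show ?thesis by simp
    qed
    show "(R.vnm {1..n} (R.mv {1..n} x v))\<^sup>2
        \<le> R.vnm {1..n} v * R.vnm {1..n} (R.mv {1..n} (amult ?E (adj ?E x) x) v)"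
      by (rule R.vnm_mv_cstar[where N = "adj ?E x"])
        (use x v in \<open>auto simp: ec mat_mult_entry simp del: mat_alg_entries(3)\<close>)
    fix y assume y: "y \<in> carrier ?E"
    have yv: "R.mv {1..n} y v i \<in> carrier A" if "i \<in> {1..n}" for i
      by (rule R.mv_closed) (use ec[OF y] v that in auto)
    show "R.vnm {1..n} (R.mv {1..n} (vadd ?E x y) v)
        \<le> R.vnm {1..n} (R.mv {1..n} x v) + R.vnm {1..n} (R.mv {1..n} y v)"
    proof -
      have "R.mv {1..n} (vadd ?E x y) v i = R.mv {1..n} x v i \<boxplus> R.mv {1..n} y v i" if i: "i \<in> {1..n}" for i
      proof -
        have "R.mv {1..n} (vadd ?E x y) v i
            = finsum (ring_of A e) (\<lambda>k. x (i, k) \<boxtimes> v k \<boxplus> y (i, k) \<boxtimes> v k) {1..n}"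
          unfolding R.mv_def
          by (rule R.finsum_cong') (use x y v i in \<open>auto simp: ec mult_closed distrib_right\<close>)
        also have "\<dots> = R.mv {1..n} x v i \<boxplus> R.mv {1..n} y v i"
          unfolding R.mv_def by (rule R.finsum_addf) (use x y v i in \<open>auto simp: ec mult_closed\<close>)
        finally show ?thesis .
      qed
      then have "R.vnm {1..n} (R.mv {1..n} (vadd ?E x y) v)
          = R.vnm {1..n} (\<lambda>i. R.mv {1..n} x v i \<boxplus> R.mv {1..n} y v i)"
        using xv yv by (intro R.vnm_cong) auto
      also have "\<dots> \<le> R.vnm {1..n} (R.mv {1..n} x v) + R.vnm {1..n} (R.mv {1..n} y v)"
        using xv yv by (intro R.vnm_triangle) auto
      finally show ?thesis .
    qed
    have "R.mv {1..n} (amult ?E x y) v i = R.mv {1..n} x (R.mv {1..n} y v) i" if "i \<in> {1..n}" for i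
      by (rule R.mv_mult) (use x y v that in \<open>auto simp: ec mat_mult_entry simp del: mat_alg_entries\<close>)
    then have "R.vnm {1..n} (R.mv {1..n} (amult ?E x y) v)
        = R.vnm {1..n} (R.mv {1..n} x (R.mv {1..n} y v))"
    proof (rule R.vnm_cong[OF finite_atLeastAtMost])
      show "R.mv {1..n} x (R.mv {1..n} y v) i \<in> carrier A" if "i \<in> {1..n}" for i
        by (rule R.mv_closed) (use ec[OF x] yv that in auto)
    qed
    then show "R.vnm {1..n} (R.mv {1..n} (amult ?E x y) v)
        \<le> R.vnm {1..n} (R.mv {1..n} x (R.mv {1..n} y v))" by simp
  next
    fix x assume x: "x \<in> carrier ?E"
    have "R.vnm {1..n} (R.mv {1..n} x v) \<le> (\<Sum>i=1..n. \<Sum>j=1..n. anorm A (x (i, j))) * R.vnm {1..n} v"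
      if "v \<in> {1..n} \<rightarrow> carrier A" for v
      by (rule R.mv_bound) (use ec[OF x] that in auto)
    moreover have "0 \<le> (\<Sum>i=1..n. \<Sum>j=1..n. anorm A (x (i, j)))"
      using ec[OF x] by (intro sum_nonneg) auto
    ultimately show "\<exists>K\<ge>0. \<forall>v\<in>{1..n} \<rightarrow> carrier A. R.vnm {1..n} (R.mv {1..n} x v) \<le> K * R.vnm {1..n} v"
      by blast
  qed
qed

lemma mat_norm_le:
  assumes x: "x \<in> carrier (mat_alg n A)"
  shows "mat_norm n x \<le> (\<Sum>i=1..n. \<Sum>j=1..n. anorm A (x (i, j)))"
  unfolding mat_norm_def
proof (rule cstar_action.opn_le[OF cstar_action_mat])
  note ec = mat_alg_entry_closed[OF x]
  show "0 \<le> (\<Sum>i=1..n. \<Sum>j=1..n. anorm A (x (i, j)))"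
    using ec by (intro sum_nonneg) auto
  show "R.vnm {1..n} (R.mv {1..n} x v) \<le> (\<Sum>i=1..n. \<Sum>j=1..n. anorm A (x (i, j))) * R.vnm {1..n} v"
    if "v \<in> {1..n} \<rightarrow> carrier A" for v
    by (rule R.mv_bound) (use ec that in auto)
qed

lemma mat_norm_nonneg: "x \<in> carrier (mat_alg n A) \<Longrightarrow> 0 \<le> mat_norm n x"
  unfolding mat_norm_def by (rule cstar_action.opn_nonneg[OF cstar_action_mat])

lemma norm_entry_le_mat_norm:
  assumes x: "x \<in> carrier (mat_alg n A)" and ij: "i \<in> {1..n}" "j \<in> {1..n}"
  shows "anorm A (x (i, j)) \<le> mat_norm n x"
proof -
  note ec = mat_alg_entry_closed[OF x]
  define v where "v = (\<lambda>k. if k = j then e else vzero A)"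
  have v: "v \<in> {1..n} \<rightarrow> carrier A" by (auto simp: v_def)
  have "x (i, j) = R.mv {1..n} x v i"
    unfolding v_def by (rule R.mv_unit_vector[symmetric]) (use ec ij in auto)
  also have "anorm A \<dots> \<le> R.vnm {1..n} (R.mv {1..n} x v)"
    by (rule R.nm_entry_le_vnm) (use ec v ij in \<open>auto intro!: R.mv_closed\<close>)
  also have "\<dots> \<le> mat_norm n x * R.vnm {1..n} v"
    unfolding mat_norm_def by (rule cstar_action.act_le_opn[OF cstar_action_mat x v])
  also have "\<dots> \<le> mat_norm n x * 1"
    unfolding v_def using ij mat_norm_nonneg[OF x] by (intro mult_left_mono R.vnm_unit_vector_le) auto
  finally show ?thesis by simp
qed

theorem cstar_algebra_mat_alg: "cstar_algebra (with_norm (mat_alg n A) (mat_norm n))"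
  unfolding mat_norm_def
proof (rule cstar_action.cstar_algebra_op_norm[OF cstar_action_mat]; fold mat_norm_def)
  let ?E = "mat_alg n A"
  note cl = mat_add_closed mat_scale_closed mat_mult_closed mat_adj_closed mat_zero_closed
  fix x assume x: "x \<in> carrier ?E" and 0: "mat_norm n x = 0"
  show "x = vzero ?E"
  proof (rule mat_alg_eqI[where n = n and B = A])
    fix i j assume ij: "i \<in> {1..n}" "j \<in> {1..n}"
    have c: "x (i, j) \<in> carrier A" by (rule mat_alg_entry_closed[OF x ij])
    have "anorm A (x (i, j)) = 0"
      using norm_entry_le_mat_norm[OF x ij] 0 R.nm_nonneg[OF c] by simp
    then show "x (i, j) = vzero ?E (i, j)" using ij norm_eq_zero[OF c] by simp
  qed (use x cl in auto)
next
  let ?E = "mat_alg n A"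
  note cl = mat_add_closed mat_scale_closed mat_mult_closed mat_adj_closed mat_zero_closed
  fix s assume s: "\<And>k::nat. s k \<in> carrier ?E"
    and Cauchy: "\<And>d::real. d > 0 \<Longrightarrow>
      \<exists>N. \<forall>k\<ge>N. \<forall>l\<ge>N. mat_norm n (s k \<boxplus>\<^bsub>?E\<^esub> (-1) \<boxdot>\<^bsub>?E\<^esub> s l) < d"
  have diff: "adist A (x (i, j)) (y (i, j)) \<le> mat_norm n (x \<boxplus>\<^bsub>?E\<^esub> (-1) \<boxdot>\<^bsub>?E\<^esub> y)"
    if "x \<in> carrier ?E" "y \<in> carrier ?E" "i \<in> {1..n}" "j \<in> {1..n}" for x y i j
    using norm_entry_le_mat_norm[of "x \<boxplus>\<^bsub>?E\<^esub> (-1) \<boxdot>\<^bsub>?E\<^esub> y" n i j] that by (simp add: cl adist_def)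
  have "\<exists>y\<in>carrier A. (\<lambda>k. adist A (s k p) y) \<longlonglongrightarrow> 0" if p: "p \<in> {1..n} \<times> {1..n}" for p
  proof (rule complete)
    obtain i j where ij: "p = (i, j)" "i \<in> {1..n}" "j \<in> {1..n}" using p by auto
    show "s k p \<in> carrier A" for k using mat_alg_entry_closed[OF s] ij by simp
    fix d :: real assume "d > 0"
    then show "\<exists>N. \<forall>k\<ge>N. \<forall>l\<ge>N. adist A (s k p) (s l p) < d"
      using Cauchy[of d] diff[OF s s ij(2,3)] unfolding ij by (meson le_less_trans)
  qed
  then obtain y where y: "\<And>p. p \<in> {1..n} \<times> {1..n} \<Longrightarrow> y p \<in> carrier A \<and> (\<lambda>k. adist A (s k p) (y p)) \<longlonglongrightarrow> 0"
    by metis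
  define x where "x = restrict y ({1..n} \<times> {1..n})"
  have x: "x \<in> carrier ?E" using y by (auto simp: x_def mat_alg_def)
  have lim: "(\<lambda>k. \<Sum>i=1..n. \<Sum>j=1..n. adist A (s k (i, j)) (x (i, j))) \<longlonglongrightarrow> 0"
    by (intro tendsto_null_sum) (use y in \<open>auto simp: x_def\<close>)
  have "(\<lambda>k. mat_norm n (s k \<boxplus>\<^bsub>?E\<^esub> (-1) \<boxdot>\<^bsub>?E\<^esub> x)) \<longlonglongrightarrow> 0"
  proof (rule tendsto_sandwich[OF _ _ tendsto_const lim]; intro always_eventually allI)
    fix k
    have c: "s k \<boxplus>\<^bsub>?E\<^esub> (-1) \<boxdot>\<^bsub>?E\<^esub> x \<in> carrier ?E" using s x by (simp add: cl)
    show "0 \<le> mat_norm n (s k \<boxplus>\<^bsub>?E\<^esub> (-1) \<boxdot>\<^bsub>?E\<^esub> x)" by (rule mat_norm_nonneg[OF c])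
    show "mat_norm n (s k \<boxplus>\<^bsub>?E\<^esub> (-1) \<boxdot>\<^bsub>?E\<^esub> x)
        \<le> (\<Sum>i=1..n. \<Sum>j=1..n. adist A (s k (i, j)) (x (i, j)))"
      using mat_norm_le[OF c] by (simp add: adist_def)
  qed
  then show "\<exists>x\<in>carrier ?E. (\<lambda>k. mat_norm n (s k \<boxplus>\<^bsub>?E\<^esub> (-1) \<boxdot>\<^bsub>?E\<^esub> x)) \<longlonglongrightarrow> 0"
    using x by blast
qed

end

section \<open>*-homomorphisms and transport of C*-algebras\<close>

lemma star_homs_with_norm_left [simp]: "star_homs (with_norm A N) B = star_homs A B"
  by (simp add: star_homs_def)

lemma star_homs_with_norm_right [simp]: "star_homs A (with_norm B N) = star_homs A B"
  by (simp add: star_homs_def)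

lemma mat_alg_with_norm [simp]: "mat_alg n (with_norm B N) = mat_alg n B"
  by (simp add: mat_alg_def)

lemma star_homsI:
  assumes "\<phi> \<in> carrier A \<rightarrow>\<^sub>E carrier B"
    and "\<And>x y. \<lbrakk>x \<in> carrier A; y \<in> carrier A\<rbrakk> \<Longrightarrow> \<phi> (x \<boxplus>\<^bsub>A\<^esub> y) = \<phi> x \<boxplus>\<^bsub>B\<^esub> \<phi> y"
    and "\<And>c x. x \<in> carrier A \<Longrightarrow> \<phi> (c \<boxdot>\<^bsub>A\<^esub> x) = c \<boxdot>\<^bsub>B\<^esub> \<phi> x"
    and "\<And>x y. \<lbrakk>x \<in> carrier A; y \<in> carrier A\<rbrakk> \<Longrightarrow> \<phi> (x \<boxtimes>\<^bsub>A\<^esub> y) = \<phi> x \<boxtimes>\<^bsub>B\<^esub> \<phi> y"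
    and "\<And>x. x \<in> carrier A \<Longrightarrow> \<phi> (adj A x) = adj B (\<phi> x)"
  shows "\<phi> \<in> star_homs A B"
  using assms by (simp add: star_homs_def)

lemma star_homsD:
  assumes "\<phi> \<in> star_homs A B"
  shows star_hom_extensional: "\<phi> \<in> carrier A \<rightarrow>\<^sub>E carrier B"
    and star_hom_closed: "x \<in> carrier A \<Longrightarrow> \<phi> x \<in> carrier B"
    and star_hom_add: "\<lbrakk>x \<in> carrier A; y \<in> carrier A\<rbrakk> \<Longrightarrow> \<phi> (x \<boxplus>\<^bsub>A\<^esub> y) = \<phi> x \<boxplus>\<^bsub>B\<^esub> \<phi> y"
    and star_hom_scale: "x \<in> carrier A \<Longrightarrow> \<phi> (c \<boxdot>\<^bsub>A\<^esub> x) = c \<boxdot>\<^bsub>B\<^esub> \<phi> x"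
    and star_hom_mult: "\<lbrakk>x \<in> carrier A; y \<in> carrier A\<rbrakk> \<Longrightarrow> \<phi> (x \<boxtimes>\<^bsub>A\<^esub> y) = \<phi> x \<boxtimes>\<^bsub>B\<^esub> \<phi> y"
    and star_hom_adj: "x \<in> carrier A \<Longrightarrow> \<phi> (adj A x) = adj B (\<phi> x)"
  using assms by (auto simp: star_homs_def)

lemma star_hom_compose:
  assumes A: "star_algebra A" and \<phi>: "\<phi> \<in> star_homs A B" and \<psi>: "\<psi> \<in> star_homs B C"
  shows "compose (carrier A) \<psi> \<phi> \<in> star_homs A C"
proof -
  interpret A: star_algebra A by (rule A)
  show ?thesis
    by (rule star_homsI)
      (auto simp: compose_def star_homsD[OF \<phi>] star_homsD[OF \<psi>] A.scale_closed A.mult_closed A.adj_closed)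
qed

lemma star_hom_zero:
  assumes "star_algebra A" "star_algebra B" "\<phi> \<in> star_homs A B"
  shows "\<phi> (vzero A) = vzero B"
proof -
  interpret A: star_algebra A by fact
  interpret B: star_algebra B by fact
  show ?thesis
    using star_hom_scale[OF assms(3) A.add.one_closed, of 0]
      star_hom_closed[OF assms(3) A.add.one_closed] by simp
qed

lemma star_hom_finprod:
  assumes "star_algebra A" "star_algebra B" "\<phi> \<in> star_homs A B"
    and "finite I" "\<And>i. i \<in> I \<Longrightarrow> f i \<in> carrier A"
  shows "\<phi> (finprod (add_group A) f I) = finprod (add_group B) (\<lambda>i. \<phi> (f i)) I"
proof -
  interpret A: star_algebra A by fact
  interpret B: star_algebra B by fact
  show ?thesis using assms(4,5)
  proof (induction I rule: finite_induct)
    case empty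
    then show ?case using star_hom_zero[OF assms(1-3)] by simp
  next
    case (insert i I)
    have "finprod (add_group A) f I \<in> carrier A"
      using insert by (intro A.add.finprod_closed) auto
    then show ?case
      using insert star_homsD[OF assms(3)] by (simp add: Pi_def)
  qed
qed

text \<open>
  The C*-algebra structure on the image of an injection \<open>f\<close> that makes \<open>f\<close> an isomorphism.
\<close>

definition transport :: "('a \<Rightarrow> 'u) \<Rightarrow> ('a, 'm) cstar_algebra_scheme \<Rightarrow> 'u cstar_algebra" where
  "transport f A = (let g = inv_into (carrier A) f in
     \<lparr>carrier = f ` carrier A, vadd = (\<lambda>x y. f (g x \<boxplus>\<^bsub>A\<^esub> g y)), vzero = f (vzero A),
      amult = (\<lambda>x y. f (g x \<boxtimes>\<^bsub>A\<^esub> g y)), cscale = (\<lambda>c x. f (c \<boxdot>\<^bsub>A\<^esub> g x)),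
      adj = (\<lambda>x. f (adj A (g x))), anorm = (\<lambda>x. anorm A (g x))\<rparr>)"

context
  fixes A :: "('a, 'm) cstar_algebra_scheme" and f :: "'a \<Rightarrow> 'u"
  assumes A: "cstar_algebra A" and inj: "inj_on f (carrier A)"
begin

interpretation A: cstar_algebra A by (rule A)

lemma transport_simps:
  "carrier (transport f A) = f ` carrier A"
  "\<lbrakk>x \<in> carrier A; y \<in> carrier A\<rbrakk> \<Longrightarrow> f x \<boxplus>\<^bsub>transport f A\<^esub> f y = f (x \<boxplus>\<^bsub>A\<^esub> y)"
  "vzero (transport f A) = f (vzero A)"
  "\<lbrakk>x \<in> carrier A; y \<in> carrier A\<rbrakk> \<Longrightarrow> f x \<boxtimes>\<^bsub>transport f A\<^esub> f y = f (x \<boxtimes>\<^bsub>A\<^esub> y)"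
  "x \<in> carrier A \<Longrightarrow> c \<boxdot>\<^bsub>transport f A\<^esub> f x = f (c \<boxdot>\<^bsub>A\<^esub> x)"
  "x \<in> carrier A \<Longrightarrow> adj (transport f A) (f x) = f (adj A x)"
  "x \<in> carrier A \<Longrightarrow> anorm (transport f A) (f x) = anorm A x"
  using inj by (simp_all add: transport_def Let_def)

lemma cstar_algebra_transport: "cstar_algebra (transport f A)"
proof -
  let ?T = "transport f A"
  note cl = A.scale_closed A.mult_closed A.adj_closed
  have inj': "f x = f y \<longleftrightarrow> x = y" if "x \<in> carrier A" "y \<in> carrier A" for x y
    using inj that by (auto dest: inj_onD)
  have grp: "comm_group (add_group ?T)"
  proof (rule comm_groupI)
    fix x assume "x \<in> carrier (add_group ?T)"
    then obtain y where "x = f y" "y \<in> carrier A" by (auto simp: add_group_def transport_simps)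
    then show "\<exists>y\<in>carrier (add_group ?T). y \<otimes>\<^bsub>add_group ?T\<^esub> x = \<one>\<^bsub>add_group ?T\<^esub>"
      by (intro bexI[of _ "f ((-1) \<boxdot>\<^bsub>A\<^esub> y)"]) (auto simp: add_group_def transport_simps cl)
  qed (auto simp: add_group_def transport_simps A.add.m_assoc intro!: arg_cong[of _ _ f] A.add.m_comm)
  have star: "star_algebra ?T"
    by (intro star_algebra.intro grp; unfold transport_simps; elim imageE)
      (auto simp: transport_simps cl A.scale_add_right A.scale_add_left A.scale_scale A.scale_one
        A.mult_assoc A.distrib_right A.distrib_left A.scale_mult_left A.scale_mult_right
        A.adj_adj A.adj_add A.adj_scale A.adj_mult)
  show ?thesis
  proof (intro cstar_algebra.intro star cstar_algebra_axioms.intro)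
    fix s assume s: "\<And>k::nat. s k \<in> carrier ?T"
      and C: "\<And>d::real. d > 0 \<Longrightarrow> \<exists>N. \<forall>k\<ge>N. \<forall>l\<ge>N. adist ?T (s k) (s l) < d"
    have "\<forall>k. \<exists>y\<in>carrier A. s k = f y" using s by (auto simp: transport_simps)
    then obtain t where t: "\<And>k. t k \<in> carrier A" "\<And>k. s k = f (t k)" by metis
    have d: "adist ?T (f x) (f y) = adist A x y" if "x \<in> carrier A" "y \<in> carrier A" for x y
      using that by (simp add: adist_def transport_simps cl)
    obtain x where "x \<in> carrier A" "(\<lambda>k. adist A (t k) x) \<longlonglongrightarrow> 0"
      using A.complete[of t] t C by (auto simp: d)
    then show "\<exists>x\<in>carrier ?T. (\<lambda>k. adist ?T (s k) x) \<longlonglongrightarrow> 0"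
      using t by (intro bexI[of _ "f x"]) (auto simp: d transport_simps)
  qed (auto simp: transport_simps cl inj' A.norm_eq_zero A.norm_triangle A.norm_scale A.norm_mult A.norm_cstar)
qed

lemma transport_hom: "restrict f (carrier A) \<in> star_homs A (transport f A)"
  by (rule star_homsI) (auto simp: transport_simps A.scale_closed A.mult_closed A.adj_closed)

lemma transport_inv_hom:
  "restrict (inv_into (carrier A) f) (f ` carrier A) \<in> star_homs (transport f A) A"
  by (rule star_homsI; unfold transport_simps; (elim imageE)?)
    (use inj in \<open>auto simp: transport_simps A.scale_closed A.mult_closed A.adj_closed\<close>)

end

text \<open>
  A projective algebra lifts along surjections between C*-algebras of arbitrary types, as long as
  their carriers can be embedded into the universe \<open>'u\<close>.
\<close>

lemma projective_lift:
  fixes B :: "('b, 'm) cstar_algebra_scheme" and D :: "('d, 'k) cstar_algebra_scheme"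
    and f :: "'b \<Rightarrow> 'u" and g :: "'d \<Rightarrow> 'u"
  assumes P: "projective TYPE('u) P" and B: "cstar_algebra B" and D: "cstar_algebra D"
    and f: "inj_on f (carrier B)" and g: "inj_on g (carrier D)"
    and \<rho>: "\<rho> \<in> star_homs B D" "\<rho> ` carrier B = carrier D" and \<phi>: "\<phi> \<in> star_homs P D"
  shows "\<exists>\<psi>\<in>star_homs P B. compose (carrier P) \<rho> \<psi> = \<phi>"
proof -
  interpret P: cstar_algebra P using P by (simp add: projective_def)
  interpret B: cstar_algebra B by (rule B)
  let ?B = "transport f B" and ?D = "transport g D"
  let ?f = "restrict f (carrier B)" and ?g = "restrict g (carrier D)"
  let ?f' = "restrict (inv_into (carrier B) f) (f ` carrier B)"
  let ?\<rho> = "compose (carrier ?B) ?g (compose (carrier ?B) \<rho> ?f')"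
  let ?\<phi> = "compose (carrier P) ?g \<phi>"
  have T: "cstar_algebra ?B" "cstar_algebra ?D"
    using B D f g by (auto intro: cstar_algebra_transport)
  then interpret TB: cstar_algebra ?B by simp
  have 1: "?\<rho> \<in> star_homs ?B ?D"
    using star_hom_compose[OF TB.star_algebra_axioms
        star_hom_compose[OF TB.star_algebra_axioms transport_inv_hom[OF B f] \<rho>(1)] transport_hom[OF D g]] .
  have \<rho>f: "?\<rho> (f b) = g (\<rho> b)" if "b \<in> carrier B" for b
    using that f star_hom_closed[OF \<rho>(1)] by (simp add: compose_def transport_simps[OF B f])
  have "?\<rho> ` carrier ?B = g ` \<rho> ` carrier B"
    unfolding transport_simps[OF B f] image_image using \<rho>f transport_simps(1)[OF B f] by (intro image_cong) auto
  then have 2: "?\<rho> ` carrier ?B = carrier ?D" using \<rho>(2) by (simp add: transport_simps(1)[OF D g])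
  have 3: "?\<phi> \<in> star_homs P ?D"
    by (rule star_hom_compose[OF P.star_algebra_axioms \<phi> transport_hom[OF D g]])
  obtain \<psi> where \<psi>: "\<psi> \<in> star_homs P ?B" and eq: "compose (carrier P) ?\<rho> \<psi> = ?\<phi>"
    using P T 1 2 3 unfolding projective_def by blast
  let ?\<psi> = "compose (carrier P) ?f' \<psi>"
  have "?\<psi> \<in> star_homs P B"
    by (rule star_hom_compose[OF P.star_algebra_axioms \<psi> transport_inv_hom[OF B f]])
  moreover have "compose (carrier P) \<rho> ?\<psi> = \<phi>"
  proof (rule PiE_ext)
    show "compose (carrier P) \<rho> ?\<psi> \<in> carrier P \<rightarrow>\<^sub>E carrier D"
      using star_hom_extensional[OF star_hom_compose[OF P.star_algebra_axioms \<open>?\<psi> \<in> star_homs P B\<close> \<rho>(1)]] .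
    show "\<phi> \<in> carrier P \<rightarrow>\<^sub>E carrier D" using star_hom_extensional[OF \<phi>] .
    fix x assume x: "x \<in> carrier P"
    then obtain b where b: "b \<in> carrier B" "\<psi> x = f b"
      using star_hom_closed[OF \<psi>] by (auto simp: transport_simps[OF B f])
    have "g (\<rho> b) = g (\<phi> x)"
      using fun_cong[OF eq, of x] x b \<rho>f star_hom_closed[OF \<phi> x] by (simp add: compose_eq)
    then have "\<rho> b = \<phi> x"
      using g star_hom_closed[OF \<phi> x] star_hom_closed[OF \<rho>(1) b(1)] by (auto dest: inj_onD)
    then show "compose (carrier P) \<rho> ?\<psi> x = \<phi> x" using x b f by (simp add: compose_eq)
  qed
  ultimately show ?thesis by blast
qed

section \<open>Induced maps on unitizations and matrices\<close>

text \<open>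
  The unital extension \<open>\<rho>~\<close> of a map to the unitizations; it keeps the scalar part.
\<close>

definition unitization_map :: "('b \<Rightarrow> 'd) \<Rightarrow> 'b \<times> complex \<Rightarrow> 'd \<times> complex" where
  "unitization_map \<rho> p = (\<rho> (fst p), snd p)"

text \<open>
  The entrywise extension of a map to matrices.
\<close>

definition mat_map ::
    "nat \<Rightarrow> ('b, 'm) star_algebra_scheme \<Rightarrow> ('b \<Rightarrow> 'd) \<Rightarrow> (nat \<times> nat \<Rightarrow> 'b) \<Rightarrow> nat \<times> nat \<Rightarrow> 'd" where
  "mat_map n B u = (\<lambda>M\<in>carrier (mat_alg n B). \<lambda>p\<in>{1..n} \<times> {1..n}. u (M p))"

lemma unitization_map_hom:
  assumes "\<rho> \<in> star_homs B D" and B: "star_algebra B"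
  shows "restrict (unitization_map \<rho>) (carrier (unitization B)) \<in> star_homs (unitization B) (unitization D)"
proof -
  interpret B: star_algebra B by (rule B)
  show ?thesis
    by (rule star_homsI)
      (auto simp: unitization_def unitization_map_def star_homsD[OF assms(1)] B.scale_closed
        B.mult_closed B.adj_closed)
qed

lemma mat_map_hom:
  assumes u: "u \<in> star_homs U V" and U: "star_algebra U" and V: "star_algebra V"
    and MU: "star_algebra (mat_alg n U)" and MV: "star_algebra (mat_alg n V)"
  shows "mat_map n U u \<in> star_homs (mat_alg n U) (mat_alg n V)"
proof -
  interpret U: star_algebra U by (rule U)
  interpret M: star_algebra "mat_alg n U" by (rule MU)
  note ec = mat_alg_entry_closed[where B = U and n = n]
  have entry: "mat_map n U u M (i, j) = u (M (i, j))"
    if "M \<in> carrier (mat_alg n U)" "i \<in> {1..n}" "j \<in> {1..n}" for M i j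
    using that by (simp add: mat_map_def)
  have cl: "mat_map n U u M \<in> carrier (mat_alg n V)" if "M \<in> carrier (mat_alg n U)" for M
    using that star_hom_closed[OF u] by (auto simp: mat_map_def mat_alg_def PiE_mem)
  have fp: "u (finprod (add_group U) (\<lambda>k. M (i, k) \<boxtimes>\<^bsub>U\<^esub> N (k, j)) {1..n})
      = finprod (add_group V) (\<lambda>k. u (M (i, k) \<boxtimes>\<^bsub>U\<^esub> N (k, j))) {1..n}"
    if "M \<in> carrier (mat_alg n U)" "N \<in> carrier (mat_alg n U)" "i \<in> {1..n}" "j \<in> {1..n}" for M N i j
    using that by (intro star_hom_finprod[OF U V u]) (auto intro!: U.mult_closed ec)
  interpret V: star_algebra V by (rule V)
  interpret MV: star_algebra "mat_alg n V" by (rule MV)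
  show ?thesis
  proof (rule star_homsI)
    show "mat_map n U u \<in> carrier (mat_alg n U) \<rightarrow>\<^sub>E carrier (mat_alg n V)"
      using cl unfolding mat_map_def by (intro restrict_PiE_iff[THEN iffD2]) auto
    fix M assume M: "M \<in> carrier (mat_alg n U)"
    show "mat_map n U u (c \<boxdot>\<^bsub>mat_alg n U\<^esub> M) = c \<boxdot>\<^bsub>mat_alg n V\<^esub> mat_map n U u M" for c
    proof (rule mat_alg_eqI[OF cl[OF M.scale_closed[OF M]] MV.scale_closed[OF cl[OF M]]])
      fix i j assume ij: "i \<in> {1..n}" "j \<in> {1..n}"
      show "mat_map n U u (c \<boxdot>\<^bsub>mat_alg n U\<^esub> M) (i, j) = (c \<boxdot>\<^bsub>mat_alg n V\<^esub> mat_map n U u M) (i, j)"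
        unfolding entry[OF M.scale_closed[OF M] ij] mat_alg_entries(4)[OF ij] entry[OF M ij]
        by (rule star_hom_scale[OF u ec[OF M ij]])
    qed
    show "mat_map n U u (adj (mat_alg n U) M) = adj (mat_alg n V) (mat_map n U u M)"
    proof (rule mat_alg_eqI[OF cl[OF M.adj_closed[OF M]] MV.adj_closed[OF cl[OF M]]])
      fix i j assume ij: "i \<in> {1..n}" "j \<in> {1..n}"
      show "mat_map n U u (adj (mat_alg n U) M) (i, j) = adj (mat_alg n V) (mat_map n U u M) (i, j)"
        unfolding entry[OF M.adj_closed[OF M] ij] mat_alg_entries(5)[OF ij] entry[OF M ij(2,1)]
        by (rule star_hom_adj[OF u ec[OF M ij(2,1)]])
    qed
    fix N assume N: "N \<in> carrier (mat_alg n U)"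
    show "mat_map n U u (M \<boxplus>\<^bsub>mat_alg n U\<^esub> N) = mat_map n U u M \<boxplus>\<^bsub>mat_alg n V\<^esub> mat_map n U u N"
    proof (rule mat_alg_eqI[OF cl[OF M.add.m_closed[OF M N]] MV.add.m_closed[OF cl[OF M] cl[OF N]]])
      fix i j assume ij: "i \<in> {1..n}" "j \<in> {1..n}"
      show "mat_map n U u (M \<boxplus>\<^bsub>mat_alg n U\<^esub> N) (i, j)
          = (mat_map n U u M \<boxplus>\<^bsub>mat_alg n V\<^esub> mat_map n U u N) (i, j)"
        unfolding entry[OF M.add.m_closed[OF M N] ij] mat_alg_entries(1)[OF ij] entry[OF M ij] entry[OF N ij]
        by (rule star_hom_add[OF u ec[OF M ij] ec[OF N ij]])
    qed
    show "mat_map n U u (M \<boxtimes>\<^bsub>mat_alg n U\<^esub> N) = mat_map n U u M \<boxtimes>\<^bsub>mat_alg n V\<^esub> mat_map n U u N"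
    proof (rule mat_alg_eqI[OF cl[OF M.mult_closed[OF M N]] MV.mult_closed[OF cl[OF M] cl[OF N]]])
      fix i j assume ij: "i \<in> {1..n}" "j \<in> {1..n}"
      have "u (M (i, k) \<boxtimes>\<^bsub>U\<^esub> N (k, j)) = mat_map n U u M (i, k) \<boxtimes>\<^bsub>V\<^esub> mat_map n U u N (k, j)"
        if k: "k \<in> {1..n}" for k
        unfolding entry[OF M ij(1) k] entry[OF N k ij(2)]
        by (rule star_hom_mult[OF u ec[OF M ij(1) k] ec[OF N k ij(2)]])
      moreover have "mat_map n U u M (i, k) \<boxtimes>\<^bsub>V\<^esub> mat_map n U u N (k, j) \<in> carrier V"
        if k: "k \<in> {1..n}" for k
        by (rule V.mult_closed[OF mat_alg_entry_closed[OF cl[OF M] ij(1) k] mat_alg_entry_closed[OF cl[OF N] k ij(2)]])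
      ultimately show "mat_map n U u (M \<boxtimes>\<^bsub>mat_alg n U\<^esub> N) (i, j)
          = (mat_map n U u M \<boxtimes>\<^bsub>mat_alg n V\<^esub> mat_map n U u N) (i, j)"
        unfolding entry[OF M.mult_closed[OF M N] ij] mat_alg_entries(3)[OF ij] fp[OF M N ij]
        by (intro V.add.finprod_cong') auto
    qed
  qed
qed

lemma mat_map_surj:
  assumes "u ` carrier U = carrier V"
  shows "mat_map n U u ` carrier (mat_alg n U) = carrier (mat_alg n V)"
proof
  let ?J = "{1..n} \<times> {1..n}"
  have mem: "M \<in> carrier (mat_alg n X) \<longleftrightarrow> M \<in> ?J \<rightarrow>\<^sub>E carrier X" for M and X :: "('x, 'k) star_algebra_scheme"
    by (simp add: mat_alg_def)
  show "mat_map n U u ` carrier (mat_alg n U) \<subseteq> carrier (mat_alg n V)"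
  proof (rule image_subsetI)
    fix M assume M: "M \<in> carrier (mat_alg n U)"
    have "u (M p) \<in> carrier V" if p: "p \<in> ?J" for p
    proof -
      have "M p \<in> carrier U" using M p unfolding mem by (rule PiE_mem)
      then show ?thesis using assms by blast
    qed
    then have "restrict (\<lambda>p. u (M p)) ?J \<in> ?J \<rightarrow>\<^sub>E carrier V" by (simp only: restrict_PiE_iff) blast
    then show "mat_map n U u M \<in> carrier (mat_alg n V)"
      unfolding mem mat_map_def using M by (simp only: restrict_apply' if_True)
  qed
  show "carrier (mat_alg n V) \<subseteq> mat_map n U u ` carrier (mat_alg n U)"
  proof
    fix N assume N: "N \<in> carrier (mat_alg n V)"
    define M where "M = restrict (\<lambda>p. inv_into (carrier U) u (N p)) ?J"
    have Np: "N p \<in> u ` carrier U" if p: "p \<in> ?J" for p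
    proof -
      have "N p \<in> carrier V" using N p unfolding mem by (rule PiE_mem)
      then show ?thesis by (simp only: assms)
    qed
    have M: "M \<in> carrier (mat_alg n U)"
      unfolding mem M_def restrict_PiE_iff by (intro ballI inv_into_into Np)
    have "mat_map n U u M = N"
    proof (rule PiE_ext)
      show "N \<in> ?J \<rightarrow>\<^sub>E carrier V" using N by (simp only: mem)
      have "mat_map n U u M \<in> carrier (mat_alg n V)"
        using \<open>mat_map n U u ` carrier (mat_alg n U) \<subseteq> carrier (mat_alg n V)\<close> M by blast
      then show "mat_map n U u M \<in> ?J \<rightarrow>\<^sub>E carrier V" by (simp only: mem)
      fix p assume p: "p \<in> ?J"
      have "mat_map n U u M p = u (M p)"
        unfolding mat_map_def restrict_apply'[OF M] restrict_apply'[OF p] ..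
      also have "M p = inv_into (carrier U) u (N p)"
        unfolding M_def restrict_apply'[OF p] ..
      finally show "mat_map n U u M p = N p" by (simp only: f_inv_into_f[OF Np[OF p]])
    qed
    then show "N \<in> mat_map n U u ` carrier (mat_alg n U)" using M by blast
  qed
qed

section \<open>Projectivity of the universal algebra\<close>

text \<open>
  A finite power of a set \<open>X\<close> that injects into an infinite set \<open>S\<close> injects into \<open>S\<close> as well.
\<close>

lemma infinite_PiE_embedding:
  fixes S :: "'u set" and q :: "'x \<Rightarrow> 'u"
  assumes S: "infinite S" and q: "inj_on q X" "q ` X \<subseteq> S" and "finite I"
  shows "\<exists>f. inj_on f (I \<rightarrow>\<^sub>E X) \<and> f ` (I \<rightarrow>\<^sub>E X) \<subseteq> S"
  using \<open>finite I\<close>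
proof (induction I rule: finite_induct)
  case empty
  obtain s where "s \<in> S" using S by fastforce
  then show ?case by (intro exI[of _ "\<lambda>_. s"]) auto
next
  case (insert a F)
  then obtain f where f: "inj_on f (F \<rightarrow>\<^sub>E X)" "f ` (F \<rightarrow>\<^sub>E X) \<subseteq> S" by blast
  obtain p where "bij_betw p (S \<times> S) S"
    using card_of_Times_same_infinite[OF S] card_of_ordIso by blast
  then have p: "inj_on p (S \<times> S)" "p ` (S \<times> S) \<subseteq> S" by (auto simp: bij_betw_def)
  define F' where "F' h = p (q (h a), f (restrict h F))" for h
  have m: "q (h a) \<in> S" "f (restrict h F) \<in> S" "h a \<in> X" "restrict h F \<in> F \<rightarrow>\<^sub>E X"
    if "h \<in> insert a F \<rightarrow>\<^sub>E X" for h
  proof -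
    show "restrict h F \<in> F \<rightarrow>\<^sub>E X" "h a \<in> X" using that by (auto simp: PiE_mem)
    then show "q (h a) \<in> S" "f (restrict h F) \<in> S" using q f by blast+
  qed
  have "inj_on F' (insert a F \<rightarrow>\<^sub>E X)"
  proof (rule inj_onI)
    fix h k assume h: "h \<in> insert a F \<rightarrow>\<^sub>E X" and k: "k \<in> insert a F \<rightarrow>\<^sub>E X" and "F' h = F' k"
    then have "(q (h a), f (restrict h F)) = (q (k a), f (restrict k F))"
      unfolding F'_def using m[OF h] m[OF k] by (intro inj_onD[OF p(1)]) auto
    then have "h a = k a" and r: "restrict h F = restrict k F"
      using m[OF h] m[OF k] inj_onD[OF q(1)] inj_onD[OF f(1)] by auto
    moreover have "h x = k x" if "x \<in> F" for x using fun_cong[OF r, of x] that by simp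
    ultimately show "h = k" by (intro PiE_ext[OF h k]) auto
  qed
  moreover have "F' ` (insert a F \<rightarrow>\<^sub>E X) \<subseteq> S" using m p by (auto simp: F'_def)
  ultimately show ?case by blast
qed

lemma ex_norm_mat_unitization:
  assumes "cstar_algebra B"
  shows "\<exists>N. cstar_algebra (with_norm (mat_alg n (unitization B)) N)"
proof -
  interpret U: unital_cstar_algebra "with_norm (unitization B) (unitization_norm B)" "new_unit B"
    by (rule cstar_algebra.unital_cstar_algebra_unitization[OF assms])
  show ?thesis using U.cstar_algebra_mat_alg[of n] by auto
qed

lemma (in cstar_algebra) nonzero_scale_inj:
  assumes b: "b \<in> carrier A" "b \<noteq> vzero A"
  shows "inj (\<lambda>c. c \<boxdot> b)"
proof (rule injI)
  fix c d assume eq: "c \<boxdot> b = d \<boxdot> b"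
  have "(c - d) \<boxdot> b = c \<boxdot> b \<boxplus> (-1) \<boxdot> d \<boxdot> b"
    using scale_add_left[OF b(1), of c "- d"] b by (simp add: scale_scale)
  also have "\<dots> = vzero A" unfolding eq using b by (simp add: scale_closed)
  finally have "cmod (c - d) * anorm A b = 0" using norm_scale[OF b(1), of "c - d"] by simp
  then show "c = d" using b by (simp add: norm_eq_zero)
qed

text \<open>
  A nonzero C*-algebra \<open>B\<close> contains a complex line, so it is infinite and absorbs the matrices over the
  unitization of any \<open>D\<close> that is no larger than \<open>B\<close>.
\<close>

lemma mat_unitization_embedding:
  fixes B D :: "'u cstar_algebra" and n :: nat
  assumes B: "cstar_algebra B" and nz: "carrier B \<noteq> {vzero B}" and sub: "carrier D \<subseteq> \<rho> ` carrier B"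
  shows "\<exists>f :: (nat \<times> nat \<Rightarrow> 'u \<times> complex) \<Rightarrow> 'u. inj_on f (carrier (mat_alg n (unitization D)))"
proof -
  interpret B: cstar_algebra B by (rule B)
  obtain b where b: "b \<in> carrier B" "b \<noteq> vzero B"
    using nz B.add.one_closed by blast
  note inj = B.nonzero_scale_inj[OF b]
  have range: "range (\<lambda>c. c \<boxdot>\<^bsub>B\<^esub> b) \<subseteq> carrier B" using b by (auto simp: B.scale_closed)
  have "infinite (UNIV :: complex set)" by (rule infinite_UNIV_char_0)
  then have S: "infinite (carrier B)"
    using range inj by (meson finite_imageD finite_subset)
  obtain p where "bij_betw p (carrier B \<times> carrier B) (carrier B)"
    using card_of_Times_same_infinite[OF S] card_of_ordIso by blast
  then have p: "inj_on p (carrier B \<times> carrier B)" "p ` (carrier B \<times> carrier B) \<subseteq> carrier B"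
    by (auto simp: bij_betw_def)
  define g where "g = inv_into (carrier B) \<rho>"
  have g: "inj_on g (carrier D)" "\<And>x. x \<in> carrier D \<Longrightarrow> g x \<in> carrier B"
    unfolding g_def using sub by (auto intro: inj_on_inv_into inv_into_into)
  define q where "q = (\<lambda>(x, c). p (g x, c \<boxdot>\<^bsub>B\<^esub> b))"
  have "inj_on q (carrier D \<times> UNIV)"
  proof (rule inj_onI; clarsimp simp: q_def)
    fix x c y d assume x: "x \<in> carrier D" and y: "y \<in> carrier D"
      and "p (g x, c \<boxdot>\<^bsub>B\<^esub> b) = p (g y, d \<boxdot>\<^bsub>B\<^esub> b)"
    then have "(g x, c \<boxdot>\<^bsub>B\<^esub> b) = (g y, d \<boxdot>\<^bsub>B\<^esub> b)"
      using g b by (intro inj_onD[OF p(1)]) (auto simp: B.scale_closed)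
    then show "x = y \<and> c = d" using inj_onD[OF g(1)] injD[OF inj] x y by auto
  qed
  moreover have "q ` (carrier D \<times> UNIV) \<subseteq> carrier B"
    using p(2) g(2) b by (auto simp: q_def B.scale_closed image_subset_iff)
  ultimately obtain f :: "(nat \<times> nat \<Rightarrow> 'u \<times> complex) \<Rightarrow> 'u"
    where "inj_on f ({1..n} \<times> {1..n} \<rightarrow>\<^sub>E carrier D \<times> UNIV)"
    using infinite_PiE_embedding[OF S, of q "carrier D \<times> UNIV" "{1..n} \<times> {1..n}"] by auto
  then show ?thesis by (auto simp: mat_alg_def)
qed

text \<open>
  An entry \<open>\<alpha>\<^sub>i\<^sub>j(a) 1 + f(a, i, j)\<close> is the pair of \<open>f(a, i, j)\<close> and the scalar \<open>\<alpha>\<^sub>i\<^sub>j(a)\<close>.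
\<close>

lemma W_map_eq:
  assumes "cstar_algebra B" and f: "f \<in> carrier A \<times> {1..n} \<times> {1..n} \<rightarrow> carrier B"
  shows "W_map n A \<alpha> B f = (\<lambda>a\<in>carrier A. \<lambda>(i, j)\<in>{1..n} \<times> {1..n}. (f (a, i, j), \<alpha> a (i, j)))"
proof -
  interpret B: cstar_algebra B by fact
  have "f (a, i, j) \<in> carrier B" if "a \<in> carrier A" "i \<in> {1..n}" "j \<in> {1..n}" for a i j
    using f that by auto
  then show ?thesis
    unfolding W_map_def by (intro restrict_ext) (auto simp: new_unit_def unit_embed_def)
qed

theorem theorem7p5:
  fixes n :: nat
    and A :: "'a cstar_algebra"
    and \<alpha> :: "'a \<Rightarrow> nat \<times> nat \<Rightarrow> complex"
    and W :: "'w cstar_algebra"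
    and \<iota> :: "'a \<times> nat \<times> nat \<Rightarrow> 'w"
  assumes "n \<ge> 1"
    and "projective TYPE('u) A"
    and "\<alpha> \<in> star_homs A (mat_alg n complex_alg)"
    and "is_W TYPE('u) n A \<alpha> W \<iota>"
  shows "projective TYPE('u) W"
proof -
  let ?I = "carrier A \<times> {1..n} \<times> {1..n}"
  have W: "cstar_algebra W" and \<iota>: "\<iota> \<in> ?I \<rightarrow> carrier W"
    and univ: "\<And>B :: 'u cstar_algebra. cstar_algebra B \<Longrightarrow>
      bij_betw (\<lambda>\<phi>. compose ?I \<phi> \<iota>) (star_homs W B) (W_functions n A \<alpha> B)"
    using assms(4) by (auto simp: is_W_def)
  interpret W: cstar_algebra W by (rule W)
  have lift: "\<exists>\<psi>\<in>star_homs W B. compose (carrier W) \<rho> \<psi> = \<phi>"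
    if B: "cstar_algebra B" and D: "cstar_algebra D" and \<rho>: "\<rho> \<in> star_homs B D"
      and surj: "\<rho> ` carrier B = carrier D" and \<phi>: "\<phi> \<in> star_homs W D"
    for B D :: "'u cstar_algebra" and \<rho> \<phi>
  proof (cases "carrier B = {vzero B}")
    case True
    interpret B: cstar_algebra B by (rule B)
    have "(\<lambda>x\<in>carrier W. vzero B) \<in> star_homs W B"
      by (rule star_homsI) (auto simp: W.scale_closed W.mult_closed W.adj_closed)
    moreover have "compose (carrier W) \<rho> (\<lambda>x\<in>carrier W. vzero B) = \<phi>"
    proof
      fix x
      have "\<phi> x = \<rho> (vzero B)" if "x \<in> carrier W"
        using star_hom_closed[OF \<phi> that] surj True by auto
      then show "compose (carrier W) \<rho> (\<lambda>x\<in>carrier W. vzero B) x = \<phi> x"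
        using PiE_arb[OF star_hom_extensional[OF \<phi>], of x] by (auto simp: compose_def)
    qed
    ultimately show ?thesis by blast
  next
    case False
    interpret B: cstar_algebra B by (rule B)
    interpret D: cstar_algebra D by (rule D)
    let ?UB = "unitization B" and ?UD = "unitization D"
    obtain NB where NB: "cstar_algebra (with_norm (mat_alg n ?UB) NB)"
      using ex_norm_mat_unitization[OF B] by blast
    obtain ND where ND: "cstar_algebra (with_norm (mat_alg n ?UD) ND)"
      using ex_norm_mat_unitization[OF D] by blast
    obtain eB :: "(nat \<times> nat \<Rightarrow> 'u \<times> complex) \<Rightarrow> 'u" where eB: "inj_on eB (carrier (mat_alg n ?UB))"
      using mat_unitization_embedding[OF B False, of B id n] by auto
    obtain eD :: "(nat \<times> nat \<Rightarrow> 'u \<times> complex) \<Rightarrow> 'u" where eD: "inj_on eD (carrier (mat_alg n ?UD))"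
      using mat_unitization_embedding[OF B False, of D \<rho> n] surj by auto
    define u where "u = restrict (unitization_map \<rho>) (carrier ?UB)"
    define P where "P = mat_map n ?UB u"
    have star: "star_algebra ?UB" "star_algebra ?UD" "star_algebra (mat_alg n ?UB)"
    "star_algebra (mat_alg n ?UD)"
      using B.unital_star_algebra_unitization D.unital_star_algebra_unitization NB ND
      by (auto simp: unital_star_algebra_def cstar_algebra_def)
    have u: "u \<in> star_homs ?UB ?UD"
      unfolding u_def by (rule unitization_map_hom[OF \<rho> B.star_algebra_axioms])
    have P: "P \<in> star_homs (mat_alg n ?UB) (mat_alg n ?UD)"
      unfolding P_def by (rule mat_map_hom[OF u star])
    have "u ` carrier ?UB = carrier ?UD"
    proof -
      have "u ` carrier ?UB = (\<lambda>p. (\<rho> (fst p), snd p)) ` (carrier B \<times> UNIV)"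
        unfolding u_def by (rule image_cong) (simp_all add: unitization_map_def unitization_def)
      also have "\<dots> = \<rho> ` carrier B \<times> UNIV" by force
      finally show ?thesis by (simp add: surj unitization_def)
    qed
    then have P_surj: "P ` carrier (mat_alg n ?UB) = carrier (mat_alg n ?UD)"
      unfolding P_def by (rule mat_map_surj)
    define f where "f = compose ?I \<phi> \<iota>"
    have f: "f \<in> W_functions n A \<alpha> D"
      using bij_betw_apply[OF univ[OF D] \<phi>] by (simp add: f_def)
    then have f_closed: "f \<in> ?I \<rightarrow>\<^sub>E carrier D" and "W_map n A \<alpha> D f \<in> star_homs A (mat_alg n ?UD)"
      by (auto simp: W_functions_def)
    then obtain \<Psi> where \<Psi>: "\<Psi> \<in> star_homs A (mat_alg n ?UB)"
      and \<Psi>_lift: "compose (carrier A) P \<Psi> = W_map n A \<alpha> D f"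
      using projective_lift[OF assms(2) NB ND, of eB eD P "W_map n A \<alpha> D f"] eB eD P P_surj by auto
    (* the lift has scalar part alpha since P preserves scalar parts *)
    have entry: "\<rho> (fst (\<Psi> a (i, j))) = f (a, i, j)" "snd (\<Psi> a (i, j)) = \<alpha> a (i, j)"
      "fst (\<Psi> a (i, j)) \<in> carrier B"
      if a: "a \<in> carrier A" and ij: "i \<in> {1..n}" "j \<in> {1..n}" for a i j
    proof -
      have c: "\<Psi> a (i, j) \<in> carrier ?UB"
        by (rule mat_alg_entry_closed[OF star_hom_closed[OF \<Psi> a] ij])
      then show "fst (\<Psi> a (i, j)) \<in> carrier B" by (auto simp: unitization_def)
      have "P (\<Psi> a) (i, j) = W_map n A \<alpha> D f a (i, j)"
        using fun_cong[OF fun_cong[OF \<Psi>_lift, of a], of "(i, j)"] a by (simp add: compose_eq)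
      moreover have "P (\<Psi> a) (i, j) = (\<rho> (fst (\<Psi> a (i, j))), snd (\<Psi> a (i, j)))"
        using c ij star_hom_closed[OF \<Psi> a] by (simp add: P_def mat_map_def u_def unitization_map_def)
      moreover have "W_map n A \<alpha> D f a (i, j) = (f (a, i, j), \<alpha> a (i, j))"
        using W_map_eq[OF D, of f A n] f_closed a ij by (auto simp: PiE_def)
      ultimately show "\<rho> (fst (\<Psi> a (i, j))) = f (a, i, j)" "snd (\<Psi> a (i, j)) = \<alpha> a (i, j)" by auto
    qed
    define f' where "f' = (\<lambda>(a, i, j)\<in>?I. fst (\<Psi> a (i, j)))"
    have f': "f' \<in> ?I \<rightarrow>\<^sub>E carrier B" using entry(3) by (auto simp: f'_def)
    have "W_map n A \<alpha> B f' = \<Psi>"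
    proof -
      have eq: "W_map n A \<alpha> B f'
          = (\<lambda>a\<in>carrier A. \<lambda>(i, j)\<in>{1..n} \<times> {1..n}. (f' (a, i, j), \<alpha> a (i, j)))"
        using f' by (intro W_map_eq[OF B]) (auto simp: PiE_def)
      show ?thesis
      proof
        fix a show "W_map n A \<alpha> B f' a = \<Psi> a"
        proof (cases "a \<in> carrier A")
          case True
          have "\<Psi> a \<in> {1..n} \<times> {1..n} \<rightarrow>\<^sub>E carrier ?UB"
            using star_hom_closed[OF \<Psi> True] by (simp add: mat_alg_def)
          then have "\<Psi> a p = undefined" if "p \<notin> {1..n} \<times> {1..n}" for p using that PiE_arb by metis
          then show ?thesis
            unfolding eq using True entry(2)[OF True] by (auto simp: f'_def fun_eq_iff prod_eq_iff)
        next
          case False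
          then show ?thesis
            unfolding eq using PiE_arb[OF star_hom_extensional[OF \<Psi>] False] by simp
        qed
      qed
    qed
    then have "f' \<in> W_functions n A \<alpha> B" using f' \<Psi> by (simp add: W_functions_def)
    then have "f' \<in> (\<lambda>\<psi>. compose ?I \<psi> \<iota>) ` star_homs W B"
      unfolding bij_betw_imp_surj_on[OF univ[OF B]] .
    then obtain \<psi> where \<psi>: "\<psi> \<in> star_homs W B" and \<psi>_eq: "compose ?I \<psi> \<iota> = f'"
      by blast
    have comp: "compose (carrier W) \<rho> \<psi> \<in> star_homs W D"
      by (rule star_hom_compose[OF W.star_algebra_axioms \<psi> \<rho>])
    have "compose ?I (compose (carrier W) \<rho> \<psi>) \<iota> = compose ?I \<phi> \<iota>"
    proof
      fix x
      show "compose ?I (compose (carrier W) \<rho> \<psi>) \<iota> x = compose ?I \<phi> \<iota> x"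
      proof (cases "x \<in> ?I")
        case True
        then obtain a i j where x: "x = (a, i, j)" "a \<in> carrier A" "i \<in> {1..n}" "j \<in> {1..n}" by auto
        have "\<iota> x \<in> carrier W" using \<iota> True by (rule funcset_mem)
        then have "compose ?I (compose (carrier W) \<rho> \<psi>) \<iota> x = \<rho> (\<psi> (\<iota> x))"
          using True by (simp add: compose_eq)
        also have "\<psi> (\<iota> x) = f' x" using fun_cong[OF \<psi>_eq, of x] True by (simp add: compose_eq)
        also have "\<rho> (f' x) = f x" using entry(1)[OF x(2-)] x by (simp add: f'_def)
        finally show ?thesis by (simp add: f_def)
      qed (simp add: compose_def)
    qed
    then have "compose (carrier W) \<rho> \<psi> = \<phi>"
      using univ[OF D] comp \<phi> by (auto simp: bij_betw_def dest: inj_onD)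
    then show ?thesis using \<psi> by blast
  qed
  show ?thesis unfolding projective_def using W lift by blast
qed

end
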